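(* For $1<p<11$ and $c>0$ let $\mathcal{M}_p(c)=\inf\{\mathcal{E}_p(u): u\in X,\ \|u\|_{L^2(\mathbb{R}^3)}^2=c\}$, where $X=\{u\in H^1(\mathbb{R}^3): u|Du|\in L^2(\mathbb{R}^3)\}$ and $\mathcal{E}_p(u)=\frac12\int_{\mathbb{R}^3}(1+2u^2)|Du|^2\,dx-\frac{1}{p+1}\int_{\mathbb{R}^3}|u|^{p+1}\,dx$. Let $S_{\rm sob}=\frac{2^{1/3}}{\sqrt{3\pi}}\frac{1}{\Gamma^{1/3}(3/2)}$. Then the following properties hold. (1) For every $\frac73\le p<\frac{13}{3}$ and every $c>0$, $$\mathcal{M}_p(c)\le \inf_{\sigma>0}\Big(\sigma^2\frac{3c}{4}+\sigma^5\frac{3c^2}{8\sqrt2\,\pi^{3/2}}-\sigma^{\frac{3(p-1)}{2}}\frac{2\sqrt2\,c^{\frac{p+1}{2}}\pi^{\frac32-\frac{3(p+1)}{4}}}{(p+1)^{5/2}}\Big).$$ (2) For every $\frac73\le p<\frac{13}{3}$, setting $\mathcal{K}_p:=4^{\frac{3p-3}{10}}S_{\rm sob}^{\frac{3p-3}{5}}$, for every $c>0$, $$\mathcal{M}_p(c)\ge -\frac{13-3p}{3(p-1)}\Big(\frac{10(p+1)}{3(p-1)\mathcal{K}_p}\Big)^{\frac{10}{3p-13}}c^{\frac{11-p}{13-3p}}.$$ (3) For $p=\frac73$, setting $A:=\frac{2\sqrt2\,3^{5/2}}{10^{5/2}\pi}$, $B:=\frac{3^{2/3}}{2^{7/3}\pi}$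 and $c_\sharp:=\Big(\frac{10^{5/2}\pi}{2^{7/2}3^{3/2}}\Big)^{3/2}$, for every $c>0$, $$\mathcal{M}_{7/3}(c)\le\begin{cases}0 & \text{if } c\le c_\sharp,\\[2pt] -\Big[\big(\tfrac25\big)^{2/3}-\big(\tfrac25\big)^{5/3}\Big]\dfrac{\big[Ac^{5/3}-\frac{3c}{4}\big]^{5/3}}{Bc^{4/3}} & \text{if } c\ge c_\sharp.\end{cases}$$ In particular, there exists a constant $M>0$ such that $\mathcal{M}_{7/3}(c)\le -Mc^{13/9}$ for all sufficiently large $c>0$. (4) If $p=\frac{13}{3}$, setting $\mathcal{K}_{13/3}:=4S_{\rm sob}^2$ and $c_\flat:=\Big(\frac{16}{3\mathcal{K}_{13/3}}\Big)^{3/2}\approx 19.73$, for every $0<c\le c_\flat$ one has $\mathcal{M}_{13/3}(c)=0$ and the infimum $\mathcal{M}_{13/3}(c)$ is not attained. (5) If $p=\frac{13}{3}$, setting $c^\flat:=\frac{3^{3/2}(16/3)^{15/4}\pi^{3/2}}{32^{3/2}}\approx 85.09$, one has $\mathcal{M}_{13/3}(c)=-\infty$ for every $c>c^\flat$.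
   Context: $Du$ denotes the (weak) gradient of $u$, functions in $H^1(\mathbb{R}^3)$ are real-valued, and $\Gamma$ is the Gamma function. The number $S_{\rm sob}$ is the best Sobolev constant in dimension 3, i.e. the best constant in $\|u\|_{L^6(\mathbb{R}^3)}\le S_{\rm sob}\|Du\|_{L^2(\mathbb{R}^3)}$. The infimum $\mathcal{M}_p(c)$ is "attained" if there is $u\in X$ with $\|u\|_{L^2(\mathbb{R}^3)}^2=c$ and $\mathcal{E}_p(u)=\mathcal{M}_p(c)$. The constant $c_\sharp$ in (3) is just the explicit number defined there. *)

theory Defs
  imports "HOL-Analysis.Analysis"
begin

text \<open>
  Elements of \<open>L\<^sup>2\<close> and \<open>H\<^sup>1\<close> are represented by Lebesgue measurable functions, not by
  equivalence classes modulo null sets.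
\<close>

definition L2 :: "('a::euclidean_space \<Rightarrow> 'b::euclidean_space) set" where
  "L2 = {f. f \<in> borel_measurable lebesgue \<and> integrable lebesgue (\<lambda>x. (norm (f x))\<^sup>2)}"

definition L2_norm :: "('a::euclidean_space \<Rightarrow> 'b::euclidean_space) \<Rightarrow> real" where
  "L2_norm f = sqrt (LINT x|lebesgue. (norm (f x))\<^sup>2)"

text \<open>
  \<open>C_times k f\<close>: the function \<open>f\<close> is of class \<open>C\<^sup>k\<close> on the whole space, i.e. it is differentiable
  and all its first partial derivatives are of class \<open>C\<^sup>k\<^sup>-\<^sup>1\<close>.
\<close>

primrec C_times :: "nat \<Rightarrow> ('a::euclidean_space \<Rightarrow> real) \<Rightarrow> bool" where
  "C_times 0 f \<longleftrightarrow> continuous_on UNIV f"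
| "C_times (Suc k) f \<longleftrightarrow> f differentiable_on UNIV \<and>
     (\<forall>b\<in>Basis. C_times k (\<lambda>x. frechet_derivative f (at x) b))"

definition test_function :: "('a::euclidean_space \<Rightarrow> real) \<Rightarrow> bool" where
  "test_function \<phi> \<longleftrightarrow> (\<forall>k. C_times k \<phi>) \<and> compact (closure {x. \<phi> x \<noteq> 0})"

definition locally_integrable :: "('a::euclidean_space \<Rightarrow> 'b::euclidean_space) \<Rightarrow> bool" where
  "locally_integrable f \<longleftrightarrow> (\<forall>K. compact K \<longrightarrow> f absolutely_integrable_on K)"

definition is_weak_gradient :: "('a::euclidean_space \<Rightarrow> real) \<Rightarrow> ('a \<Rightarrow> 'a) \<Rightarrow> bool" where
  "is_weak_gradient u g \<longleftrightarrow> locally_integrable u \<and> locally_integrable g \<and>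
     (\<forall>\<phi>. test_function \<phi> \<longrightarrow> (\<forall>b\<in>Basis.
        (LINT x|lebesgue. u x * frechet_derivative \<phi> (at x) b) =
        - (LINT x|lebesgue. (g x \<bullet> b) * \<phi> x)))"

text \<open>
  The weak gradient is unique up to null sets, so that nothing below depends on which
  representative is selected.
\<close>

definition weak_grad :: "('a::euclidean_space \<Rightarrow> real) \<Rightarrow> 'a \<Rightarrow> 'a" where
  "weak_grad u = (SOME g. is_weak_gradient u g)"

definition H1 :: "('a::euclidean_space \<Rightarrow> real) set" where
  "H1 = {u. u \<in> L2 \<and> (\<exists>g. is_weak_gradient u g \<and> g \<in> L2)}"

definition X_space :: "(real^3 \<Rightarrow> real) set" where
  "X_space = {u \<in> H1. (\<lambda>x. u x * norm (weak_grad u x)) \<in> L2}"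

definition energy :: "real \<Rightarrow> (real^3 \<Rightarrow> real) \<Rightarrow> real" where
  "energy p u =
     1/2 * (LINT x|lebesgue. (1 + 2 * (u x)\<^sup>2) * (norm (weak_grad u x))\<^sup>2)
     - 1/(p + 1) * (LINT x|lebesgue. \<bar>u x\<bar> powr (p + 1))"

definition mass_sphere :: "real \<Rightarrow> (real^3 \<Rightarrow> real) set" where
  "mass_sphere c = {u \<in> X_space. (L2_norm u)\<^sup>2 = c}"

text \<open>The infimum is taken in the extended reals, since it may be \<open>-\<infinity>\<close>.\<close>

definition min_energy :: "real \<Rightarrow> real \<Rightarrow> ereal" where
  "min_energy p c = (INF u\<in>mass_sphere c. ereal (energy p u))"

definition min_energy_attained :: "real \<Rightarrow> real \<Rightarrow> bool" where
  "min_energy_attained p c \<longleftrightarrow> (\<exists>u\<in>mass_sphere c. ereal (energy p u) = min_energy p c)"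

definition S_sob :: real where
  "S_sob = 2 powr (1/3) / sqrt (3 * pi) * (1 / Gamma (3/2) powr (1/3))"

definition K_const :: "real \<Rightarrow> real" where
  "K_const p = 4 powr ((3 * p - 3) / 10) * S_sob powr ((3 * p - 3) / 5)"

definition A_const :: real where
  "A_const = 2 * sqrt 2 * 3 powr (5/2) / (10 powr (5/2) * pi)"

definition B_const :: real where
  "B_const = 3 powr (2/3) / (2 powr (7/3) * pi)"

definition c_sharp :: real where
  "c_sharp = (10 powr (5/2) * pi / (2 powr (7/2) * 3 powr (3/2))) powr (3/2)"

definition K_crit :: real where
  "K_crit = 4 * S_sob\<^sup>2"

definition c_flat_lower :: real where
  "c_flat_lower = (16 / (3 * K_crit)) powr (3/2)"

definition c_flat_upper :: real where
  "c_flat_upper = 3 powr (3/2) * (16/3) powr (15/4) * pi powr (3/2) / 32 powr (3/2)"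

end

theory Submission
  imports Defs "HOL-Probability.Distributions"
begin

text \<open>
  The upper bounds come from Gaussians. For the Gaussian of mass \<open>c\<close> and inverse width \<open>\<sigma>\<close> the three
  integrals in the energy are explicit (\<open>gaussian_energy\<close>), and everything else on this side is
  calculus in \<open>\<sigma>\<close>: spreading out gives \<open>min_energy p c \<le> 0\<close>, optimising at \<open>p = 7/3\<close> gives the explicit
  negative bound, and at \<open>p = 13/3\<close> concentration drives the energy to \<open>-\<infinity>\<close> as soon as the potential term
  dominates.

  The lower bounds rest on a single inequality for \<open>v = u\<^sup>2\<close>, where \<open>\<integral> \<bar>Dv\<bar>\<^sup>2 = 4 \<integral> u\<^sup>2 \<bar>Du\<bar>\<^sup>2\<close>, namely
  \<open>\<integral> v\<^sup>8\<^sup>/\<^sup>3 \<le> \<kappa> (\<integral> v)\<^sup>2\<^sup>/\<^sup>3 \<integral> \<bar>Dv\<bar>\<^sup>2\<close>. It bounds the critical power of \<open>u\<close> linearly by \<open>\<integral> u\<^sup>2 \<bar>Du\<bar>\<^sup>2\<close>, and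
  subcritical powers follow by interpolation with the mass. The constants in the lower bounds are
  those for \<open>\<kappa> = S_sob\<^sup>2\<close>, about \<open>0.1826\<close>, which is what the best Sobolev inequality for \<open>v\<close> and Hoelder's
  inequality would give. That combination is not sharp, since an extremal of Sobolev's
  inequality is not one of Hoelder's. This leaves room for a direct proof that does not pass through
  Sobolev's inequality: \<open>\<kappa> = 9/50\<close> suffices (\<open>K_crit_gt\<close>). Because it is strictly smaller than
  \<open>S_sob\<^sup>2\<close>, the energy is strictly positive for all masses up to \<open>c_flat_lower\<close>, which excludes minimisers.

  The inequality is proved by mass transport. For a continuously differentiable \<open>v \<ge> 0\<close> with compact support,
  the Knothe map \<open>T\<close> transports the normalised density \<open>f = v\<^sup>8\<^sup>/\<^sup>3\<close> to the uniform density on the cube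
  \<open>[-1,1]\<^sup>3\<close>. Each coordinate of \<open>T\<close> is an explicit conditional distribution function, its diagonal
  derivatives have product \<open>8 f / \<integral> f\<close>, and the inequality of arithmetic and geometric means gives
  \<open>6 (\<integral> f)\<^sup>2\<^sup>/\<^sup>3 \<le> \<integral> v\<^sup>1\<^sup>6\<^sup>/\<^sup>9 div T = - (16/9) \<integral> v\<^sup>7\<^sup>/\<^sup>9 Dv \<bullet> T\<close>. The gain over a crude bound of \<open>T\<close> by the
  size of the cube lies in the sixth moment of the uniform distribution: \<open>\<integral> f T\<^sub>i\<^sup>6 = (\<integral> f) / 7\<close>. Young's
  inequality with two scales, optimised at the end, yields \<open>\<kappa> = 7/50\<close> (\<open>gagliardo_nirenberg_compact\<close>).

  Passing to general \<open>u\<close> requires the weak derivative of \<open>u\<^sup>2\<close> (\<open>weak_partial_square\<close>), mollification, truncation and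
  Fatou's lemma (\<open>gagliardo_nirenberg_weak\<close>), where the margin between \<open>7/50\<close> and \<open>9/50\<close> absorbs the error of
  the truncation. All convergence statements about mollification are derived from one, that the
  mean oscillation of an integrable function at the scale of the kernel tends to zero
  (\<open>moll_osc_tendsto_0\<close>).
\<close>

section \<open>Smooth functions with compact support\<close>

text \<open>
  The functions \<open>t\<^sup>-\<^sup>m exp (-1/t)\<close>, extended by \<open>0\<close> to \<open>t \<le> 0\<close>. Carrying the
  exponent \<open>m\<close> along keeps the derivative inside the family.
\<close>

definition flat :: "nat \<Rightarrow> real \<Rightarrow> real" where
  "flat m t = (if t > 0 then inverse t ^ m * exp (- inverse t) else 0)"

lemma flat_nonneg: "0 \<le> flat m t"
  by (simp add: flat_def)

lemma flat_pos: "0 < t \<Longrightarrow> 0 < flat m t"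
  by (simp add: flat_def)

lemma flat_tendsto_0: "(flat m \<longlongrightarrow> 0) (at 0)"
proof -
  have 1: "((\<lambda>r::real. r ^ m * exp (- r)) \<longlongrightarrow> 0) at_top"
    using tendsto_power_div_exp_0[of m] by (simp add: exp_minus field_simps)
  have "((\<lambda>t. inverse t ^ m * exp (- inverse t)) \<longlongrightarrow> 0) (at_right (0::real))"
    by (rule filterlim_compose[OF 1 filterlim_inverse_at_top_right])
  then have R: "(flat m \<longlongrightarrow> 0) (at_right 0)"
    by (rule Lim_transform_eventually)
       (auto simp: flat_def eventually_at_filter)
  have L: "(flat m \<longlongrightarrow> 0) (at_left 0)"
    by (rule Lim_transform_eventually[OF tendsto_const])
       (auto simp: flat_def eventually_at_filter)
  from R L show ?thesis by (simp add: filterlim_split_at)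
qed

lemma flat_has_derivative:
  "(flat m has_real_derivative flat (m + 2) t - real m * flat (m + 1) t) (at t)"
proof (cases "t > 0" "t < 0" rule: bool.exhaust[case_product bool.exhaust])
  case True_True
  then show ?thesis by simp
next
  case True_False
  then have t: "t > 0" by simp
  have "((\<lambda>t. inverse t ^ m) has_real_derivative
          real m * (- (inverse t ^ Suc (Suc 0)) * inverse t ^ (m - Suc 0))) (at t)"
    using t by (intro DERIV_power DERIV_inverse) auto
  then have P: "((\<lambda>t. inverse t ^ m) has_real_derivative - real m * inverse t ^ (m + 1)) (at t)"
    by (cases m) (simp_all add: algebra_simps)
  have E: "((\<lambda>t. exp (- inverse t)) has_real_derivative exp (- inverse t) * inverse t ^ 2) (at t)"
    using t by (auto intro!: derivative_eq_intros simp: power2_eq_square)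
  have "((\<lambda>t. inverse t ^ m * exp (- inverse t)) has_real_derivative
          flat (m + 2) t - real m * flat (m + 1) t) (at t)"
    using DERIV_mult[OF P E] t by (simp add: flat_def power2_eq_square algebra_simps)
  then show ?thesis
    by (rule has_field_derivative_transform_within_open[of _ _ _ "{0<..}"])
       (use t in \<open>auto simp: flat_def\<close>)
next
  case False_True
  have "((\<lambda>t. 0) has_real_derivative flat (m + 2) t - real m * flat (m + 1) t) (at t)"
    using False_True by (auto simp: flat_def)
  then show ?thesis
    by (rule has_field_derivative_transform_within_open[of _ _ _ "{..<0}"])
       (use False_True in \<open>auto simp: flat_def\<close>)
next
  case False_False
  then have t: "t = 0" by simp
  have "((\<lambda>h. flat m h / h) \<longlongrightarrow> 0) (at 0)"
    by (rule Lim_transform_eventually[OF flat_tendsto_0[of "Suc m"]])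
       (auto simp: flat_def eventually_at_filter field_simps)
  then show ?thesis
    unfolding t by (simp add: has_field_derivative_iff flat_def)
qed

text \<open>
  An inductive class of functions that contains every test function used below and is closed under
  directional derivatives. Smoothness of all orders then follows by one induction, without
  computing higher derivatives.
\<close>

inductive smooth_term :: "('a::euclidean_space \<Rightarrow> real) \<Rightarrow> bool" where
  const: "smooth_term (\<lambda>x. c)"
| coord: "smooth_term (\<lambda>x. x \<bullet> b)"
| bump: "smooth_term (\<lambda>x. flat m (r - (x - a) \<bullet> (x - a)))"
| add: "smooth_term f \<Longrightarrow> smooth_term g \<Longrightarrow> smooth_term (\<lambda>x. f x + g x)"
| mult: "smooth_term f \<Longrightarrow> smooth_term g \<Longrightarrow> smooth_term (\<lambda>x. f x * g x)"

lemma smooth_term_has_derivative: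
  assumes "smooth_term f"
  shows "\<exists>f'. (\<forall>x. (f has_derivative f' x) (at x)) \<and> (\<forall>b. smooth_term (\<lambda>x. f' x b))"
  using assms
proof induction
  case (const c)
  show ?case
    by (rule exI[of _ "\<lambda>x b. 0"]) (auto intro: smooth_term.const)
next
  case (coord b)
  show ?case
    by (rule exI[of _ "\<lambda>x h. h \<bullet> b"])
       (auto intro!: smooth_term.intros derivative_eq_intros)
next
  case (bump m r a)
  define d where "d x h = (flat (m + 2) (r - (x - a) \<bullet> (x - a)) +
        - real m * flat (m + 1) (r - (x - a) \<bullet> (x - a))) * (-2 * (x \<bullet> h + - (a \<bullet> h)))" for x h
  have "((\<lambda>x. flat m (r - (x - a) \<bullet> (x - a))) has_derivative d x) (at x)" for x
  proof -
    have 1: "((\<lambda>x. r - (x - a) \<bullet> (x - a)) has_derivative (\<lambda>h. -2 * (x \<bullet> h + - (a \<bullet> h)))) (at x)"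
      by (auto intro!: derivative_eq_intros simp: algebra_simps inner_commute)
    from has_derivative_compose[OF 1 flat_has_derivative[of m, unfolded has_field_derivative_def]]
    show ?thesis
      by (simp add: d_def[abs_def] mult.commute)
  qed
  moreover have "smooth_term (\<lambda>x. d x h)" for h
    unfolding d_def by (intro smooth_term.intros)
  ultimately show ?case by blast
next
  case (add f g)
  then obtain f' g' where
    "\<And>x. (f has_derivative f' x) (at x)" "\<And>b. smooth_term (\<lambda>x. f' x b)"
    "\<And>x. (g has_derivative g' x) (at x)" "\<And>b. smooth_term (\<lambda>x. g' x b)" by blast
  then show ?case
    by (intro exI[of _ "\<lambda>x b. f' x b + g' x b"])
       (auto intro!: smooth_term.add has_derivative_add)
next
  case (mult f g)
  then obtain f' g' where
    "\<And>x. (f has_derivative f' x) (at x)" "\<And>b. smooth_term (\<lambda>x. f' x b)"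
    "\<And>x. (g has_derivative g' x) (at x)" "\<And>b. smooth_term (\<lambda>x. g' x b)" by blast
  then show ?case using mult
    by (intro exI[of _ "\<lambda>x b. f x * g' x b + f' x b * g x"])
       (auto intro!: smooth_term.add smooth_term.mult has_derivative_mult)
qed

lemma smooth_term_C_times: "smooth_term f \<Longrightarrow> C_times k f"
proof (induction k arbitrary: f)
  case 0
  then obtain f' where "\<And>x. (f has_derivative f' x) (at x)"
    using smooth_term_has_derivative by blast
  then show ?case
    by (auto simp: continuous_on_eq_continuous_at dest: has_derivative_continuous)
next
  case (Suc k)
  then obtain f' where f': "\<And>x. (f has_derivative f' x) (at x)" "\<And>b. smooth_term (\<lambda>x. f' x b)"
    using smooth_term_has_derivative by blast
  have "frechet_derivative f (at x) = f' x" for x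
    using f'(1) by (metis frechet_derivative_at)
  with f' Suc.IH show ?case
    by (auto simp: differentiable_on_def differentiable_def)
qed

lemma test_function_smooth_term:
  assumes "smooth_term f" "\<And>x. x \<notin> cball a r \<Longrightarrow> f x = 0"
  shows "test_function f"
proof -
  have "closure {x. f x \<noteq> 0} \<subseteq> cball a r"
    by (rule closure_minimal) (use assms(2) in \<open>auto simp del: mem_cball\<close>)
  then have "compact (closure {x. f x \<noteq> 0})"
    by (meson bounded_cball bounded_subset closed_closure compact_eq_bounded_closed)
  with assms(1) show ?thesis
    by (simp add: test_function_def smooth_term_C_times)
qed

definition moll_rad :: "nat \<Rightarrow> real" where "moll_rad n = inverse (real (Suc n))"

definition bump0 :: "nat \<Rightarrow> 'a::euclidean_space \<Rightarrow> real" where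
  "bump0 n z = flat 0 ((moll_rad n)\<^sup>2 - z \<bullet> z)"

text \<open>
  The mollifying kernel: \<open>moll n\<close> is even, nonnegative, of integral \<open>1\<close>, and vanishes outside the
  ball of radius \<open>moll_rad n\<close>.
\<close>

definition moll :: "nat \<Rightarrow> 'a::euclidean_space \<Rightarrow> real" where
  "moll n z = bump0 n z / (LINT y|lborel. bump0 n (y::'a))"

lemma moll_rad_pos: "0 < moll_rad n" and moll_rad_le_1: "moll_rad n \<le> 1"
  by (auto simp: moll_rad_def field_simps)

lemma moll_rad_tendsto: "moll_rad \<longlonglongrightarrow> 0"
  unfolding moll_rad_def by (rule LIMSEQ_inverse_real_of_nat)

lemma continuous_flat: "continuous_on UNIV (flat m)"
  using flat_has_derivative by (meson DERIV_isCont continuous_at_imp_continuous_on)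

lemma continuous_bump0: "continuous_on UNIV (bump0 n)"
  unfolding bump0_def
  by (rule continuous_on_compose2[OF continuous_flat]) (auto intro!: continuous_intros)

lemma bump0_nonneg: "0 \<le> bump0 n z" by (simp add: bump0_def flat_nonneg)

lemma bump0_eq_0: "moll_rad n \<le> norm z \<Longrightarrow> bump0 n z = 0"
proof -
  assume "moll_rad n \<le> norm z"
  then have "(moll_rad n)\<^sup>2 \<le> (norm z)\<^sup>2"
    using moll_rad_pos[of n] by (intro power_mono) auto
  then show ?thesis by (simp add: bump0_def flat_def dot_square_norm)
qed

lemma bump0_integrable: "integrable lborel (bump0 n :: 'a::euclidean_space \<Rightarrow> real)"
proof -
  have "set_integrable lborel (cball 0 1) (bump0 n :: 'a \<Rightarrow> real)"
    unfolding set_integrable_def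
    by (rule borel_integrable_compact)
       (auto intro: continuous_on_subset[OF continuous_bump0])
  moreover have "indicator (cball 0 1) z *\<^sub>R bump0 n z = bump0 n z" for z :: 'a
    using bump0_eq_0[of n z] moll_rad_le_1[of n] by (auto simp: indicator_def)
  ultimately show ?thesis by (simp only: set_integrable_def)
qed

lemma bump0_integral_pos: "0 < (LINT y|lborel. bump0 n (y::'a::euclidean_space))"
proof -
  have ne: "(LINT y|lborel. bump0 n (y::'a)) \<noteq> 0"
  proof
    assume "(LINT y|lborel. bump0 n (y::'a)) = 0"
    then have ae: "AE y in lborel. bump0 n (y::'a) = 0"
      using integral_nonneg_eq_0_iff_AE[OF bump0_integrable[of n, where 'a='a]]
      by (simp add: bump0_nonneg)
    have "bump0 n (y::'a) \<noteq> 0" if "y \<in> ball 0 (moll_rad n)" for y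
    proof -
      have "(norm y)\<^sup>2 < (moll_rad n)\<^sup>2"
        using that by (intro power_strict_mono) auto
      then show ?thesis
        using flat_pos[of "(moll_rad n)\<^sup>2 - y \<bullet> y" 0] by (simp add: bump0_def dot_square_norm)
    qed
    then have "AE y in lborel. y \<notin> ball (0::'a) (moll_rad n)"
      using ae by (auto elim!: eventually_mono)
    then have "ball (0::'a) (moll_rad n) \<in> null_sets lborel"
      by (subst AE_iff_null_sets) auto
    then have "emeasure lborel (ball (0::'a) (moll_rad n)) = 0" by auto
    then show False
      using open_not_negligible[of "ball (0::'a) (moll_rad n)"] moll_rad_pos[of n]
      by (auto simp: negligible_iff_null_sets null_sets_completion_iff null_sets_def)
  qed
  have "0 \<le> (LINT y|lborel. bump0 n (y::'a))"
    by (rule integral_nonneg_AE) (simp add: bump0_nonneg)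
  with ne show ?thesis by simp
qed

lemma moll_nonneg: "0 \<le> moll n z"
  using bump0_integral_pos[of n] by (simp add: moll_def bump0_nonneg)

lemma moll_minus: "moll n (- z) = moll n z"
  by (simp add: moll_def bump0_def)

lemma moll_commute: "moll n (x - y) = moll n (y - x)"
  using moll_minus[of n "x - y"] by simp

lemma moll_eq_0: "moll_rad n \<le> norm z \<Longrightarrow> moll n z = 0"
  by (simp add: moll_def bump0_eq_0)

lemma moll_integrable: "integrable lborel (moll n :: 'a::euclidean_space \<Rightarrow> real)"
  unfolding moll_def by (intro integrable_divide bump0_integrable)

lemma moll_integral: "(LINT y|lborel. moll n (y::'a::euclidean_space)) = 1"
  unfolding moll_def using bump0_integral_pos[of n, where 'a='a] by simp

lemma continuous_moll: "continuous_on UNIV (moll n :: 'a::euclidean_space \<Rightarrow> real)"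
  unfolding moll_def
  by (intro continuous_intros continuous_bump0) (use bump0_integral_pos[of n, where 'a='a] in auto)

lemma borel_measurable_moll [measurable]: "moll n \<in> borel_measurable borel"
  by (rule borel_measurable_continuous_onI[OF continuous_moll])

lemma smooth_term_moll: "smooth_term (\<lambda>x. moll n (x - a))"
proof -
  have "smooth_term (\<lambda>x. inverse (LINT y|lborel. bump0 n (y::'a)) *
          flat 0 ((moll_rad n)\<^sup>2 - (x - a) \<bullet> (x - a)))"
    by (intro smooth_term.intros)
  then show ?thesis by (simp add: moll_def bump0_def field_simps)
qed

lemma test_function_moll: "test_function (\<lambda>x. moll n (x - a))"
  by (rule test_function_smooth_term[OF smooth_term_moll, of a "moll_rad n"])
     (auto intro!: moll_eq_0 simp: dist_norm norm_minus_commute)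

lemma test_function_moll_mult: "test_function (\<lambda>x. moll n (x - a) * moll m (x - b))"
  by (rule test_function_smooth_term[OF smooth_term.mult[OF smooth_term_moll smooth_term_moll], of a "moll_rad n"])
     (auto intro!: moll_eq_0 simp: dist_norm norm_minus_commute)

lemma nn_integral_moll: "(\<integral>\<^sup>+ y. ennreal (moll n (x - y)) \<partial>lborel) = 1" for x :: "'a::euclidean_space"
proof -
  have "(\<integral>\<^sup>+ y. ennreal (moll n (y::'a)) \<partial>lborel) = ennreal 1"
    by (subst nn_integral_eq_integral) (auto simp: moll_integrable moll_nonneg moll_integral)
  moreover have "(\<integral>\<^sup>+ y. ennreal (moll n (y - x)) \<partial>lborel) = (\<integral>\<^sup>+ y. ennreal (moll n (y::'a)) \<partial>lborel)"
  proof -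
    have "(\<integral>\<^sup>+ y. ennreal (moll n (y::'a)) \<partial>lborel) = (\<integral>\<^sup>+ y. ennreal (moll n y) \<partial>distr lborel borel ((+) (- x)))"
      by (simp only: lborel_distr_plus)
    also have "\<dots> = (\<integral>\<^sup>+ y. ennreal (moll n (- x + y)) \<partial>lborel)"
      by (rule nn_integral_distr) auto
    finally show ?thesis by simp
  qed
  ultimately show ?thesis by (simp add: moll_commute[of n x])
qed

section \<open>Mollification in mean\<close>

lemma moll_bounded: "\<exists>C. \<forall>z::'a::euclidean_space. moll n z \<le> C"
proof -
  have "bump0 n z \<le> 1" for z :: 'a by (simp add: bump0_def flat_def)
  then have "moll n z \<le> 1 / (LINT y|lborel. bump0 n (y::'a))" for z :: 'a
    unfolding moll_def using bump0_integral_pos[of n, where 'a='a]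
    by (intro divide_right_mono) auto
  then show ?thesis by blast
qed

lemma nn_integral_moll': "(\<integral>\<^sup>+ x. ennreal (moll n (x - y)) \<partial>lborel) = 1" for y :: "'a::euclidean_space"
  using nn_integral_moll[of n y] by (simp add: moll_commute[of n y])

lemma integrable_moll_shift: "integrable lborel (\<lambda>y. moll n (x - y :: 'a::euclidean_space))"
  using nn_integral_moll[of n x]
  by (intro integrableI_nonneg) (auto simp: moll_nonneg)

lemma integral_moll_shift: "(LINT y|lborel. moll n (x - y :: 'a::euclidean_space)) = 1"
  using nn_integral_moll[of n x]
  by (subst integral_eq_nn_integral) (auto simp: moll_nonneg)

lemma nn_integral_moll_left:
  fixes f :: "'a::euclidean_space \<Rightarrow> ennreal"
  assumes [measurable]: "f \<in> borel_measurable borel"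
  shows "(\<integral>\<^sup>+ x. \<integral>\<^sup>+ y. ennreal (moll n (x - y)) * f x \<partial>lborel \<partial>lborel) = (\<integral>\<^sup>+ x. f x \<partial>lborel)"
  by (simp add: nn_integral_multc nn_integral_moll)

lemma nn_integral_moll_right:
  fixes f :: "'a::euclidean_space \<Rightarrow> ennreal"
  assumes [measurable]: "f \<in> borel_measurable borel"
  shows "(\<integral>\<^sup>+ x. \<integral>\<^sup>+ y. ennreal (moll n (x - y)) * f y \<partial>lborel \<partial>lborel) = (\<integral>\<^sup>+ x. f x \<partial>lborel)"
proof -
  have "(\<integral>\<^sup>+ x. \<integral>\<^sup>+ y. ennreal (moll n (x - y)) * f y \<partial>lborel \<partial>lborel)
      = (\<integral>\<^sup>+ y. \<integral>\<^sup>+ x. ennreal (moll n (x - y)) * f y \<partial>lborel \<partial>lborel)"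
    by (rule lborel_pair.Fubini'[symmetric]) measurable
  also have "\<dots> = (\<integral>\<^sup>+ x. f x \<partial>lborel)"
    by (simp add: nn_integral_multc nn_integral_moll')
  finally show ?thesis .
qed

text \<open>
  The mean oscillation of \<open>f\<close> at the scale of the kernel. It dominates both the \<open>L\<^sup>1\<close> error of the
  mollification of \<open>f\<close> and the error in the correlations below, so a single convergence
  statement serves both.
\<close>

definition moll_osc :: "nat \<Rightarrow> ('a::euclidean_space \<Rightarrow> real) \<Rightarrow> ennreal" where
  "moll_osc n f = (\<integral>\<^sup>+ x. \<integral>\<^sup>+ y. ennreal (moll n (x - y)) * ennreal \<bar>f y - f x\<bar> \<partial>lborel \<partial>lborel)"

lemma moll_osc_triangle:
  fixes f g :: "'a::euclidean_space \<Rightarrow> real"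
  assumes [measurable]: "f \<in> borel_measurable borel" "g \<in> borel_measurable borel"
  shows "moll_osc n (\<lambda>x. f x + g x) \<le> moll_osc n f + moll_osc n g"
proof -
  have "moll_osc n (\<lambda>x. f x + g x) \<le> (\<integral>\<^sup>+ x. \<integral>\<^sup>+ y. ennreal (moll n (x - y)) * ennreal \<bar>f y - f x\<bar>
      + ennreal (moll n (x - y)) * ennreal \<bar>g y - g x\<bar> \<partial>lborel \<partial>lborel)"
    unfolding moll_osc_def
    by (intro nn_integral_mono)
       (auto simp flip: ennreal_mult ennreal_plus distrib_left
             simp: moll_nonneg intro!: ennreal_leI mult_left_mono)
  also have "\<dots> = moll_osc n f + moll_osc n g"
    unfolding moll_osc_def by (simp add: nn_integral_add)
  finally show ?thesis .
qed

lemma moll_osc_le: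
  fixes f :: "'a::euclidean_space \<Rightarrow> real"
  assumes [measurable]: "f \<in> borel_measurable borel"
  shows "moll_osc n f \<le> 2 * (\<integral>\<^sup>+ x. ennreal \<bar>f x\<bar> \<partial>lborel)"
proof -
  have "moll_osc n f \<le> (\<integral>\<^sup>+ x. \<integral>\<^sup>+ y. ennreal (moll n (x - y)) * ennreal \<bar>f y\<bar>
      + ennreal (moll n (x - y)) * ennreal \<bar>f x\<bar> \<partial>lborel \<partial>lborel)"
    unfolding moll_osc_def
    by (intro nn_integral_mono)
       (auto simp flip: ennreal_mult ennreal_plus distrib_left
             simp: moll_nonneg intro!: ennreal_leI mult_left_mono)
  also have "\<dots> = (\<integral>\<^sup>+ x. ennreal \<bar>f x\<bar> \<partial>lborel) + (\<integral>\<^sup>+ x. ennreal \<bar>f x\<bar> \<partial>lborel)"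
    by (subst nn_integral_moll_left[symmetric, of _ n], simp, subst nn_integral_moll_right[symmetric, of _ n], simp)
       (simp add: nn_integral_add)
  finally show ?thesis by (simp add: mult_2)
qed

lemma moll_osc_cmult:
  fixes f :: "'a::euclidean_space \<Rightarrow> real"
  assumes [measurable]: "f \<in> borel_measurable borel"
  shows "moll_osc n (\<lambda>x. c * f x) = ennreal \<bar>c\<bar> * moll_osc n f"
proof -
  have "\<bar>c * f y - c * f x\<bar> = \<bar>c\<bar> * \<bar>f y - f x\<bar>" for x y
    by (simp add: right_diff_distrib[symmetric] abs_mult)
  then show ?thesis
    unfolding moll_osc_def
    by (simp add: ennreal_mult mult.left_commute[of _ "ennreal \<bar>c\<bar>"] nn_integral_cmult)
qed

lemma ennreal_tendsto_0I:
  fixes X :: "nat \<Rightarrow> ennreal"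
  assumes "\<And>e::real. 0 < e \<Longrightarrow> \<forall>\<^sub>F n in sequentially. X n \<le> ennreal e"
  shows "X \<longlonglongrightarrow> 0"
proof (rule order_tendstoI)
  fix a :: ennreal assume "0 < a"
  then obtain z where z: "0 < z" "z < a" using dense by blast
  then obtain r where r: "z = ennreal r" "0 < r"
    by (cases z) (auto simp: top_unique)
  from assms[OF r(2)] show "\<forall>\<^sub>F n in sequentially. X n < a"
    by eventually_elim (use z r in auto)
qed auto

lemma ennreal_tendsto_0D:
  fixes X :: "nat \<Rightarrow> ennreal"
  assumes "X \<longlonglongrightarrow> 0" "0 < (e::real)"
  shows "\<forall>\<^sub>F n in sequentially. X n \<le> ennreal e"
  using order_tendstoD(2)[OF assms(1), of "ennreal e"] assms(2)
  by (auto elim: eventually_mono)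

lemma moll_osc_approx:
  fixes f :: "'a::euclidean_space \<Rightarrow> real"
  assumes f [measurable]: "f \<in> borel_measurable borel"
    and approx: "\<And>e::real. 0 < e \<Longrightarrow> \<exists>g. g \<in> borel_measurable borel \<and> (\<lambda>n. moll_osc n g) \<longlonglongrightarrow> 0 \<and>
          (\<integral>\<^sup>+ x. ennreal \<bar>f x - g x\<bar> \<partial>lborel) \<le> ennreal e"
  shows "(\<lambda>n. moll_osc n f) \<longlonglongrightarrow> 0"
proof (rule ennreal_tendsto_0I)
  fix e :: real assume e: "0 < e"
  then obtain g where g [measurable]: "g \<in> borel_measurable borel"
    and osc: "(\<lambda>n. moll_osc n g) \<longlonglongrightarrow> 0"
    and close: "(\<integral>\<^sup>+ x. ennreal \<bar>f x - g x\<bar> \<partial>lborel) \<le> ennreal (e / 3)"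
    using approx[of "e / 3"] by auto
  have "\<forall>\<^sub>F n in sequentially. moll_osc n g \<le> ennreal (e / 3)"
    using ennreal_tendsto_0D[OF osc, of "e / 3"] e by auto
  then show "\<forall>\<^sub>F n in sequentially. moll_osc n f \<le> ennreal e"
  proof eventually_elim
    case (elim n)
    have "moll_osc n f \<le> moll_osc n g + moll_osc n (\<lambda>x. f x - g x)"
      using moll_osc_triangle[of g "\<lambda>x. f x - g x" n] by simp
    also have "\<dots> \<le> ennreal (e / 3) + 2 * ennreal (e / 3)"
      by (rule add_mono[OF elim order_trans[OF moll_osc_le mult_left_mono[OF close]]]) auto
    also have "\<dots> = ennreal (e / 3) + ennreal 2 * ennreal (e / 3)" by simp
    also have "\<dots> = ennreal e"
      using e by (simp flip: ennreal_mult ennreal_plus del: ennreal_numeral)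
    finally show ?case .
  qed
qed

text \<open>
  For an open set \<open>U\<close> the oscillation is twice the integral over \<open>U\<close> of the fraction of the kernel,
  centred at \<open>x\<close>, that falls outside \<open>U\<close>; that fraction is eventually zero at each point of \<open>U\<close>.
\<close>

lemma moll_osc_open:
  fixes U :: "'a::euclidean_space set"
  assumes "open U" "emeasure lborel U < \<infinity>"
  shows "(\<lambda>n. moll_osc n (indicator U)) \<longlonglongrightarrow> 0"
proof -
  have [measurable]: "U \<in> sets borel" using assms(1) by simp
  define g where "g n x = (\<integral>\<^sup>+ y. ennreal (moll n (x - y)) * indicator (- U) y \<partial>lborel)" for n and x :: 'a
  have g_le: "g n x \<le> 1" for n x
    unfolding g_def nn_integral_moll[of n x, symmetric]
    by (intro nn_integral_mono) (auto simp: indicator_def)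
  have [measurable]: "g n \<in> borel_measurable borel" for n
    unfolding g_def by measurable
  have "moll_osc n (indicator U) = 2 * (\<integral>\<^sup>+ x. indicator U x * g n x \<partial>lborel)" for n
  proof -
    have "moll_osc n (indicator U) = (\<integral>\<^sup>+ x. \<integral>\<^sup>+ y. ennreal (moll n (x - y)) * (indicator U x * indicator (- U) y)
       + ennreal (moll n (x - y)) * (indicator U y * indicator (- U) x) \<partial>lborel \<partial>lborel)"
      unfolding moll_osc_def
      by (intro nn_integral_cong) (auto simp: indicator_def)
    also have "\<dots> = (\<integral>\<^sup>+ x. \<integral>\<^sup>+ y. ennreal (moll n (x - y)) * (indicator U x * indicator (- U) y) \<partial>lborel \<partial>lborel)
       + (\<integral>\<^sup>+ x. \<integral>\<^sup>+ y. ennreal (moll n (x - y)) * (indicator U y * indicator (- U) x) \<partial>lborel \<partial>lborel)"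
      by (simp add: nn_integral_add)
    also have "(\<integral>\<^sup>+ x. \<integral>\<^sup>+ y. ennreal (moll n (x - y)) * (indicator U y * indicator (- U) x) \<partial>lborel \<partial>lborel)
       = (\<integral>\<^sup>+ y. \<integral>\<^sup>+ x. ennreal (moll n (x - y)) * (indicator U y * indicator (- U) x) \<partial>lborel \<partial>lborel)"
      by (rule lborel_pair.Fubini'[symmetric]) measurable
    also have "\<dots> = (\<integral>\<^sup>+ x. \<integral>\<^sup>+ y. ennreal (moll n (x - y)) * (indicator U x * indicator (- U) y) \<partial>lborel \<partial>lborel)"
      by (subst moll_commute) simp
    also have "(\<integral>\<^sup>+ x. \<integral>\<^sup>+ y. ennreal (moll n (x - y)) * (indicator U x * indicator (- U) y) \<partial>lborel \<partial>lborel)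
       = (\<integral>\<^sup>+ x. indicator U x * g n x \<partial>lborel)"
      unfolding g_def
      by (simp add: mult.left_commute[of _ "indicator U _"] nn_integral_cmult)
    finally show ?thesis by (simp add: mult_2)
  qed
  moreover have "(\<lambda>n. \<integral>\<^sup>+ x. indicator U x * g n x \<partial>lborel) \<longlonglongrightarrow> (\<integral>\<^sup>+ (x::'a). 0 \<partial>lborel)"
  proof (rule nn_integral_dominated_convergence[where w = "indicator U" and u' = "\<lambda>_. 0"])
    show "(\<integral>\<^sup>+ x. indicator U x \<partial>lborel) < \<infinity>" using assms(2) by simp
    show "AE x in lborel. indicator U x * g n x \<le> indicator U x" for n
      using g_le by (auto simp: indicator_def)
    show "AE x in lborel. (\<lambda>n. indicator U x * g n x) \<longlonglongrightarrow> 0"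
    proof (rule AE_I2)
      fix x :: 'a
      show "(\<lambda>n. indicator U x * g n x) \<longlonglongrightarrow> 0"
      proof (cases "x \<in> U")
        case True
        then obtain d where d: "0 < d" "ball x d \<subseteq> U" using assms(1) openE by blast
        have "\<forall>\<^sub>F n in sequentially. moll_rad n < d"
          using order_tendstoD(2)[OF moll_rad_tendsto d(1)] .
        then have "\<forall>\<^sub>F n in sequentially. g n x = 0"
        proof eventually_elim
          case (elim n)
          have "ennreal (moll n (x - y)) * indicator (- U) y = 0" for y
          proof (cases "y \<in> U")
            case False
            then have "y \<notin> ball x d" using d by blast
            then have "moll n (x - y) = 0"
              using elim by (intro moll_eq_0) (auto simp: dist_norm)
            then show ?thesis by simp
          qed simp
          then show ?case unfolding g_def by (simp only: nn_integral_const mult_zero_left)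
        qed
        then show ?thesis
          by (intro tendsto_eventually) (auto elim: eventually_mono)
      qed simp
    qed
  qed auto
  ultimately show ?thesis
    using tendsto_mult_ennreal[OF tendsto_const, of _ 0 sequentially 2] by simp
qed

text \<open>
  Open sets are handled by the preceding lemma, outer regularity passes to Borel sets of finite
  measure, and \<open>moll_osc_approx\<close> passes to limits in \<open>L\<^sup>1\<close>.
\<close>

theorem moll_osc_tendsto_0:
  fixes f :: "'a::euclidean_space \<Rightarrow> real"
  assumes "integrable lborel f"
  shows "(\<lambda>n. moll_osc n f) \<longlonglongrightarrow> 0"
  using assms
proof (induction rule: integrable_induct)
  case (base A c)
  then have [measurable]: "A \<in> sets borel" by simp
  have "(\<lambda>n. moll_osc n (indicator A :: 'a \<Rightarrow> real)) \<longlonglongrightarrow> 0"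
  proof (rule moll_osc_approx)
    fix e :: real assume e: "0 < e"
    obtain U where U: "open U" "A \<subseteq> U" "emeasure lborel (U - A) < ennreal e"
      using outer_regular_lborel[of A e] e by auto
    then have [measurable]: "U \<in> sets borel" by simp
    have "emeasure lborel U = emeasure lborel A + emeasure lborel (U - A)"
      using U(2) by (subst plus_emeasure) (auto simp: Un_absorb1)
    also have "\<dots> < \<infinity>" using base U(3) by (auto simp: less_top[symmetric] top_unique)
    finally have "(\<lambda>n. moll_osc n (indicator U :: 'a \<Rightarrow> real)) \<longlonglongrightarrow> 0"
      by (rule moll_osc_open[OF U(1)])
    moreover have "(\<integral>\<^sup>+ x. ennreal \<bar>indicator A x - indicator U x\<bar> \<partial>lborel) \<le> ennreal e"
    proof -
      have "(\<integral>\<^sup>+ x. ennreal \<bar>indicator A x - indicator U x\<bar> \<partial>lborel) = (\<integral>\<^sup>+ x. indicator (U - A) x \<partial>lborel)"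
        using U(2) by (intro nn_integral_cong) (auto simp: indicator_def)
      then show ?thesis using U(3) by simp
    qed
    ultimately show "\<exists>g. g \<in> borel_measurable borel \<and> (\<lambda>n. moll_osc n g) \<longlonglongrightarrow> 0 \<and>
          (\<integral>\<^sup>+ x. ennreal \<bar>indicator A x - g x\<bar> \<partial>lborel) \<le> ennreal e"
      by (intro exI[of _ "indicator U"]) auto
  qed simp
  then have "(\<lambda>n. ennreal \<bar>c\<bar> * moll_osc n (indicator A :: 'a \<Rightarrow> real)) \<longlonglongrightarrow> 0"
    using tendsto_mult_ennreal[OF tendsto_const, of _ 0 sequentially "ennreal \<bar>c\<bar>"] by simp
  then show ?case
    using moll_osc_cmult[of "indicator A :: 'a \<Rightarrow> real" _ c] by (simp add: mult.commute)
next
  case (add f g)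
  have m [measurable]: "f \<in> borel_measurable borel" "g \<in> borel_measurable borel"
    using add(1,2)[THEN borel_measurable_integrable] by auto
  have "(\<lambda>n. moll_osc n f + moll_osc n g) \<longlonglongrightarrow> 0 + 0"
    by (intro tendsto_add add.IH)
  then have "(\<lambda>n. moll_osc n f + moll_osc n g) \<longlonglongrightarrow> 0" by simp
  then show ?case
    by (rule tendsto_sandwich[OF always_eventually always_eventually tendsto_const, rotated 2])
       (use moll_osc_triangle[OF m] in auto)
next
  case (lim f s)
  have m [measurable]: "f \<in> borel_measurable borel" "\<And>i. s i \<in> borel_measurable borel"
    using lim(1,4)[THEN borel_measurable_integrable] by auto
  show ?case
  proof (rule moll_osc_approx)
    fix e :: real assume e: "0 < e"
    have "(\<lambda>i. \<integral>\<^sup>+ x. ennreal (norm (f x - s i x)) \<partial>lborel) \<longlonglongrightarrow> 0"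
    proof (rule nn_integral_dominated_convergence_norm[where w = "\<lambda>x. 2 * norm (f x)"])
      show "AE x in lborel. norm (s i x) \<le> 2 * norm (f x)" for i
        using lim(3) by auto
      show "(\<integral>\<^sup>+ x. ennreal (2 * norm (f x)) \<partial>lborel) < \<infinity>"
        using lim(4) by (simp add: ennreal_mult nn_integral_cmult integrable_iff_bounded ennreal_mult_less_top)
    qed (use lim(2) in auto)
    then have "\<forall>\<^sub>F i in sequentially. (\<integral>\<^sup>+ x. ennreal (norm (f x - s i x)) \<partial>lborel) \<le> ennreal e"
      by (rule ennreal_tendsto_0D[OF _ e])
    then obtain i where "(\<integral>\<^sup>+ x. ennreal (norm (f x - s i x)) \<partial>lborel) \<le> ennreal e"
      by (auto simp: eventually_sequentially)
    then show "\<exists>g. g \<in> borel_measurable borel \<and> (\<lambda>n. moll_osc n g) \<longlonglongrightarrow> 0 \<and>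
          (\<integral>\<^sup>+ x. ennreal \<bar>f x - g x\<bar> \<partial>lborel) \<le> ennreal e"
      by (intro exI[of _ "s i"]) (use lim.IH in auto)
  qed simp
qed

section \<open>Kernels, correlations and the fundamental lemma\<close>

lemma nn_integral_reflect:
  fixes f :: "'a::euclidean_space \<Rightarrow> ennreal"
  assumes [measurable]: "f \<in> borel_measurable borel"
  shows "(\<integral>\<^sup>+ y. f (x - y) \<partial>lborel) = (\<integral>\<^sup>+ y. f y \<partial>lborel)"
proof -
  have "(\<integral>\<^sup>+ y. f y \<partial>lborel) =
      (\<integral>\<^sup>+ y. f y \<partial>density (distr lborel borel (\<lambda>y. x + (-1) *\<^sub>R y)) (\<lambda>_. ennreal (\<bar>-1::real\<bar> ^ DIM('a))))"
    by (subst lborel_affine[of "-1" x]) simp_all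
  also have "\<dots> = (\<integral>\<^sup>+ y. f (x - y) \<partial>lborel)"
    by (simp add: nn_integral_density nn_integral_distr)
  finally show ?thesis ..
qed

lemma nn_integral_shift:
  fixes f :: "'a::euclidean_space \<Rightarrow> ennreal"
  assumes [measurable]: "f \<in> borel_measurable borel"
  shows "(\<integral>\<^sup>+ x. f (x - y) \<partial>lborel) = (\<integral>\<^sup>+ x. f x \<partial>lborel)"
proof -
  have "(\<integral>\<^sup>+ x. f x \<partial>lborel) = (\<integral>\<^sup>+ x. f x \<partial>distr lborel borel ((+) (- y)))"
    by (simp only: lborel_distr_plus)
  also have "\<dots> = (\<integral>\<^sup>+ x. f (- y + x) \<partial>lborel)"
    by (rule nn_integral_distr) auto
  finally show ?thesis by simp
qed

lemma abs_mult_le_squares: "\<bar>s * t\<bar> \<le> s\<^sup>2 + t\<^sup>2" for s t :: real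
proof -
  have "2 * (\<bar>s\<bar> * \<bar>t\<bar>) \<le> s\<^sup>2 + t\<^sup>2"
    using zero_le_power2[of "\<bar>s\<bar> - \<bar>t\<bar>"] by (simp add: power2_diff mult_ac)
  moreover have "0 \<le> \<bar>s\<bar> * \<bar>t\<bar>" by simp
  ultimately show ?thesis unfolding abs_mult by linarith
qed

lemma integrable_kernel_pair:
  fixes k a b :: "'a::euclidean_space \<Rightarrow> real"
  assumes k: "integrable lborel k"
    and [measurable]: "a \<in> borel_measurable borel" "b \<in> borel_measurable borel"
    and a2: "integrable lborel (\<lambda>x. (a x)\<^sup>2)" and b2: "integrable lborel (\<lambda>x. (b x)\<^sup>2)"
  shows "integrable (lborel \<Otimes>\<^sub>M lborel) (\<lambda>(x, y). k (x - y) * (a x * b y))"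
proof -
  have [measurable]: "k \<in> borel_measurable borel"
    using borel_measurable_integrable[OF k] by simp
  have fin: "(\<integral>\<^sup>+ x. ennreal \<bar>k x\<bar> \<partial>lborel) < \<infinity>" "(\<integral>\<^sup>+ x. ennreal ((a x)\<^sup>2) \<partial>lborel) < \<infinity>"
    "(\<integral>\<^sup>+ x. ennreal ((b x)\<^sup>2) \<partial>lborel) < \<infinity>"
    using k a2 b2 by (simp_all add: integrable_iff_bounded)
  have "(\<integral>\<^sup>+ p. ennreal (norm (case p of (x, y) \<Rightarrow> k (x - y) * (a x * b y))) \<partial>(lborel \<Otimes>\<^sub>M lborel))
     = (\<integral>\<^sup>+ x. \<integral>\<^sup>+ y. ennreal \<bar>k (x - y) * (a x * b y)\<bar> \<partial>lborel \<partial>lborel)"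
    by (subst lborel.nn_integral_fst[symmetric]) auto
  also have "\<dots> \<le> (\<integral>\<^sup>+ x. \<integral>\<^sup>+ y. ennreal \<bar>k (x - y)\<bar> * ennreal ((a x)\<^sup>2)
        + ennreal \<bar>k (x - y)\<bar> * ennreal ((b y)\<^sup>2) \<partial>lborel \<partial>lborel)"
  proof (intro nn_integral_mono)
    fix x y
    have "\<bar>a x * b y\<bar> \<le> (a x)\<^sup>2 + (b y)\<^sup>2" by (rule abs_mult_le_squares)
    then have "\<bar>k (x - y)\<bar> * \<bar>a x * b y\<bar> \<le> \<bar>k (x - y)\<bar> * ((a x)\<^sup>2 + (b y)\<^sup>2)"
      by (intro mult_left_mono) auto
    then show "ennreal \<bar>k (x - y) * (a x * b y)\<bar> \<le> ennreal \<bar>k (x - y)\<bar> * ennreal ((a x)\<^sup>2)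
        + ennreal \<bar>k (x - y)\<bar> * ennreal ((b y)\<^sup>2)"
      by (simp flip: ennreal_mult ennreal_plus distrib_left add: abs_mult)
  qed
  also have "\<dots> = (\<integral>\<^sup>+ x. \<integral>\<^sup>+ y. ennreal \<bar>k (x - y)\<bar> * ennreal ((a x)\<^sup>2) \<partial>lborel \<partial>lborel)
       + (\<integral>\<^sup>+ x. \<integral>\<^sup>+ y. ennreal \<bar>k (x - y)\<bar> * ennreal ((b y)\<^sup>2) \<partial>lborel \<partial>lborel)"
    by (simp add: nn_integral_add)
  also have "(\<integral>\<^sup>+ x. \<integral>\<^sup>+ y. ennreal \<bar>k (x - y)\<bar> * ennreal ((b y)\<^sup>2) \<partial>lborel \<partial>lborel)
     = (\<integral>\<^sup>+ y. \<integral>\<^sup>+ x. ennreal \<bar>k (x - y)\<bar> * ennreal ((b y)\<^sup>2) \<partial>lborel \<partial>lborel)"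
    by (rule lborel_pair.Fubini'[symmetric]) measurable
  also have "\<dots> = (\<integral>\<^sup>+ x. ennreal \<bar>k x\<bar> \<partial>lborel) * (\<integral>\<^sup>+ x. ennreal ((b x)\<^sup>2) \<partial>lborel)"
    by (simp add: nn_integral_multc nn_integral_cmult nn_integral_shift[of "\<lambda>x. ennreal \<bar>k x\<bar>"])
  also have "(\<integral>\<^sup>+ x. \<integral>\<^sup>+ y. ennreal \<bar>k (x - y)\<bar> * ennreal ((a x)\<^sup>2) \<partial>lborel \<partial>lborel)
     = (\<integral>\<^sup>+ x. ennreal \<bar>k x\<bar> \<partial>lborel) * (\<integral>\<^sup>+ x. ennreal ((a x)\<^sup>2) \<partial>lborel)"
    by (simp add: nn_integral_multc nn_integral_cmult nn_integral_reflect[of "\<lambda>x. ennreal \<bar>k x\<bar>"])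
  also have "\<dots> + (\<integral>\<^sup>+ x. ennreal \<bar>k x\<bar> \<partial>lborel) * (\<integral>\<^sup>+ x. ennreal ((b x)\<^sup>2) \<partial>lborel) < \<infinity>"
    using fin by (auto simp: ennreal_mult_less_top)
  finally show ?thesis
    by (subst integrable_iff_bounded) auto
qed

text \<open>
  For square-integrable \<open>b\<close> the function \<open>b\<bar>b\<bar>\<close> is integrable, and by this inequality its mean
  oscillation controls the mean squared oscillation of \<open>b\<close>.
\<close>

lemma square_diff_le: "(s - t)\<^sup>2 \<le> 2 * \<bar>s * \<bar>s\<bar> - t * \<bar>t\<bar>\<bar>" for s t :: real
proof -
  have key: "(s - t)\<^sup>2 \<le> 2 * \<bar>s * \<bar>s\<bar> - t * \<bar>t\<bar>\<bar>" if "t \<le> s" for s t :: real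
  proof -
    consider "0 \<le> t" | "t < 0" "0 \<le> s" | "s < 0" by linarith
    then show ?thesis
    proof cases
      case 1
      have "(s - t) * (s - t) \<le> (s - t) * (s + t)"
        using 1 that by (intro mult_left_mono) auto
      moreover have "0 \<le> (s - t) * (s + t)" using 1 that by simp
      ultimately have "(s - t) * (s - t) \<le> 2 * ((s - t) * (s + t))" by linarith
      also have "(s - t) * (s + t) = \<bar>s * \<bar>s\<bar> - t * \<bar>t\<bar>\<bar>"
        using 1 that \<open>0 \<le> (s - t) * (s + t)\<close> by (simp add: algebra_simps)
      finally show ?thesis by (simp add: power2_eq_square)
    next
      case 2
      have "0 \<le> (s + t)\<^sup>2" by simp
      moreover have "0 \<le> s * s + t * t" by simp
      ultimately show ?thesis
        using 2 by (simp add: power2_eq_square algebra_simps)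
    next
      case 3
      then have "(s - t) * (s - t) \<le> (s - t) * (- s - t)"
        using that by (intro mult_left_mono) auto
      moreover have "0 \<le> (s - t) * (- s - t)" using 3 that by simp
      ultimately have "(s - t) * (s - t) \<le> 2 * ((s - t) * (- s - t))" by linarith
      also have "(s - t) * (- s - t) = \<bar>s * \<bar>s\<bar> - t * \<bar>t\<bar>\<bar>"
        using 3 that \<open>0 \<le> (s - t) * (- s - t)\<close> by (simp add: algebra_simps)
      finally show ?thesis by (simp add: power2_eq_square)
    qed
  qed
  show ?thesis
    using key[of t s] key[of s t] by (cases "t \<le> s") (auto simp: power2_commute abs_minus_commute)
qed

lemma integrable_mult_L2:
  fixes a b :: "'a \<Rightarrow> real"
  assumes [measurable]: "a \<in> borel_measurable M" "b \<in> borel_measurable M"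
    and "integrable M (\<lambda>x. (a x)\<^sup>2)" "integrable M (\<lambda>x. (b x)\<^sup>2)"
  shows "integrable M (\<lambda>x. a x * b x)"
proof (rule Bochner_Integration.integrable_bound)
  show "integrable M (\<lambda>x. (a x)\<^sup>2 + (b x)\<^sup>2)" using assms by auto
  show "AE x in M. norm (a x * b x) \<le> norm ((a x)\<^sup>2 + (b x)\<^sup>2)"
    using abs_mult_le_squares by auto
qed measurable

text \<open>
  The difference of the two sides is the integral of \<open>moll n (x - y) a(x) (b(y) - b(x))\<close>. By
  Young's inequality it is at most \<open>s \<parallel>a\<parallel>\<^sup>2\<close> plus \<open>2/s\<close> times the mean oscillation of \<open>b\<bar>b\<bar>\<close>; first
  \<open>n\<close> tends to infinity, then \<open>s\<close> to zero.
\<close>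

lemma moll_correlation:
  fixes a b :: "'a::euclidean_space \<Rightarrow> real"
  assumes [measurable]: "a \<in> borel_measurable borel" "b \<in> borel_measurable borel"
    and a2: "integrable lborel (\<lambda>x. (a x)\<^sup>2)" and b2: "integrable lborel (\<lambda>x. (b x)\<^sup>2)"
  shows "(\<lambda>n. \<integral>(x, y). moll n (x - y) * (a x * b y) \<partial>(lborel \<Otimes>\<^sub>M lborel))
           \<longlonglongrightarrow> (LINT x|lborel. a x * b x)"
proof -
  \<comment> \<open>\<open>B\<close> is integrable and controls squared differences of \<open>b\<close> by \<open>square_diff_le\<close>\<close>
  define B where "B x = b x * \<bar>b x\<bar>" for x
  have [measurable]: "B \<in> borel_measurable borel" unfolding B_def by measurable
  have "integrable lborel B"
    by (rule Bochner_Integration.integrable_bound[OF b2]) (auto simp: B_def power2_eq_square abs_mult)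
  then have osc: "(\<lambda>n. moll_osc n B) \<longlonglongrightarrow> 0" by (rule moll_osc_tendsto_0)
  have ab: "integrable lborel (\<lambda>x. a x * b x)"
    by (rule integrable_mult_L2) (use a2 b2 in auto)
  define A where "A = (LINT x|lborel. (a x)\<^sup>2)"
  have A0: "0 \<le> A" unfolding A_def by simp
  have A_eq: "(\<integral>\<^sup>+ x. ennreal ((a x)\<^sup>2) \<partial>lborel) = ennreal A"
    unfolding A_def using a2 by (subst nn_integral_eq_integral) auto
  define F where "F n = (\<integral>(x, y). moll n (x - y) * (a x * b y) \<partial>(lborel \<Otimes>\<^sub>M lborel))" for n
  have bound: "ennreal \<bar>F n - (LINT x|lborel. a x * b x)\<bar> \<le> ennreal (s * A) + ennreal (1 / s) * (2 * moll_osc n B)"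
    if s: "0 < s" for s n
  proof -
    have "integrable (lborel \<Otimes>\<^sub>M lborel) (\<lambda>(x, y). moll n (x - y) * (a x * b y))"
      by (rule integrable_kernel_pair) (use a2 b2 moll_integrable in auto)
    moreover have "integrable (lborel \<Otimes>\<^sub>M lborel) (\<lambda>(x, y). moll n (x - y) * (a x * b x))"
    proof -
      have "(\<integral>\<^sup>+ p. ennreal (norm (case p of (x, y) \<Rightarrow> moll n (x - y) * (a x * b x))) \<partial>(lborel \<Otimes>\<^sub>M lborel))
        = (\<integral>\<^sup>+ x. \<integral>\<^sup>+ y. ennreal (moll n (x - y)) * ennreal \<bar>a x * b x\<bar> \<partial>lborel \<partial>lborel)"
        by (subst lborel.nn_integral_fst[symmetric]) (auto simp: abs_mult moll_nonneg ennreal_mult)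
      also have "\<dots> = (\<integral>\<^sup>+ x. ennreal \<bar>a x * b x\<bar> \<partial>lborel)"
        by (rule nn_integral_moll_left) measurable
      also have "\<dots> < \<infinity>" using ab by (simp add: integrable_iff_bounded)
      finally show ?thesis by (subst integrable_iff_bounded) auto
    qed
    moreover have "(\<integral>(x, y). moll n (x - y) * (a x * b x) \<partial>(lborel \<Otimes>\<^sub>M lborel)) = (LINT x|lborel. a x * b x)"
      using lborel_pair.integral_fst'[OF calculation(2)] by (simp add: integral_moll_shift)
    ultimately have "F n - (LINT x|lborel. a x * b x) =
       (\<integral>(x, y). moll n (x - y) * (a x * (b y - b x)) \<partial>(lborel \<Otimes>\<^sub>M lborel))"
      and int: "integrable (lborel \<Otimes>\<^sub>M lborel) (\<lambda>(x, y). moll n (x - y) * (a x * (b y - b x)))"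
      unfolding F_def
      by (auto simp: Bochner_Integration.integral_diff[symmetric] split_beta' algebra_simps
          intro!: Bochner_Integration.integral_cong dest: Bochner_Integration.integrable_diff)
    then have "ennreal \<bar>F n - (LINT x|lborel. a x * b x)\<bar> \<le>
       (\<integral>\<^sup>+ p. norm (case p of (x, y) \<Rightarrow> moll n (x - y) * (a x * (b y - b x))) \<partial>(lborel \<Otimes>\<^sub>M lborel))"
      using integral_norm_bound_ennreal[OF int] by simp
    also have "\<dots> = (\<integral>\<^sup>+ x. \<integral>\<^sup>+ y. ennreal \<bar>moll n (x - y) * (a x * (b y - b x))\<bar> \<partial>lborel \<partial>lborel)"
      by (subst lborel.nn_integral_fst[symmetric]) auto
    also have "\<dots> \<le> (\<integral>\<^sup>+ x. \<integral>\<^sup>+ y. ennreal (moll n (x - y)) * ennreal (s * (a x)\<^sup>2)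
         + ennreal (1 / s) * (2 * (ennreal (moll n (x - y)) * ennreal \<bar>B y - B x\<bar>)) \<partial>lborel \<partial>lborel)"
    proof (intro nn_integral_mono)
      fix x y :: 'a
      define d where "d = b y - b x"
      have d2: "d\<^sup>2 \<le> 2 * \<bar>B y - B x\<bar>" unfolding B_def d_def by (rule square_diff_le)
      have "0 \<le> (s * \<bar>a x\<bar> - \<bar>d\<bar>)\<^sup>2" by simp
      then have "2 * s * (\<bar>a x\<bar> * \<bar>d\<bar>) \<le> s\<^sup>2 * (a x)\<^sup>2 + d\<^sup>2"
        by (simp add: power2_diff power_mult_distrib mult_ac)
      then have "s * (2 * (\<bar>a x\<bar> * \<bar>d\<bar>)) \<le> s * (s * (a x)\<^sup>2 + 1 / s * d\<^sup>2)"
        using s by (simp add: algebra_simps power2_eq_square)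
      then have "2 * (\<bar>a x\<bar> * \<bar>d\<bar>) \<le> s * (a x)\<^sup>2 + 1 / s * d\<^sup>2"
        using s mult_le_cancel_left_pos by blast
      moreover have "0 \<le> \<bar>a x\<bar> * \<bar>d\<bar>" by simp
      moreover have "1 / s * d\<^sup>2 \<le> 1 / s * (2 * \<bar>B y - B x\<bar>)"
        using d2 s by (intro mult_left_mono) auto
      ultimately have "\<bar>a x * d\<bar> \<le> s * (a x)\<^sup>2 + 1 / s * (2 * \<bar>B y - B x\<bar>)"
        unfolding abs_mult by linarith
      then have "moll n (x - y) * \<bar>a x * d\<bar> \<le> moll n (x - y) * (s * (a x)\<^sup>2 + 1 / s * (2 * \<bar>B y - B x\<bar>))"
        by (intro mult_left_mono) (auto simp: moll_nonneg)
      then have "\<bar>moll n (x - y) * (a x * d)\<bar> \<le> moll n (x - y) * (s * (a x)\<^sup>2) + 1 / s * (2 * (moll n (x - y) * \<bar>B y - B x\<bar>))"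
        by (simp add: abs_mult moll_nonneg algebra_simps)
      then have "ennreal \<bar>moll n (x - y) * (a x * d)\<bar> \<le>
          ennreal (moll n (x - y) * (s * (a x)\<^sup>2) + 1 / s * (2 * (moll n (x - y) * \<bar>B y - B x\<bar>)))"
        by (rule ennreal_leI)
      also have "\<dots> = ennreal (moll n (x - y)) * ennreal (s * (a x)\<^sup>2)
         + ennreal (1 / s) * (2 * (ennreal (moll n (x - y)) * ennreal \<bar>B y - B x\<bar>))"
      proof -
        have "ennreal (p + r * (2 * q)) = ennreal p + ennreal r * (2 * ennreal q)"
          if "0 \<le> p" "0 \<le> r" "0 \<le> q" for p q r :: real
          using that by (simp add: ennreal_mult ennreal_plus)
        note split = this[of "moll n (x - y) * (s * (a x)\<^sup>2)" "1 / s" "moll n (x - y) * \<bar>B y - B x\<bar>"]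
        have p: "ennreal (moll n (x - y) * (s * (a x)\<^sup>2)) = ennreal (moll n (x - y)) * ennreal (s * (a x)\<^sup>2)"
          and q: "ennreal (moll n (x - y) * \<bar>B y - B x\<bar>) = ennreal (moll n (x - y)) * ennreal \<bar>B y - B x\<bar>"
          using s by (auto intro!: ennreal_mult moll_nonneg)
        show ?thesis
          unfolding p[symmetric] q[symmetric]
          by (rule split) (use s moll_nonneg[of n "x - y"] in auto)
      qed
      finally show "ennreal \<bar>moll n (x - y) * (a x * (b y - b x))\<bar> \<le> ennreal (moll n (x - y)) * ennreal (s * (a x)\<^sup>2)
         + ennreal (1 / s) * (2 * (ennreal (moll n (x - y)) * ennreal \<bar>B y - B x\<bar>))"
        unfolding d_def .
    qed
    also have "\<dots> = (\<integral>\<^sup>+ x. \<integral>\<^sup>+ y. ennreal (moll n (x - y)) * ennreal (s * (a x)\<^sup>2) \<partial>lborel \<partial>lborel)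
         + ennreal (1 / s) * (2 * moll_osc n B)"
      unfolding moll_osc_def by (simp add: nn_integral_add nn_integral_cmult)
    also have "(\<integral>\<^sup>+ x. \<integral>\<^sup>+ y. ennreal (moll n (x - y)) * ennreal (s * (a x)\<^sup>2) \<partial>lborel \<partial>lborel) = ennreal (s * A)"
      using s by (subst nn_integral_moll_left) (auto simp: ennreal_mult nn_integral_cmult A_eq A0)
    finally show ?thesis .
  qed
  have "F \<longlonglongrightarrow> (LINT x|lborel. a x * b x)"
  proof (rule LIMSEQ_I)
    fix e :: real assume e: "0 < e"
    define s where "s = e / (4 * (A + 1))"
    have s: "0 < s" unfolding s_def using e A0 by simp
    have sA: "s * A \<le> e / 4"
      unfolding s_def using e A0 by (simp add: field_simps)
    have "\<forall>\<^sub>F n in sequentially. moll_osc n B \<le> ennreal (s * e / 8)"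
      using ennreal_tendsto_0D[OF osc, of "s * e / 8"] s e by simp
    then obtain N where N: "\<And>n. n \<ge> N \<Longrightarrow> moll_osc n B \<le> ennreal (s * e / 8)"
      by (auto simp: eventually_sequentially)
    have "norm (F n - (LINT x|lborel. a x * b x)) < e" if "n \<ge> N" for n
    proof -
      have "ennreal \<bar>F n - (LINT x|lborel. a x * b x)\<bar> \<le> ennreal (e / 4) + ennreal (1 / s) * (2 * ennreal (s * e / 8))"
        by (rule order_trans[OF bound[OF s]])
           (intro add_mono mult_left_mono N[OF that] ennreal_leI sA; simp)
      also have "2 * ennreal (s * e / 8) = ennreal (2 * (s * e / 8))"
        using s e by (subst ennreal_mult) auto
      also have "ennreal (e / 4) + ennreal (1 / s) * ennreal (2 * (s * e / 8)) = ennreal (e / 2)"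
        using s e by (simp flip: ennreal_mult ennreal_plus add: field_simps)
      finally show ?thesis using e by simp
    qed
    then show "\<exists>no. \<forall>n\<ge>no. norm (F n - (LINT x|lborel. a x * b x)) < e" by blast
  qed
  then show ?thesis unfolding F_def .
qed

definition moll_conv :: "nat \<Rightarrow> ('a::euclidean_space \<Rightarrow> real) \<Rightarrow> 'a \<Rightarrow> real" where
  "moll_conv n f x = (LINT y|lborel. moll n (x - y) * f y)"

lemma integrable_moll_mult:
  fixes f :: "'a::euclidean_space \<Rightarrow> real"
  assumes f: "integrable lborel f"
  shows "integrable lborel (\<lambda>y. moll n (x - y) * f y)"
proof -
  have [measurable]: "f \<in> borel_measurable borel"
    using borel_measurable_integrable[OF f] by simp
  obtain C where C: "\<And>z::'a. moll n z \<le> C" using moll_bounded by blast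
  have C0: "0 \<le> C" using C[of 0] moll_nonneg[of n "0::'a"] by linarith
  show ?thesis
  proof (rule Bochner_Integration.integrable_bound)
    show "integrable lborel (\<lambda>y. C * f y)" using f by simp
    have "\<bar>moll n (x - y)\<bar> \<le> C" for y
      using C[of "x - y"] moll_nonneg[of n "x - y"] by simp
    then show "AE y in lborel. norm (moll n (x - y) * f y) \<le> norm (C * f y)"
      using C0 by (auto simp: abs_mult intro!: mult_right_mono)
  qed measurable
qed

lemma borel_measurable_moll_conv [measurable]:
  assumes [measurable]: "f \<in> borel_measurable borel"
  shows "moll_conv n f \<in> borel_measurable (borel :: 'a::euclidean_space measure)"
  unfolding moll_conv_def[abs_def] by measurable

lemma moll_conv_L1:
  fixes f :: "'a::euclidean_space \<Rightarrow> real"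
  assumes f: "integrable lborel f"
  shows "(\<integral>\<^sup>+ x. ennreal \<bar>moll_conv n f x - f x\<bar> \<partial>lborel) \<le> moll_osc n f"
  unfolding moll_osc_def
proof (intro nn_integral_mono)
  fix x :: 'a
  have i: "integrable lborel (\<lambda>y. moll n (x - y) * (f y - f x))"
    unfolding right_diff_distrib
    by (intro Bochner_Integration.integrable_diff integrable_moll_mult f integrable_mult_left integrable_moll_shift)
  have "moll_conv n f x - f x = (LINT y|lborel. moll n (x - y) * (f y - f x))"
    unfolding moll_conv_def right_diff_distrib
    by (subst Bochner_Integration.integral_diff)
       (auto intro!: integrable_moll_mult f integrable_mult_left integrable_moll_shift simp: integral_moll_shift)
  then have "ennreal \<bar>moll_conv n f x - f x\<bar> \<le> (\<integral>\<^sup>+ y. norm (moll n (x - y) * (f y - f x)) \<partial>lborel)"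
    using integral_norm_bound_ennreal[OF i] by simp
  then show "ennreal \<bar>moll_conv n f x - f x\<bar> \<le> (\<integral>\<^sup>+ y. ennreal (moll n (x - y)) * ennreal \<bar>f y - f x\<bar> \<partial>lborel)"
    by (simp add: abs_mult moll_nonneg ennreal_mult)
qed

text \<open>
  Truncated to a ball, \<open>h\<close> is the limit in \<open>L\<^sup>1\<close> of its mollifications, and by hypothesis these
  vanish well inside the ball.
\<close>

lemma fundamental_lemma:
  fixes h :: "'a::euclidean_space \<Rightarrow> real"
  assumes [measurable]: "h \<in> borel_measurable borel"
    and loc: "\<And>r. set_integrable lborel (cball 0 r) h"
    and zero: "\<And>n a. (LINT x|lborel. h x * moll n (x - a)) = 0"
  shows "AE x in lborel. h x = 0"
proof -
  have "AE x in lborel. indicator (cball 0 (real R)) x * h x = 0" for R :: nat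
  proof -
    define f where "f x = indicator (cball 0 (real R + 1)) x * h x" for x
    have f: "integrable lborel f"
      using loc[of "real R + 1"] by (simp add: f_def[abs_def] set_integrable_def)
    have c: "moll_conv n f x = 0" if x: "x \<in> cball 0 (real R)" for n x
    proof -
      have "moll n (x - y) * f y = h y * moll n (y - x)" for y
      proof (cases "norm (x - y) < moll_rad n")
        case True
        then have "norm y \<le> real R + 1"
          using x moll_rad_le_1[of n] norm_triangle_ineq2[of y x]
          by (simp add: norm_minus_commute)
        then show ?thesis by (simp add: f_def moll_commute[of n x])
      next
        case False
        then show ?thesis using moll_eq_0[of n "x - y"] by (simp add: moll_commute[of n y])
      qed
      then show ?thesis unfolding moll_conv_def using zero[of n x] by simp
    qed
    have le: "(\<integral>\<^sup>+ x. ennreal \<bar>indicator (cball 0 (real R)) x * h x\<bar> \<partial>lborel) \<le> moll_osc n f" for n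
    proof (rule order_trans[OF _ moll_conv_L1[OF f]], intro nn_integral_mono)
      fix x
      show "ennreal \<bar>indicator (cball 0 (real R)) x * h x\<bar> \<le> ennreal \<bar>moll_conv n f x - f x\<bar>"
        using c[of x n] by (cases "x \<in> cball 0 (real R)") (auto simp: f_def indicator_def)
    qed
    have "(\<integral>\<^sup>+ x. ennreal \<bar>indicator (cball 0 (real R)) x * h x\<bar> \<partial>lborel) \<le> 0"
      by (rule tendsto_lowerbound[OF moll_osc_tendsto_0[OF f]]) (use le in auto)
    then have "(\<integral>\<^sup>+ x. ennreal \<bar>indicator (cball 0 (real R)) x * h x\<bar> \<partial>lborel) = 0"
      by (simp only: le_zero_eq)
    moreover have [measurable]: "cball (0::'a) (real R) \<in> sets borel" by simp
    then have m: "(\<lambda>x. \<bar>indicator (cball 0 (real R)) x * h x\<bar>) \<in> borel_measurable borel"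
      by measurable
    ultimately have "AE x in lborel. ennreal \<bar>indicator (cball 0 (real R)) x * h x\<bar> = 0"
      by (subst (asm) nn_integral_0_iff_AE) (use m in simp_all)
    then show ?thesis by eventually_elim (simp add: indicator_def split: if_splits)
  qed
  then have "AE x in lborel. \<forall>R::nat. indicator (cball 0 (real R)) x * h x = 0"
    by (subst AE_all_countable) blast
  then show ?thesis
  proof eventually_elim
    case (elim x)
    obtain R :: nat where "norm x \<le> real R" using real_arch_simple by blast
    then show ?case using elim[rule_format, of R] by (auto simp: indicator_def)
  qed
qed

section \<open>Weak derivatives of squares\<close>

text \<open>
  The weak partial derivative in direction \<open>b\<close>, stated for the Lebesgue measure on Borel sets:
  product measures and Fubini's theorem are applied to Borel representatives, and the
  completed measure only enters at the end.
\<close>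

definition weak_partial :: "'a::euclidean_space \<Rightarrow> ('a \<Rightarrow> real) \<Rightarrow> ('a \<Rightarrow> real) \<Rightarrow> bool" where
  "weak_partial b u g \<longleftrightarrow> (\<forall>\<phi>. test_function \<phi> \<longrightarrow>
     (LINT x|lborel. u x * frechet_derivative \<phi> (at x) b) = - (LINT x|lborel. g x * \<phi> x))"

definition dmoll :: "nat \<Rightarrow> 'a::euclidean_space \<Rightarrow> 'a \<Rightarrow> real" where
  "dmoll n b z = frechet_derivative (moll n) (at z) b"

lemma smooth_term_moll_0: "smooth_term (moll n)"
  using smooth_term_moll[of n 0] by simp

lemma has_derivative_moll: "(moll n has_derivative (\<lambda>b. dmoll n b z)) (at z)"
  using smooth_term_has_derivative[OF smooth_term_moll_0[of n]]
  unfolding dmoll_def by (metis frechet_derivative_at)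

lemma smooth_term_continuous: "smooth_term f \<Longrightarrow> continuous_on UNIV f"
  using smooth_term_C_times[of f 0] by simp

lemma smooth_term_dmoll:
  fixes b :: "'a::euclidean_space"
  shows "smooth_term (dmoll n b)"
proof -
  obtain f' :: "'a \<Rightarrow> 'a \<Rightarrow> real" where f': "\<And>x. (moll n has_derivative f' x) (at x)" "\<And>b. smooth_term (\<lambda>x. f' x b)"
    using smooth_term_has_derivative[OF smooth_term_moll_0[of n]] by blast
  then have "dmoll n b = (\<lambda>x. f' x b)"
    unfolding dmoll_def by (metis frechet_derivative_at)
  with f' show ?thesis by simp
qed

lemma continuous_dmoll: "continuous_on UNIV (dmoll n b)"
  by (rule smooth_term_continuous[OF smooth_term_dmoll])

lemma borel_measurable_dmoll [measurable]: "dmoll n b \<in> borel_measurable borel"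
  by (rule borel_measurable_continuous_onI[OF continuous_dmoll])

lemma dmoll_eq_0:
  assumes "moll_rad n < norm z"
  shows "dmoll n b z = 0"
proof -
  have "open (- cball (0::'a) (moll_rad n))" by (simp add: open_Compl)
  then have "((\<lambda>_. 0) has_derivative (\<lambda>b. dmoll n b z)) (at z)"
    by (rule has_derivative_transform_within_open[OF has_derivative_moll[of n z]])
       (use assms in \<open>auto intro!: moll_eq_0\<close>)
  then have "(\<lambda>b. dmoll n b z) = (\<lambda>_. 0)"
    using has_derivative_unique[OF _ has_derivative_const] by blast
  then show ?thesis by meson
qed

lemma dmoll_minus: "dmoll n b (- z) = - dmoll n b z"
proof -
  have "((\<lambda>z. moll n (- z)) has_derivative (\<lambda>b. dmoll n (- b) (- z))) (at z)"
    by (rule has_derivative_compose[OF _ has_derivative_moll, of uminus uminus])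
       (auto intro!: derivative_eq_intros)
  then have "(moll n has_derivative (\<lambda>b. dmoll n (- b) (- z))) (at z)"
    by (simp add: moll_minus)
  then have "(\<lambda>b. dmoll n (- b) (- z)) = (\<lambda>b. dmoll n b z)"
    by (rule has_derivative_unique[OF _ has_derivative_moll])
  then have "dmoll n (- b) (- z) = dmoll n b z" by meson
  moreover have "dmoll n (- b) (- z) = - dmoll n b (- z)"
    by (rule linear_neg[OF has_derivative_linear[OF has_derivative_moll]])
  ultimately show ?thesis by simp
qed

lemma bounded_compact_support:
  fixes f :: "'a::euclidean_space \<Rightarrow> real"
  assumes "continuous_on UNIV f" "\<And>x. r < norm x \<Longrightarrow> f x = 0"
  obtains C where "0 \<le> C" "\<And>x. \<bar>f x\<bar> \<le> C"
proof -
  have "compact (f ` cball 0 r)"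
    by (rule compact_continuous_image[OF continuous_on_subset[OF assms(1)]]) auto
  then have "bounded (f ` cball 0 r)" by (rule compact_imp_bounded)
  then obtain C where "\<forall>y \<in> f ` cball 0 r. norm y \<le> C" unfolding bounded_iff by blast
  then have C: "\<And>x. x \<in> cball 0 r \<Longrightarrow> \<bar>f x\<bar> \<le> C" by auto
  have "\<bar>f x\<bar> \<le> max C 0" for x
    using C[of x] assms(2)[of x] by (cases "norm x \<le> r") auto
  then show ?thesis by (intro that[of "max C 0"]) auto
qed

lemma integrable_compact_support:
  fixes f :: "'a::euclidean_space \<Rightarrow> real"
  assumes "continuous_on UNIV f" "\<And>x. r < norm x \<Longrightarrow> f x = 0"
  shows "integrable lborel f"
proof -
  have "integrable lborel (\<lambda>x. indicator (cball 0 r) x *\<^sub>R f x)"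
    by (rule borel_integrable_compact[OF _ continuous_on_subset[OF assms(1)]]) auto
  moreover have "(\<lambda>x. indicator (cball 0 r) x *\<^sub>R f x) = f"
    using assms(2) by (auto simp: fun_eq_iff indicator_def not_le)
  ultimately show ?thesis by simp
qed

lemma dmoll_bounded: obtains C where "0 \<le> C" "\<And>z. \<bar>dmoll n b z\<bar> \<le> C"
  using bounded_compact_support[OF continuous_dmoll dmoll_eq_0] by metis

lemma integrable_dmoll: "integrable lborel (dmoll n b)"
  by (rule integrable_compact_support[OF continuous_dmoll dmoll_eq_0])

lemma has_derivative_moll_shift:
  "((\<lambda>x. moll n (x - a)) has_derivative (\<lambda>b. dmoll n b (x - a))) (at x)"
  by (rule has_derivative_compose[OF _ has_derivative_moll, of "\<lambda>x. x - a" "\<lambda>b. b"])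
     (auto intro!: derivative_eq_intros)

lemma frechet_derivative_moll_shift:
  "frechet_derivative (\<lambda>x. moll n (x - a)) (at x) b = dmoll n b (x - a)"
  using frechet_derivative_at[OF has_derivative_moll_shift[of n a x]] by metis

lemma frechet_derivative_moll_mult:
  "frechet_derivative (\<lambda>x. moll m (x - z) * moll n (x - y)) (at x) b =
     moll m (x - z) * dmoll n b (x - y) + dmoll m b (x - z) * moll n (x - y)"
  using frechet_derivative_at[OF has_derivative_mult[OF has_derivative_moll_shift[of m z x]
        has_derivative_moll_shift[of n y x]]] by metis

lemma integrable_bounded_mult_sq:
  fixes u k :: "'a::euclidean_space \<Rightarrow> real"
  assumes [measurable]: "u \<in> borel_measurable borel" "k \<in> borel_measurable borel"
    and "integrable lborel (\<lambda>x. (u x)\<^sup>2)" and C: "\<And>x. \<bar>k x\<bar> \<le> C"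
  shows "integrable lborel (\<lambda>x. (u x * k x)\<^sup>2)"
proof (rule Bochner_Integration.integrable_bound)
  show "integrable lborel (\<lambda>x. C\<^sup>2 * (u x)\<^sup>2)" using assms by simp
  have "(k x)\<^sup>2 \<le> C\<^sup>2" for x
    using C[of x] abs_le_square_iff[of "k x" C] by simp
  then show "AE x in lborel. norm ((u x * k x)\<^sup>2) \<le> norm (C\<^sup>2 * (u x)\<^sup>2)"
    by (auto simp: power_mult_distrib mult.commute intro!: mult_right_mono)
qed measurable

lemma integrable_moll_sq: "integrable lborel (\<lambda>x. (moll n (x - y :: 'a::euclidean_space))\<^sup>2)"
proof (rule integrable_compact_support[where r = "norm y + moll_rad n"])
  show "(moll n (x - y))\<^sup>2 = 0" if "norm y + moll_rad n < norm x" for x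
    using moll_eq_0[of n "x - y"] that norm_triangle_ineq2[of x y] by simp
qed (intro continuous_intros continuous_on_compose2[OF continuous_moll] subset_UNIV)

lemma integrable_dmoll_sq: "integrable lborel (\<lambda>x. (dmoll n b (x - y :: 'a::euclidean_space))\<^sup>2)"
proof (rule integrable_compact_support[where r = "norm y + moll_rad n"])
  show "(dmoll n b (x - y))\<^sup>2 = 0" if "norm y + moll_rad n < norm x" for x
    using dmoll_eq_0[of n "x - y"] that norm_triangle_ineq2[of x y] by simp
qed (intro continuous_intros continuous_on_compose2[OF continuous_dmoll] subset_UNIV)

text \<open>
  The chain rule \<open>D(u\<^sup>2) = 2 u Du\<close> for the test functions that are needed later, namely the
  kernels \<open>\<phi>\<close>. For each \<open>y\<close> the product \<open>\<phi>(x) moll n (x - y)\<close> is a test function. Testing \<open>u\<close> with it,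
  multiplying by \<open>u(y)\<close> and integrating over \<open>y\<close> gives three correlations with sum zero; in the one
  that contains the derivative of the kernel, the weak derivative is applied once more in \<open>y\<close>.
  As \<open>n\<close> tends to infinity the correlations converge to the three terms of the chain rule.
\<close>

theorem weak_partial_square:
  fixes u g :: "'a::euclidean_space \<Rightarrow> real"
  assumes [measurable]: "u \<in> borel_measurable borel" "g \<in> borel_measurable borel"
    and u2: "integrable lborel (\<lambda>x. (u x)\<^sup>2)" and g2: "integrable lborel (\<lambda>x. (g x)\<^sup>2)"
    and weak: "weak_partial b u g"
  shows "(LINT x|lborel. (u x)\<^sup>2 * dmoll m b (x - z)) = - (LINT x|lborel. 2 * u x * g x * moll m (x - z))"
proof -
  define \<phi> where "\<phi> x = moll m (x - z)" for x
  define d\<phi> where "d\<phi> x = dmoll m b (x - z)" for x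
  have u_m: "u \<in> borel_measurable borel" and g_m: "g \<in> borel_measurable borel" by fact+
  have [measurable]: "\<phi> \<in> borel_measurable borel" "d\<phi> \<in> borel_measurable borel"
    unfolding \<phi>_def d\<phi>_def by measurable
  have m1: "(\<lambda>x. u x * d\<phi> x) \<in> borel_measurable borel"
    and m2: "(\<lambda>x. u x * \<phi> x) \<in> borel_measurable borel"
    and m3: "(\<lambda>x. g x * \<phi> x) \<in> borel_measurable borel"
    by measurable
  obtain C where C: "\<And>x. \<bar>\<phi> x\<bar> \<le> C"
    using moll_bounded[of m, where 'a='a] moll_nonneg[of m, where 'a='a] unfolding \<phi>_def by (metis abs_of_nonneg)
  obtain C' where C': "\<And>x. \<bar>d\<phi> x\<bar> \<le> C'"
    using dmoll_bounded[of m b] unfolding d\<phi>_def by metis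
  have sq: "integrable lborel (\<lambda>x. (u x * d\<phi> x)\<^sup>2)" "integrable lborel (\<lambda>x. (u x * \<phi> x)\<^sup>2)"
     "integrable lborel (\<lambda>x. (g x * \<phi> x)\<^sup>2)"
    by (rule integrable_bounded_mult_sq[OF _ _ u2 C'] integrable_bounded_mult_sq[OF _ _ u2 C]
        integrable_bounded_mult_sq[OF _ _ g2 C]; fact)+
  define P1 where "P1 n = (\<integral>(x, y). moll n (x - y) * ((u x * d\<phi> x) * u y) \<partial>(lborel \<Otimes>\<^sub>M lborel))" for n
  define P2 where "P2 n = (\<integral>(x, y). moll n (x - y) * ((u x * \<phi> x) * g y) \<partial>(lborel \<Otimes>\<^sub>M lborel))" for n
  define P3 where "P3 n = (\<integral>(x, y). moll n (x - y) * ((g x * \<phi> x) * u y) \<partial>(lborel \<Otimes>\<^sub>M lborel))" for n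
  have zero: "P1 n + P2 n + P3 n = 0" for n
  proof -
    let ?M = "lborel \<Otimes>\<^sub>M lborel :: ('a \<times> 'a) measure"
    note i1 = integrable_kernel_pair[OF moll_integrable[of n] m1 u_m sq(1) u2]
    note i2 = integrable_kernel_pair[OF integrable_dmoll[of n b] m2 u_m sq(2) u2]
    note i2' = integrable_kernel_pair[OF moll_integrable[of n] m2 g_m sq(2) g2]
    note i3 = integrable_kernel_pair[OF moll_integrable[of n] m3 u_m sq(3) u2]
    \<comment> \<open>for fixed \<open>x\<close>, the weak derivative of \<open>u\<close> is tested with the kernel centred at \<open>x\<close>\<close>
    have P2: "(\<integral>(x, y). dmoll n b (x - y) * ((u x * \<phi> x) * u y) \<partial>?M) = P2 n"
    proof -
      have inner: "(LINT y|lborel. dmoll n b (x - y) * ((u x * \<phi> x) * u y)) =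
            (LINT y|lborel. moll n (x - y) * ((u x * \<phi> x) * g y))" for x
      proof -
        have "(LINT y|lborel. u y * dmoll n b (y - x)) = - (LINT y|lborel. g y * moll n (y - x))"
          using weak[unfolded weak_partial_def, rule_format, OF test_function_moll[of n x]]
          by (simp only: frechet_derivative_moll_shift)
        moreover have "dmoll n b (x - y) * ((u x * \<phi> x) * u y) = (u x * \<phi> x) * (- (u y * dmoll n b (y - x)))" for y
          using dmoll_minus[of n b "y - x"] by simp
        moreover have "moll n (x - y) * ((u x * \<phi> x) * g y) = (u x * \<phi> x) * (g y * moll n (y - x))" for y
          using moll_commute[of n x y] by simp
        ultimately show ?thesis
          by (simp only: integral_mult_right_zero Bochner_Integration.integral_minus minus_minus)
      qed
      have "(\<integral>(x, y). dmoll n b (x - y) * ((u x * \<phi> x) * u y) \<partial>?M) =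
         (LINT x|lborel. LINT y|lborel. dmoll n b (x - y) * ((u x * \<phi> x) * u y))"
        using lborel_pair.integral_fst'[OF i2] by simp
      also have "\<dots> = (LINT x|lborel. LINT y|lborel. moll n (x - y) * ((u x * \<phi> x) * g y))"
        by (simp only: inner)
      also have "\<dots> = P2 n"
        using lborel_pair.integral_fst'[OF i2'] by (simp add: P2_def)
      finally show ?thesis .
    qed
    have "P1 n + P2 n + P3 n = (\<integral>(x, y). moll n (x - y) * ((u x * d\<phi> x) * u y) +
         dmoll n b (x - y) * ((u x * \<phi> x) * u y) + moll n (x - y) * ((g x * \<phi> x) * u y) \<partial>?M)"
      unfolding P2[symmetric] P1_def P3_def
      using i1 i2 i3 by (simp add: split_beta')
    also have "\<dots> = (LINT y|lborel. LINT x|lborel. moll n (x - y) * ((u x * d\<phi> x) * u y) +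
         dmoll n b (x - y) * ((u x * \<phi> x) * u y) + moll n (x - y) * ((g x * \<phi> x) * u y))"
      using i1 i2 i3 by (intro lborel_pair.integral_snd[symmetric]) (simp add: split_beta')
    also have "\<dots> = (LINT (y::'a)|lborel. 0)"
    proof (rule Bochner_Integration.integral_cong[OF refl])
      fix y
      have t: "(LINT x|lborel. u x * (\<phi> x * dmoll n b (x - y) + d\<phi> x * moll n (x - y))) =
           - (LINT x|lborel. g x * (\<phi> x * moll n (x - y)))"
        using weak[unfolded weak_partial_def, rule_format, OF test_function_moll_mult[of m z n y]]
        by (simp add: frechet_derivative_moll_mult \<phi>_def d\<phi>_def)
      note msq = integrable_moll_sq[of n y] integrable_dmoll_sq[of n b y]
      have "integrable lborel (\<lambda>x. (u x * \<phi> x) * dmoll n b (x - y))"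
        "integrable lborel (\<lambda>x. (u x * d\<phi> x) * moll n (x - y))"
        "integrable lborel (\<lambda>x. (g x * \<phi> x) * moll n (x - y))"
        by (rule integrable_mult_L2[OF _ _ sq(2) msq(2)] integrable_mult_L2[OF _ _ sq(1) msq(1)]
            integrable_mult_L2[OF _ _ sq(3) msq(1)]; measurable)+
      then have "(LINT x|lborel. u x * (\<phi> x * dmoll n b (x - y) + d\<phi> x * moll n (x - y))) +
           (LINT x|lborel. g x * (\<phi> x * moll n (x - y))) =
          (LINT x|lborel. u x * (\<phi> x * dmoll n b (x - y) + d\<phi> x * moll n (x - y)) + g x * (\<phi> x * moll n (x - y)))"
        by (simp add: distrib_left mult.assoc)
      with t have "(LINT x|lborel. u x * (\<phi> x * dmoll n b (x - y) + d\<phi> x * moll n (x - y)) + g x * (\<phi> x * moll n (x - y))) = 0"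
        by simp
      then have "u y * (LINT x|lborel. u x * (\<phi> x * dmoll n b (x - y) + d\<phi> x * moll n (x - y)) + g x * (\<phi> x * moll n (x - y))) = 0"
        by simp
      moreover have "moll n (x - y) * ((u x * d\<phi> x) * u y) +
         dmoll n b (x - y) * ((u x * \<phi> x) * u y) + moll n (x - y) * ((g x * \<phi> x) * u y) =
         u y * (u x * (\<phi> x * dmoll n b (x - y) + d\<phi> x * moll n (x - y)) + g x * (\<phi> x * moll n (x - y)))" for x
        by (simp add: algebra_simps)
      ultimately show "(LINT x|lborel. moll n (x - y) * ((u x * d\<phi> x) * u y) +
         dmoll n b (x - y) * ((u x * \<phi> x) * u y) + moll n (x - y) * ((g x * \<phi> x) * u y)) = 0"
        by (simp only: integral_mult_right_zero)
    qed
    finally show ?thesis by simp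
  qed
  have "(\<lambda>n. P1 n + P2 n + P3 n) \<longlonglongrightarrow> (LINT x|lborel. (u x * d\<phi> x) * u x) +
     (LINT x|lborel. (u x * \<phi> x) * g x) + (LINT x|lborel. (g x * \<phi> x) * u x)"
    unfolding P1_def P2_def P3_def
    by (intro tendsto_add moll_correlation m1 m2 m3 u_m g_m sq u2 g2)
  then have "(LINT x|lborel. (u x * d\<phi> x) * u x) +
     (LINT x|lborel. (u x * \<phi> x) * g x) + (LINT x|lborel. (g x * \<phi> x) * u x) = 0"
    unfolding zero using LIMSEQ_unique tendsto_const by blast
  moreover have "(LINT x|lborel. 2 * u x * g x * \<phi> x) = 2 * (LINT x|lborel. (g x * \<phi> x) * u x)"
    by (subst integral_mult_right_zero[symmetric]) (simp add: mult_ac)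
  moreover have "(LINT x|lborel. (u x * \<phi> x) * g x) = (LINT x|lborel. (g x * \<phi> x) * u x)"
    "(LINT x|lborel. (u x)\<^sup>2 * d\<phi> x) = (LINT x|lborel. (u x * d\<phi> x) * u x)"
    by (simp_all add: power2_eq_square mult_ac)
  ultimately show ?thesis
    unfolding \<phi>_def[symmetric] d\<phi>_def[symmetric] by linarith
qed

section \<open>Mollified functions and classical derivatives\<close>

lemma continuous_convolution:
  fixes k f :: "'a::euclidean_space \<Rightarrow> real"
  assumes k: "continuous_on UNIV k" and C: "\<And>z. \<bar>k z\<bar> \<le> C" and f: "integrable lborel f"
  shows "continuous_on UNIV (\<lambda>x. LINT y|lborel. k (x - y) * f y)"
  unfolding continuous_on_eq_continuous_at[OF open_UNIV] continuous_at_sequentially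
proof (intro ballI allI impI)
  fix x :: 'a and X :: "nat \<Rightarrow> 'a" assume X: "X \<longlonglongrightarrow> x"
  have [measurable]: "f \<in> borel_measurable borel" "k \<in> borel_measurable borel"
    using borel_measurable_integrable[OF f] borel_measurable_continuous_onI[OF k] by auto
  have "(\<lambda>n. LINT y|lborel. k (X n - y) * f y) \<longlonglongrightarrow> (LINT y|lborel. k (x - y) * f y)"
  proof (rule integral_dominated_convergence[where w = "\<lambda>y. C * \<bar>f y\<bar>"])
    show "AE y in lborel. (\<lambda>n. k (X n - y) * f y) \<longlonglongrightarrow> k (x - y) * f y"
    proof (rule AE_I2)
      fix y
      have "isCont k (x - y)" using k by (simp add: continuous_on_eq_continuous_at)
      then have "(\<lambda>n. k (X n - y)) \<longlonglongrightarrow> k (x - y)"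
        by (rule isCont_tendsto_compose) (intro tendsto_intros X)
      then show "(\<lambda>n. k (X n - y) * f y) \<longlonglongrightarrow> k (x - y) * f y"
        by (intro tendsto_intros)
    qed
    show "AE y in lborel. norm (k (X n - y) * f y) \<le> C * \<bar>f y\<bar>" for n
      using C by (auto simp: abs_mult intro!: mult_right_mono)
  qed (use f in auto)
  then show "((\<lambda>x. LINT y|lborel. k (x - y) * f y) \<circ> X) \<longlonglongrightarrow> (LINT y|lborel. k (x - y) * f y)"
    by (simp add: comp_def)
qed

lemma moll_abs_bounded: obtains C where "0 \<le> C" "\<And>z::'a::euclidean_space. \<bar>moll n z\<bar> \<le> C"
proof (rule bounded_compact_support[OF continuous_moll])
  show "moll n x = 0" if "moll_rad n < norm x" for x :: 'a
    by (rule moll_eq_0) (use that in simp)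
qed blast

lemma continuous_moll_conv:
  fixes f :: "'a::euclidean_space \<Rightarrow> real"
  assumes "integrable lborel f"
  shows "continuous_on UNIV (moll_conv n f)"
proof -
  obtain C where "\<And>z::'a. \<bar>moll n z\<bar> \<le> C" using moll_abs_bounded by blast
  then show ?thesis
    unfolding moll_conv_def[abs_def] by (rule continuous_convolution[OF continuous_moll _ assms])
qed

lemma moll_line_derivative:
  "((\<lambda>t. moll n (z + t *\<^sub>R b)) has_real_derivative dmoll n b (z + t *\<^sub>R b)) (at t)"
proof -
  have lin: "dmoll n (h *\<^sub>R b) y = dmoll n b y * h" for h y
    using linear_scale[OF has_derivative_linear[OF has_derivative_moll[of n y]], of h b] by simp
  have "((\<lambda>t. moll n (z + t *\<^sub>R b)) has_derivative (\<lambda>h. dmoll n (h *\<^sub>R b) (z + t *\<^sub>R b))) (at t)"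
    by (rule has_derivative_compose[OF _ has_derivative_moll, of "\<lambda>t. z + t *\<^sub>R b" "\<lambda>h. h *\<^sub>R b"])
       (auto intro!: derivative_eq_intros)
  then show ?thesis
    by (simp add: has_field_derivative_def lin)
qed

text \<open>
  The difference quotients of the kernel are bounded uniformly, so dominated convergence
  differentiates under the integral; the weak derivative then moves the derivative from the
  kernel to \<open>v\<close>.
\<close>

lemma moll_conv_derivative:
  fixes v G :: "'a::euclidean_space \<Rightarrow> real"
  assumes v: "integrable lborel v"
    and parts: "\<And>z. (LINT x|lborel. v x * dmoll n b (x - z)) = - (LINT x|lborel. G x * moll n (x - z))"
  shows "((\<lambda>t. moll_conv n v (x + t *\<^sub>R b)) has_real_derivative moll_conv n G (x + t *\<^sub>R b)) (at t)"
proof -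
  have [measurable]: "v \<in> borel_measurable borel" using borel_measurable_integrable[OF v] by simp
  obtain C where C: "0 \<le> C" "\<And>z. \<bar>dmoll n b z\<bar> \<le> C" using dmoll_bounded by blast
  define x0 where "x0 = x + t *\<^sub>R b"
  have lip: "\<bar>moll n (z + h *\<^sub>R b) - moll n z\<bar> \<le> C * \<bar>h\<bar>" for z h
    using field_differentiable_bound[of UNIV "\<lambda>t. moll n (z + t *\<^sub>R b)" "\<lambda>t. dmoll n b (z + t *\<^sub>R b)" C h 0]
      moll_line_derivative[of n z b] C by simp
  have der: "(LINT y|lborel. dmoll n b (x0 - y) * v y) = moll_conv n G x0"
  proof -
    have "dmoll n b (x0 - y) * v y = - (v y * dmoll n b (y - x0))" for y
      using dmoll_minus[of n b "y - x0"] by simp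
    then have "(LINT y|lborel. dmoll n b (x0 - y) * v y) = (LINT x|lborel. G x * moll n (x - x0))"
      using parts[of x0] by (simp only: Bochner_Integration.integral_minus minus_minus)
    then show ?thesis unfolding moll_conv_def by (simp add: mult.commute moll_commute[of n x0])
  qed
  have "((\<lambda>h. (moll_conv n v (x0 + h *\<^sub>R b) - moll_conv n v x0) / h) \<longlongrightarrow> moll_conv n G x0) (at 0)"
    unfolding tendsto_at_iff_sequentially
  proof (intro allI impI)
    fix X :: "nat \<Rightarrow> real" assume X: "\<forall>i. X i \<in> UNIV - {0}" "X \<longlonglongrightarrow> 0"
    have eq: "(moll_conv n v (x0 + X i *\<^sub>R b) - moll_conv n v x0) / X i =
       (LINT y|lborel. (moll n ((x0 - y) + X i *\<^sub>R b) - moll n (x0 - y)) / X i * v y)" for i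
    proof -
      have "moll_conv n v (x0 + X i *\<^sub>R b) - moll_conv n v x0 =
         (LINT y|lborel. moll n (x0 + X i *\<^sub>R b - y) * v y - moll n (x0 - y) * v y)"
        unfolding moll_conv_def
        by (intro Bochner_Integration.integral_diff[symmetric] integrable_moll_mult v)
      also have "\<dots> / X i = (LINT y|lborel. (moll n (x0 + X i *\<^sub>R b - y) * v y - moll n (x0 - y) * v y) / X i)"
        by simp
      finally show ?thesis by (simp add: algebra_simps diff_divide_distrib)
    qed
    have "(\<lambda>i. LINT y|lborel. (moll n ((x0 - y) + X i *\<^sub>R b) - moll n (x0 - y)) / X i * v y)
        \<longlonglongrightarrow> (LINT y|lborel. dmoll n b (x0 - y) * v y)"
    proof (rule integral_dominated_convergence[where w = "\<lambda>y. C * \<bar>v y\<bar>"])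
      show "AE y in lborel. (\<lambda>i. (moll n ((x0 - y) + X i *\<^sub>R b) - moll n (x0 - y)) / X i * v y)
          \<longlonglongrightarrow> dmoll n b (x0 - y) * v y"
      proof (rule AE_I2)
        fix y
        have "((\<lambda>h. (moll n ((x0 - y) + h *\<^sub>R b) - moll n (x0 - y)) / h) \<longlongrightarrow> dmoll n b (x0 - y)) (at 0)"
          using moll_line_derivative[of n "x0 - y" b 0] by (simp add: has_field_derivative_iff)
        then have "(\<lambda>i. (moll n ((x0 - y) + X i *\<^sub>R b) - moll n (x0 - y)) / X i) \<longlonglongrightarrow> dmoll n b (x0 - y)"
          using X unfolding tendsto_at_iff_sequentially comp_def by blast
        then show "(\<lambda>i. (moll n ((x0 - y) + X i *\<^sub>R b) - moll n (x0 - y)) / X i * v y)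
          \<longlonglongrightarrow> dmoll n b (x0 - y) * v y"
          by (intro tendsto_intros)
      qed
      show "AE y in lborel. norm ((moll n ((x0 - y) + X i *\<^sub>R b) - moll n (x0 - y)) / X i * v y) \<le> C * \<bar>v y\<bar>" for i
      proof (rule AE_I2)
        fix y
        have "\<bar>moll n ((x0 - y) + X i *\<^sub>R b) - moll n (x0 - y)\<bar> / \<bar>X i\<bar> \<le> C"
          using lip[of "x0 - y" "X i"] X(1) by (simp add: divide_le_eq)
        then show "norm ((moll n ((x0 - y) + X i *\<^sub>R b) - moll n (x0 - y)) / X i * v y) \<le> C * \<bar>v y\<bar>"
          by (simp only: real_norm_def abs_mult abs_divide) (intro mult_right_mono; simp)
      qed
      show "(\<lambda>y. (moll n ((x0 - y) + X i *\<^sub>R b) - moll n (x0 - y)) / X i * v y) \<in> borel_measurable lborel" for i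
        by measurable
      show "(\<lambda>y. dmoll n b (x0 - y) * v y) \<in> borel_measurable lborel"
        by measurable
    qed (use v in auto)
    then show "((\<lambda>h. (moll_conv n v (x0 + h *\<^sub>R b) - moll_conv n v x0) / h) \<circ> X) \<longlonglongrightarrow> moll_conv n G x0"
      by (simp add: comp_def eq der)
  qed
  then show ?thesis
    by (simp add: DERIV_def x0_def algebra_simps)
qed

text \<open>
  Jensen's inequality for the probability density \<open>moll n (x - y)\<close>, in the form that a variance is
  nonnegative.
\<close>

lemma moll_conv_square_le:
  fixes G :: "'a::euclidean_space \<Rightarrow> real"
  assumes G: "integrable lborel G" and G2: "integrable lborel (\<lambda>x. (G x)\<^sup>2)"
  shows "(\<integral>\<^sup>+ x. ennreal ((moll_conv n G x)\<^sup>2) \<partial>lborel) \<le> (\<integral>\<^sup>+ x. ennreal ((G x)\<^sup>2) \<partial>lborel)"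
proof -
  have [measurable]: "G \<in> borel_measurable borel" using borel_measurable_integrable[OF G] by simp
  have "(\<integral>\<^sup>+ x. ennreal ((moll_conv n G x)\<^sup>2) \<partial>lborel) \<le>
     (\<integral>\<^sup>+ x. \<integral>\<^sup>+ y. ennreal (moll n (x - y)) * ennreal ((G y)\<^sup>2) \<partial>lborel \<partial>lborel)"
  proof (intro nn_integral_mono)
    fix x :: 'a
    define c where "c = moll_conv n G x"
    note i = integrable_moll_mult[OF G2, of n x] integrable_moll_mult[OF G, of n x] integrable_moll_shift[of n x]
    have "0 \<le> (LINT y|lborel. moll n (x - y) * (G y - c)\<^sup>2)"
      by (intro integral_nonneg_AE) (auto simp: moll_nonneg)
    also have "\<dots> = (LINT y|lborel. (moll n (x - y) * (G y)\<^sup>2 - 2 * c * (moll n (x - y) * G y)) + c\<^sup>2 * moll n (x - y))"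
      by (intro Bochner_Integration.integral_cong) (auto simp: power2_eq_square algebra_simps)
    also have "\<dots> = (LINT y|lborel. moll n (x - y) * (G y)\<^sup>2) - 2 * c * c + c\<^sup>2"
      using i by (simp add: c_def moll_conv_def integral_moll_shift)
    finally have "c\<^sup>2 \<le> (LINT y|lborel. moll n (x - y) * (G y)\<^sup>2)"
      by (simp add: power2_eq_square)
    then have "ennreal (c\<^sup>2) \<le> ennreal (LINT y|lborel. moll n (x - y) * (G y)\<^sup>2)" by (rule ennreal_leI)
    also have "\<dots> = (\<integral>\<^sup>+ y. ennreal (moll n (x - y) * (G y)\<^sup>2) \<partial>lborel)"
      by (rule nn_integral_eq_integral[symmetric]) (use i in \<open>auto simp: moll_nonneg\<close>)
    finally show "ennreal ((moll_conv n G x)\<^sup>2) \<le> (\<integral>\<^sup>+ y. ennreal (moll n (x - y)) * ennreal ((G y)\<^sup>2) \<partial>lborel)"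
      by (simp add: c_def ennreal_mult moll_nonneg)
  qed
  also have "\<dots> = (\<integral>\<^sup>+ x. ennreal ((G x)\<^sup>2) \<partial>lborel)"
    by (rule nn_integral_moll_right) measurable
  finally show ?thesis .
qed

lemma lborel_integral_shift:
  fixes h :: "'a::euclidean_space \<Rightarrow> real"
  assumes [measurable]: "h \<in> borel_measurable borel"
  shows "(LINT x|lborel. h (x + a)) = (LINT x|lborel. h x)"
proof -
  have "(LINT x|lborel. h x) = (LINT x|distr lborel borel ((+) a). h x)"
    by (simp only: lborel_distr_plus)
  also have "\<dots> = (LINT x|lborel. h (a + x))"
    by (rule integral_distr) auto
  finally show ?thesis by (simp add: add.commute)
qed

text \<open>
  Translation invariance makes the integral of every difference quotient zero, and dominated
  convergence passes to the derivative.
\<close>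

lemma integral_partial_derivative_0:
  fixes h h' :: "'a::euclidean_space \<Rightarrow> real"
  assumes h: "continuous_on UNIV h" and h': "continuous_on UNIV h'"
    and supp: "\<And>x. r < norm x \<Longrightarrow> h x = 0" "\<And>x. r < norm x \<Longrightarrow> h' x = 0"
    and der: "\<And>x t. ((\<lambda>t. h (x + t *\<^sub>R b)) has_real_derivative h' (x + t *\<^sub>R b)) (at t)"
  shows "(LINT x|lborel. h' x) = 0"
proof -
  have [measurable]: "h \<in> borel_measurable borel" "h' \<in> borel_measurable borel"
    using h h' by (auto intro: borel_measurable_continuous_onI)
  have hi: "integrable lborel h" by (rule integrable_compact_support[OF h supp(1)])
  obtain C where C: "0 \<le> C" "\<And>x. \<bar>h' x\<bar> \<le> C"
    using bounded_compact_support[OF h' supp(2)] by metis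
  define T where "T n = inverse (real (Suc n))" for n
  have T: "0 < T n" "T n \<le> 1" for n by (auto simp: T_def field_simps)
  have T0: "T \<longlonglongrightarrow> 0" unfolding T_def by (rule LIMSEQ_inverse_real_of_nat)
  define Q where "Q n x = (h (x + T n *\<^sub>R b) - h x) / T n" for n x
  have lip: "\<bar>h (x + t *\<^sub>R b) - h x\<bar> \<le> C * \<bar>t\<bar>" for x t
    using field_differentiable_bound[of UNIV "\<lambda>t. h (x + t *\<^sub>R b)" "\<lambda>t. h' (x + t *\<^sub>R b)" C t 0]
      der[of x] C by simp
  have "(LINT x|lborel. Q n x) = 0" for n
  proof -
    have "integrable lborel (\<lambda>x. h (x + T n *\<^sub>R b))"
    proof (rule integrable_compact_support[where r = "\<bar>r\<bar> + norm (T n *\<^sub>R b)"])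
      show "continuous_on UNIV (\<lambda>x. h (x + T n *\<^sub>R b))"
        by (intro continuous_on_compose2[OF h] continuous_intros) auto
      show "h (x + T n *\<^sub>R b) = 0" if "\<bar>r\<bar> + norm (T n *\<^sub>R b) < norm x" for x
        using that norm_diff_ineq[of x "T n *\<^sub>R b"] by (intro supp) linarith
    qed
    then show ?thesis
      using hi lborel_integral_shift[of h "T n *\<^sub>R b"] by (simp add: Q_def)
  qed
  moreover have "(\<lambda>n. LINT x|lborel. Q n x) \<longlonglongrightarrow> (LINT x|lborel. h' x)"
  proof (rule integral_dominated_convergence[where w = "\<lambda>x. C * indicator (cball 0 (\<bar>r\<bar> + norm b)) x"])
    have "emeasure lborel (cball (0::'a) (\<bar>r\<bar> + norm b)) < \<infinity>"
      by (rule emeasure_bounded_finite) simp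
    then show "integrable lborel (\<lambda>x::'a. C * indicator (cball 0 (\<bar>r\<bar> + norm b)) x)"
      by (intro integrable_mult_right integrable_real_indicator) auto
    show "AE x in lborel. (\<lambda>n. Q n x) \<longlonglongrightarrow> h' x"
    proof (rule AE_I2)
      fix x
      have "((\<lambda>t. (h (x + t *\<^sub>R b) - h x) / t) \<longlongrightarrow> h' x) (at 0)"
        using der[of x 0] by (simp add: has_field_derivative_iff)
      then show "(\<lambda>n. Q n x) \<longlonglongrightarrow> h' x"
        unfolding Q_def by (rule filterlim_compose) (use T in \<open>auto simp: filterlim_at T0 less_imp_neq[symmetric]\<close>)
    qed
    show "AE x in lborel. norm (Q n x) \<le> C * indicator (cball 0 (\<bar>r\<bar> + norm b)) x" for n
    proof (rule AE_I2)
      fix x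
      show "norm (Q n x) \<le> C * indicator (cball 0 (\<bar>r\<bar> + norm b)) x"
      proof (cases "norm x \<le> \<bar>r\<bar> + norm b")
        case True
        then show ?thesis using lip[of x "T n"] T[of n] by (simp add: Q_def divide_le_eq abs_of_pos)
      next
        case False
        have "norm (T n *\<^sub>R b) \<le> norm b" using T[of n] by (simp add: mult_left_le_one_le)
        with False have "r < norm (x + T n *\<^sub>R b)"
          using norm_diff_ineq[of x "T n *\<^sub>R b"] by linarith
        moreover have "r < norm x" using False norm_ge_zero[of b] by linarith
        ultimately show ?thesis using supp(1)[of x] supp(1)[of "x + T n *\<^sub>R b"] False by (auto simp: Q_def)
      qed
    qed
  qed (simp_all add: Q_def)
  ultimately have "(\<lambda>n::nat. 0::real) \<longlonglongrightarrow> (LINT x|lborel. h' x)" by simp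
  then show ?thesis by (metis LIMSEQ_unique tendsto_const)
qed

theorem weak_partial_classical:
  fixes f f' :: "'a::euclidean_space \<Rightarrow> real"
  assumes b: "b \<in> Basis" and f: "continuous_on UNIV f" and f': "continuous_on UNIV f'"
    and der: "\<And>x t. ((\<lambda>t. f (x + t *\<^sub>R b)) has_real_derivative f' (x + t *\<^sub>R b)) (at t)"
  shows "weak_partial b f f'"
  unfolding weak_partial_def
proof (intro allI impI)
  fix \<phi> :: "'a \<Rightarrow> real" assume "test_function \<phi>"
  then have "C_times (Suc 0) \<phi>" and cpt: "compact (closure {x. \<phi> x \<noteq> 0})"
    unfolding test_function_def by blast+
  then have diff: "\<phi> differentiable_on UNIV" and cont': "continuous_on UNIV (\<lambda>x. frechet_derivative \<phi> (at x) b)"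
    using b by auto
  define d\<phi> where "d\<phi> x = frechet_derivative \<phi> (at x) b" for x
  have has: "(\<phi> has_derivative frechet_derivative \<phi> (at x)) (at x)" for x
    using diff by (simp add: differentiable_on_def frechet_derivative_works)
  have cont: "continuous_on UNIV \<phi>" using diff by (rule differentiable_imp_continuous_on)
  have cont_d: "continuous_on UNIV d\<phi>" using cont' by (simp add: d\<phi>_def[abs_def])
  from compact_imp_bounded[OF cpt] obtain r where r: "\<And>x. x \<in> closure {x. \<phi> x \<noteq> 0} \<Longrightarrow> norm x \<le> r"
    unfolding bounded_iff by blast
  have z: "\<phi> x = 0" if "r < norm x" for x
    using r[of x] that closure_subset[of "{x. \<phi> x \<noteq> 0}"] by force
  have z': "d\<phi> x = 0" if "r < norm x" for x
  proof -
    have "((\<lambda>_. 0) has_derivative frechet_derivative \<phi> (at x)) (at x)"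
      by (rule has_derivative_transform_within_open[OF has, of "- cball 0 r"])
         (use that z in \<open>auto simp: open_Compl\<close>)
    then have "frechet_derivative \<phi> (at x) = (\<lambda>_. 0)"
      using has_derivative_unique[OF _ has_derivative_const] by blast
    then show ?thesis by (simp add: d\<phi>_def)
  qed
  have line: "((\<lambda>t. \<phi> (x + t *\<^sub>R b)) has_real_derivative d\<phi> (x + t *\<^sub>R b)) (at t)" for x t
  proof -
    have "((\<lambda>t. \<phi> (x + t *\<^sub>R b)) has_derivative (\<lambda>h. frechet_derivative \<phi> (at (x + t *\<^sub>R b)) (h *\<^sub>R b))) (at t)"
      by (rule has_derivative_compose[OF _ has, of "\<lambda>t. x + t *\<^sub>R b" "\<lambda>h. h *\<^sub>R b"])
         (auto intro!: derivative_eq_intros)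
    moreover have "frechet_derivative \<phi> (at y) (h *\<^sub>R b) = d\<phi> y * h" for y h
      using linear_scale[OF has_derivative_linear[OF has[of y]], of h b] by (simp add: d\<phi>_def)
    ultimately show ?thesis by (simp add: has_field_derivative_def)
  qed
  have i: "integrable lborel (\<lambda>x. f x * d\<phi> x)" "integrable lborel (\<lambda>x. f' x * \<phi> x)"
    by (intro integrable_compact_support[where r = r] continuous_on_mult f cont_d; simp add: z z')
       (intro integrable_compact_support[where r = r] continuous_on_mult f' cont; simp add: z z')
  have "(LINT x|lborel. f x * d\<phi> x + f' x * \<phi> x) = 0"
  proof (rule integral_partial_derivative_0[where h = "\<lambda>x. f x * \<phi> x" and r = r and b = b])
    show "((\<lambda>t. f (x + t *\<^sub>R b) * \<phi> (x + t *\<^sub>R b)) has_real_derivative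
       f (x + t *\<^sub>R b) * d\<phi> (x + t *\<^sub>R b) + f' (x + t *\<^sub>R b) * \<phi> (x + t *\<^sub>R b)) (at t)" for x t
      using DERIV_mult[OF der[of x t] line[of x t]] by (simp add: algebra_simps)
  qed (use z z' in \<open>auto intro!: continuous_intros f f' cont cont_d\<close>)
  then show "(LINT x|lborel. f x * frechet_derivative \<phi> (at x) b) = - (LINT x|lborel. f' x * \<phi> x)"
    using i unfolding d\<phi>_def by simp
qed

section \<open>Monotone transport along one axis\<close>

text \<open>
  The derivative is one-sided at \<open>x = 0\<close>, where the powers of nonnegative functions used below are
  not covered by the usual rule for positive bases.
\<close>

lemma powr_has_derivative_nonneg:
  fixes a x :: real
  assumes a: "1 < a" and x: "0 \<le> x"
  shows "((\<lambda>t. t powr a) has_real_derivative a * x powr (a - 1)) (at x within {0..})"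
proof (cases "x = 0")
  case False
  with x have "((\<lambda>t. t powr a) has_real_derivative a * x powr (a - 1)) (at x)"
    by (auto intro!: derivative_eq_intros)
  then show ?thesis by (rule has_field_derivative_at_within)
next
  case True
  have "((\<lambda>t::real. t powr (a - 1)) \<longlongrightarrow> 0 powr (a - 1)) (at 0 within {0..})"
    by (rule tendsto_powr'[OF tendsto_ident_at tendsto_const])
       (use a in \<open>auto simp: eventually_at_filter\<close>)
  then have "((\<lambda>t::real. t powr (a - 1)) \<longlongrightarrow> 0) (at 0 within {0..})" by simp
  then have "((\<lambda>t::real. (t powr a - 0 powr a) / (t - 0)) \<longlongrightarrow> 0) (at 0 within {0..})"
    by (rule Lim_transform_eventually)
       (auto simp: eventually_at_filter powr_diff)
  then show ?thesis using True a by (simp add: has_field_derivative_iff)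
qed

lemma powr_nth_power:
  fixes x :: real
  assumes "0 \<le> x" "0 < n"
  shows "(x powr a) ^ n = x powr (a * real n)"
proof (cases "x = 0")
  case False
  with assms have "(x powr a) ^ n = (x powr a) powr real n" by (simp add: powr_realpow)
  then show ?thesis by (simp add: powr_powr)
qed (use assms in simp)

lemma weighted_amgm3: "3 * (x\<^sup>2 * y) \<le> 2 * x ^ 3 + y ^ 3" if "0 \<le> x" "0 \<le> y" for x y :: real
proof -
  have "0 \<le> (x - y)\<^sup>2 * (2 * x + y)" using that by simp
  also have "\<dots> = 2 * x ^ 3 + y ^ 3 - 3 * (x\<^sup>2 * y)"
    by (simp add: power2_eq_square power3_eq_cube algebra_simps)
  finally show ?thesis by simp
qed

lemma amgm3:
  fixes a b c p :: real
  assumes "0 \<le> a" "0 \<le> b" "0 \<le> c" "0 \<le> p" "p ^ 3 \<le> a * b * c"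
  shows "3 * p \<le> a + b + c"
proof -
  have "(a * b * c) powr (1/3) \<le> (a + b + c) / 3"
  proof -
    define x where "x = a powr (1/3)"
    define y where "y = b powr (1/3)"
    define z where "z = c powr (1/3)"
    have c3: "x ^ 3 = a" "y ^ 3 = b" "z ^ 3 = c" and nn: "0 \<le> x" "0 \<le> y" "0 \<le> z"
      using assms by (auto simp: x_def y_def z_def powr_nth_power)
    have "0 \<le> (x + y + z) * ((x - y)\<^sup>2 + (y - z)\<^sup>2 + (z - x)\<^sup>2)"
      using nn by (intro mult_nonneg_nonneg add_nonneg_nonneg) auto
    also have "\<dots> = 2 * (x ^ 3 + y ^ 3 + z ^ 3) - 6 * (x * y * z)"
      by (simp add: power2_eq_square power3_eq_cube algebra_simps)
    finally have "x * y * z \<le> (a + b + c) / 3" unfolding c3 by simp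
    then show ?thesis unfolding x_def y_def z_def using assms by (simp add: powr_mult)
  qed
  moreover have "p \<le> (a * b * c) powr (1/3)"
  proof -
    have "p = (p ^ 3) powr (1/3)" using assms(4) by (cases "p = 0") (auto simp: powr_powr simp flip: powr_numeral)
    also have "\<dots> \<le> (a * b * c) powr (1/3)" using assms by (intro powr_mono2) auto
    finally show ?thesis .
  qed
  ultimately show ?thesis by simp
qed

text \<open>
  Two applications of Young's inequality with free parameters: \<open>s\<close> separates the derivative \<open>W\<close>, and
  \<open>l\<close> splits \<open>V\<^sup>1\<^sup>4\<^sup>/\<^sup>9 T\<^sup>2\<close> between \<open>V\<close> and \<open>V\<^sup>8\<^sup>/\<^sup>3 T\<^sup>6\<close>. Using parameters and optimising them after the
  integration replaces the Cauchy-Schwarz and Hoelder inequalities.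
\<close>

lemma young_transport:
  fixes V W T s l :: real
  assumes V: "0 \<le> V" and s: "0 < s" and l: "0 < l"
  shows "\<bar>V powr (7/9) * W * T\<bar> \<le> s / 2 * W\<^sup>2 + l / (3 * s) * V + 1 / (6 * s * l\<^sup>2) * (V powr (8/3) * T ^ 6)"
proof -
  \<comment> \<open>all exponents of \<open>V\<close> are multiples of \<open>1/9\<close>, so \<open>r\<close> turns them into natural powers\<close>
  define r where "r = V powr (1/9)"
  define k where "k = l powr (1/3)"
  have r: "0 \<le> r" and k: "0 < k" using l by (auto simp: r_def k_def)
  have V9: "V = r ^ 9" using V unfolding r_def by (subst powr_nth_power) auto
  have l3: "l = k ^ 3" using l unfolding k_def by (subst powr_nth_power) auto
  have p7: "V powr (7/9) = r ^ 7" and p8: "V powr (8/3) = r ^ 24"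
    using V unfolding r_def by (simp_all add: powr_nth_power)
  have "3 * ((k * r ^ 3)\<^sup>2 * (r ^ 8 * T\<^sup>2 / k\<^sup>2)) \<le> 2 * (k * r ^ 3) ^ 3 + (r ^ 8 * T\<^sup>2 / k\<^sup>2) ^ 3"
    by (rule weighted_amgm3) (use r k in auto)
  also have "(k * r ^ 3)\<^sup>2 * (r ^ 8 * T\<^sup>2 / k\<^sup>2) = (r ^ 7 * T)\<^sup>2"
    using k by (simp add: field_simps flip: power_mult power_add)
  also have "(k * r ^ 3) ^ 3 = l * V" by (simp add: V9 l3 power_mult_distrib flip: power_mult)
  also have "(r ^ 8 * T\<^sup>2 / k\<^sup>2) ^ 3 = V powr (8/3) * T ^ 6 / l\<^sup>2"
    by (simp add: p8 l3 power_mult_distrib power_divide flip: power_mult)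
  finally have A: "(r ^ 7 * T)\<^sup>2 \<le> 2 / 3 * (l * V) + 1 / 3 * (V powr (8/3) * T ^ 6 / l\<^sup>2)" by simp
  have "0 \<le> (s * \<bar>W\<bar> - \<bar>r ^ 7 * T\<bar>)\<^sup>2" by simp
  then have "2 * (s * \<bar>W\<bar>) * \<bar>r ^ 7 * T\<bar> \<le> s\<^sup>2 * W\<^sup>2 + (r ^ 7 * T)\<^sup>2"
    by (simp add: power2_diff power_mult_distrib del: abs_mult)
  then have "2 * s * \<bar>V powr (7/9) * W * T\<bar> \<le> s\<^sup>2 * W\<^sup>2 + (r ^ 7 * T)\<^sup>2"
    by (simp add: p7 abs_mult mult_ac)
  also have "\<dots> \<le> s\<^sup>2 * W\<^sup>2 + (2 / 3 * (l * V) + 1 / 3 * (V powr (8/3) * T ^ 6 / l\<^sup>2))"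
    using A by simp
  finally have "\<bar>V powr (7/9) * W * T\<bar> \<le> (s\<^sup>2 * W\<^sup>2 + (2 / 3 * (l * V) + 1 / 3 * (V powr (8/3) * T ^ 6 / l\<^sup>2))) / (2 * s)"
    using s by (simp add: le_divide_eq mult_ac)
  also have "\<dots> = s / 2 * W\<^sup>2 + l / (3 * s) * V + 1 / (6 * s * l\<^sup>2) * (V powr (8/3) * T ^ 6)"
    using s l by (simp add: field_simps power2_eq_square)
  finally show ?thesis .
qed

text \<open>
  \<open>T\<close> is the monotone map that transports the density \<open>\<rho>\<close> to the uniform density on \<open>[-1, 1]\<close>. The last
  identity is the sixth moment of the uniform distribution, \<open>1/7\<close>, seen through \<open>T\<close>.
\<close>

lemma transport_line:
  fixes R :: real
  assumes R: "0 < R" and \<rho>: "continuous_on {-R..R} \<rho>" and m: "m = integral {-R..R} \<rho>" "m \<noteq> 0"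
  obtains T where "\<And>t. t \<in> {-R..R} \<Longrightarrow> (T has_real_derivative 2 * \<rho> t / m) (at t within {-R..R})"
    "T (-R) = -1" "T R = 1" "integral {-R..R} (\<lambda>t. \<rho> t * T t ^ 6) = m / 7"
proof -
  define T where "T t = -1 + 2 * integral {-R..t} \<rho> / m" for t
  have der: "(T has_real_derivative 2 * \<rho> t / m) (at t within {-R..R})" if "t \<in> {-R..R}" for t
    unfolding T_def
    by (auto intro!: derivative_eq_intros integral_has_real_derivative[OF \<rho> that] simp: m(2))
  have ends: "T (-R) = -1" "T R = 1" using m by (simp_all add: T_def)
  \<comment> \<open>the integrand is the derivative of \<open>T\<^sup>7/7\<close>, and \<open>T\<close> runs from \<open>-1\<close> to \<open>1\<close>\<close>
  have "((\<lambda>t. T t ^ 6 * (2 * \<rho> t / m)) has_integral (T R ^ 7 / 7 - T (-R) ^ 7 / 7)) {-R..R}"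
  proof (rule fundamental_theorem_of_calculus)
    show "((\<lambda>t. T t ^ 7 / 7) has_vector_derivative T t ^ 6 * (2 * \<rho> t / m)) (at t within {-R..R})"
      if "t \<in> {-R..R}" for t
      unfolding has_real_derivative_iff_has_vector_derivative[symmetric]
      by (rule derivative_eq_intros der[OF that] refl | simp)+
  qed (use R in simp)
  then have "((\<lambda>t. m / 2 * (T t ^ 6 * (2 * \<rho> t / m))) has_integral m / 2 * (2 / 7)) {-R..R}"
    by (intro has_integral_mult_right) (simp add: ends)
  moreover have "m / 2 * (T t ^ 6 * (2 * \<rho> t / m)) = \<rho> t * T t ^ 6" for t
    using m by simp
  ultimately have "integral {-R..R} (\<lambda>t. \<rho> t * T t ^ 6) = m / 7"
    by (simp add: integral_unique)
  with der ends show ?thesis by (rule that)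
qed

text \<open>
  Integration by parts moves the derivative from \<open>T\<close> to \<open>v\<^sup>1\<^sup>6\<^sup>/\<^sup>9\<close>; the boundary terms vanish with
  \<open>v\<close>, and \<open>young_transport\<close> estimates the integrand.
\<close>

lemma transport_by_parts:
  fixes R :: real
  assumes R: "0 < R"
    and v: "\<And>t. t \<in> {-R..R} \<Longrightarrow> (v has_real_derivative v' t) (at t within {-R..R})" "continuous_on {-R..R} v'"
    and v0: "\<And>t. 0 \<le> v t" and bd: "v (-R) = 0" "v R = 0"
    and T: "\<And>t. t \<in> {-R..R} \<Longrightarrow> (T has_real_derivative \<tau> t) (at t within {-R..R})" "continuous_on {-R..R} \<tau>"
    and f: "continuous_on {-R..R} f" "\<And>t. v t powr (8/3) \<le> f t"
    and s: "0 < s" and l: "0 < l"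
  shows "integral {-R..R} (\<lambda>t. v t powr (16/9) * \<tau> t) \<le>
     integral {-R..R} (\<lambda>t. 16/9 * (s / 2 * (v' t)\<^sup>2 + l / (3 * s) * v t + 1 / (6 * s * l\<^sup>2) * (f t * T t ^ 6)))"
proof -
  have cv: "continuous_on {-R..R} v" and cT: "continuous_on {-R..R} T"
    using DERIV_continuous_on[OF v(1)] DERIV_continuous_on[OF T(1)] by blast+
  have cp: "continuous_on {-R..R} (\<lambda>t. v t powr a)" if "0 < a" for a
    by (intro continuous_on_powr' continuous_intros cv) (use v0 that in auto)
  have dw: "((\<lambda>t. v t powr (16/9)) has_real_derivative 16/9 * v t powr (7/9) * v' t) (at t within {-R..R})"
    if "t \<in> {-R..R}" for t
  proof -
    have "((\<lambda>y. y powr (16/9)) has_real_derivative 16/9 * v t powr (16/9 - 1)) (at (v t) within v ` {-R..R})"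
      by (rule has_field_derivative_subset[OF powr_has_derivative_nonneg]) (use v0 in auto)
    from DERIV_image_chain[OF this v(1)[OF that]] show ?thesis by (simp add: comp_def)
  qed
  have "((\<lambda>t. 16/9 * v t powr (7/9) * v' t * T t + v t powr (16/9) * \<tau> t) has_integral
     (v R powr (16/9) * T R - v (-R) powr (16/9) * T (-R))) {-R..R}"
  proof (rule fundamental_theorem_of_calculus)
    show "((\<lambda>t. v t powr (16/9) * T t) has_vector_derivative
        16/9 * v t powr (7/9) * v' t * T t + v t powr (16/9) * \<tau> t) (at t within {-R..R})"
      if "t \<in> {-R..R}" for t
      unfolding has_real_derivative_iff_has_vector_derivative[symmetric]
      using DERIV_mult'[OF dw[OF that] T(1)[OF that]] by (simp add: algebra_simps)
  qed (use R in simp)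
  then have "((\<lambda>t. 16/9 * v t powr (7/9) * v' t * T t + v t powr (16/9) * \<tau> t) has_integral 0) {-R..R}"
    by (simp add: bd)
  moreover have i: "(\<lambda>t. 16/9 * v t powr (7/9) * v' t * T t) integrable_on {-R..R}"
    "(\<lambda>t. v t powr (16/9) * \<tau> t) integrable_on {-R..R}"
    by (intro integrable_continuous_real continuous_intros cp v T cT; simp)+
  ultimately have "integral {-R..R} (\<lambda>t. v t powr (16/9) * \<tau> t) =
      integral {-R..R} (\<lambda>t. - (16/9 * v t powr (7/9) * v' t * T t))"
    using Henstock_Kurzweil_Integration.integral_add[OF i] by (simp add: integral_unique)
  also have "\<dots> \<le> integral {-R..R} (\<lambda>t. 16/9 * (s / 2 * (v' t)\<^sup>2 + l / (3 * s) * v t + 1 / (6 * s * l\<^sup>2) * (f t * T t ^ 6)))"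
  proof (rule integral_le)
    show "(\<lambda>t. - (16/9 * v t powr (7/9) * v' t * T t)) integrable_on {-R..R}"
      using i(1) by (rule integrable_neg)
    show "(\<lambda>t. 16/9 * (s / 2 * (v' t)\<^sup>2 + l / (3 * s) * v t + 1 / (6 * s * l\<^sup>2) * (f t * T t ^ 6))) integrable_on {-R..R}"
      by (intro integrable_continuous_real continuous_intros v cv cT f)
    fix t
    have "- (v t powr (7/9) * v' t * T t) \<le> s / 2 * (v' t)\<^sup>2 + l / (3 * s) * v t + 1 / (6 * s * l\<^sup>2) * (v t powr (8/3) * T t ^ 6)"
      using young_transport[OF v0[of t] s l, of "v' t" "T t"] by linarith
    also have "\<dots> \<le> s / 2 * (v' t)\<^sup>2 + l / (3 * s) * v t + 1 / (6 * s * l\<^sup>2) * (f t * T t ^ 6)"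
      using f(2)[of t] s by (intro add_left_mono mult_left_mono mult_right_mono) auto
    finally have "16/9 * (- (v t powr (7/9) * v' t * T t)) \<le>
       16/9 * (s / 2 * (v' t)\<^sup>2 + l / (3 * s) * v t + 1 / (6 * s * l\<^sup>2) * (f t * T t ^ 6))"
      by (rule mult_left_mono) simp
    then show "- (16/9 * v t powr (7/9) * v' t * T t) \<le>
       16/9 * (s / 2 * (v' t)\<^sup>2 + l / (3 * s) * v t + 1 / (6 * s * l\<^sup>2) * (f t * T t ^ 6))"
      by (simp only: mult_minus_right mult.assoc)
  qed
  finally show ?thesis .
qed

text \<open>
  The transport in the variable \<open>t\<close> of the marginal \<open>\<rho>\<close> of \<open>f\<close>, where \<open>q\<close> collects the variables that
  have been integrated out. The bound by parts holds for every fixed \<open>q\<close>; after integration over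
  \<open>q\<close> the density \<open>f\<close> becomes \<open>\<rho>\<close>, and the sixth moment produces the term \<open>m/7\<close>.
\<close>

lemma transport_axis:
  fixes R :: real and a b :: "'q::euclidean_space" and v v' f :: "real \<Rightarrow> 'q \<Rightarrow> real"
  defines "S \<equiv> {-R..R}" and "Q \<equiv> cbox a b"
  assumes R: "0 < R"
    and c: "continuous_on (S \<times> Q) (\<lambda>(t, q). v t q)" "continuous_on (S \<times> Q) (\<lambda>(t, q). v' t q)"
      "continuous_on (S \<times> Q) (\<lambda>(t, q). f t q)"
    and v: "\<And>t q. t \<in> S \<Longrightarrow> ((\<lambda>t. v t q) has_real_derivative v' t q) (at t within S)"
    and v0: "\<And>t q. 0 \<le> v t q" and bd: "\<And>q. v (-R) q = 0" "\<And>q. v R q = 0"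
    and f: "\<And>t q. v t q powr (8/3) \<le> f t q"
    and \<rho>: "\<And>t. \<rho> t = integral Q (f t)" and m: "m = integral S \<rho>" "m \<noteq> 0"
    and s: "0 < s" and l: "0 < l"
  shows "integral S (\<lambda>t. integral Q (\<lambda>q. v t q powr (16/9) * (2 * \<rho> t / m))) \<le>
     16/9 * (integral S (\<lambda>t. integral Q (\<lambda>q. s / 2 * (v' t q)\<^sup>2 + l / (3 * s) * v t q)) + 1 / (6 * s * l\<^sup>2) * (m / 7))"
proof -
  have S: "S = cbox (-R) R" by (simp add: S_def)
  have SQ: "S \<times> Q = cbox (-R, a) (R, b)" by (simp add: S Q_def cbox_Pair_eq)
  have c\<rho>: "continuous_on S \<rho>"
    using integral_continuous_on_param[OF c(3)[unfolded Q_def]] by (simp add: \<rho>[abs_def] Q_def)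
  obtain T where T: "\<And>t. t \<in> S \<Longrightarrow> (T has_real_derivative 2 * \<rho> t / m) (at t within S)"
      and T6: "integral S (\<lambda>t. \<rho> t * T t ^ 6) = m / 7"
    using transport_line[OF R c\<rho>[unfolded S_def] m(1)[unfolded S_def] m(2)] unfolding S_def by metis
  have cT: "continuous_on S T" using T by (rule DERIV_continuous_on)
  have c\<rho>m: "continuous_on S (\<lambda>t. 2 * \<rho> t / m)"
    using m(2) by (intro continuous_intros c\<rho>) auto
  have c1: "continuous_on (S \<times> Q) (\<lambda>(t, q). h t)" if "continuous_on S h" for h :: "real \<Rightarrow> real"
    unfolding split_beta' by (rule continuous_on_compose2[OF that]) (auto intro!: continuous_intros)
  have row: "continuous_on S (\<lambda>t. h t q)" if "continuous_on (S \<times> Q) (\<lambda>(t, q). h t q)" "q \<in> Q" for h :: "real \<Rightarrow> 'q \<Rightarrow> real" and q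
  proof -
    have "continuous_on S (\<lambda>t. (\<lambda>(t, q). h t q) (t, q))"
      by (rule continuous_on_compose2[OF that(1)]) (use that(2) in \<open>auto intro!: continuous_intros\<close>)
    then show ?thesis by simp
  qed
  have col: "continuous_on Q (h t)" if "continuous_on (S \<times> Q) (\<lambda>(t, q). h t q)" "t \<in> S" for h :: "real \<Rightarrow> 'q \<Rightarrow> real" and t
  proof -
    have "continuous_on Q (\<lambda>q. (\<lambda>(t, q). h t q) (t, q))"
      by (rule continuous_on_compose2[OF that(1)]) (use that(2) in \<open>auto intro!: continuous_intros\<close>)
    then show ?thesis by simp
  qed
  have swap: "integral S (\<lambda>t. integral Q (h t)) = integral Q (\<lambda>q. integral S (\<lambda>t. h t q))"
    if "continuous_on (S \<times> Q) (\<lambda>(t, q). h t q)" for h :: "real \<Rightarrow> 'q \<Rightarrow> real"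
    using integral_swap_continuous[of "-R" a R b h] that by (simp add: SQ[symmetric] S Q_def)
  have inner: "continuous_on Q (\<lambda>q. integral S (\<lambda>t. h t q))"
    if "continuous_on (S \<times> Q) (\<lambda>(t, q). h t q)" for h :: "real \<Rightarrow> 'q \<Rightarrow> real"
  proof -
    have "continuous_on (Q \<times> S) (\<lambda>p. (\<lambda>(t, q). h t q) (snd p, fst p))"
      by (rule continuous_on_compose2[OF that]) (auto intro!: continuous_intros)
    then have "continuous_on (Q \<times> S) (\<lambda>(q, t). h t q)" by (simp add: split_beta')
    then show ?thesis unfolding S by (rule integral_continuous_on_param)
  qed
  have inner': "continuous_on S (\<lambda>t. integral Q (h t))"
    if "continuous_on (S \<times> Q) (\<lambda>(t, q). h t q)" for h :: "real \<Rightarrow> 'q \<Rightarrow> real"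
    using that unfolding Q_def by (rule integral_continuous_on_param)
  define w where "w t q = v t q powr (16/9) * (2 * \<rho> t / m)" for t q
  define A where "A t q = s / 2 * (v' t q)\<^sup>2 + l / (3 * s) * v t q" for t q
  define B where "B t q = 16/9 * (s / 2 * (v' t q)\<^sup>2 + l / (3 * s) * v t q + 1 / (6 * s * l\<^sup>2) * (f t q * T t ^ 6))" for t q
  have cw: "continuous_on (S \<times> Q) (\<lambda>(t, q). w t q)"
    unfolding w_def split_beta'
    by (intro continuous_on_mult continuous_on_powr' continuous_intros c[unfolded split_beta'] c1[OF c\<rho>m, unfolded split_beta'])
       (use v0 in auto)
  have cA: "continuous_on (S \<times> Q) (\<lambda>(t, q). A t q)"
    unfolding A_def split_beta' by (intro continuous_intros c[unfolded split_beta'])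
  have cfT: "continuous_on (S \<times> Q) (\<lambda>(t, q). f t q * T t ^ 6)"
    unfolding split_beta' by (intro continuous_intros c[unfolded split_beta'] c1[OF cT, unfolded split_beta'])
  have cB: "continuous_on (S \<times> Q) (\<lambda>(t, q). B t q)"
    unfolding B_def split_beta' by (intro continuous_intros c[unfolded split_beta'] c1[OF cT, unfolded split_beta'])
  have "integral S (\<lambda>t. integral Q (w t)) = integral Q (\<lambda>q. integral S (\<lambda>t. w t q))"
    by (rule swap[OF cw])
  also have "\<dots> \<le> integral Q (\<lambda>q. integral S (\<lambda>t. B t q))"
  proof (rule integral_le)
    show "(\<lambda>q. integral S (\<lambda>t. w t q)) integrable_on Q" "(\<lambda>q. integral S (\<lambda>t. B t q)) integrable_on Q"
      unfolding Q_def by (intro integrable_continuous inner[OF cw, unfolded Q_def] inner[OF cB, unfolded Q_def])+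
    fix q assume q: "q \<in> Q"
    show "integral S (\<lambda>t. w t q) \<le> integral S (\<lambda>t. B t q)"
      unfolding w_def B_def S_def
      by (rule transport_by_parts[OF R])
         (use v v0 bd T f s l row[OF c(2) q] row[OF c(3) q] c\<rho>m in \<open>auto simp: S_def\<close>)
  qed
  also have "\<dots> = integral S (\<lambda>t. integral Q (B t))" by (rule swap[OF cB, symmetric])
  also have "\<dots> = integral S (\<lambda>t. 16/9 * (integral Q (A t) + 1 / (6 * s * l\<^sup>2) * (\<rho> t * T t ^ 6)))"
  proof (rule integral_cong)
    fix t assume t: "t \<in> S"
    have i: "A t integrable_on Q" "f t integrable_on Q"
      unfolding Q_def by (intro integrable_continuous col[OF cA t, unfolded Q_def] col[OF c(3) t, unfolded Q_def])+
    have "integral Q (B t) = integral Q (\<lambda>q. 16/9 * (A t q + (1 / (6 * s * l\<^sup>2) * T t ^ 6) * f t q))"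
      by (intro integral_cong) (simp add: B_def A_def mult_ac)
    also have "\<dots> = 16/9 * (integral Q (A t) + (1 / (6 * s * l\<^sup>2) * T t ^ 6) * integral Q (f t))"
      using i by (simp only: integral_mult_right Henstock_Kurzweil_Integration.integral_add integrable_on_mult_right)
    finally show "integral Q (B t) = 16/9 * (integral Q (A t) + 1 / (6 * s * l\<^sup>2) * (\<rho> t * T t ^ 6))"
      by (simp add: \<rho> mult_ac)
  qed
  also have "\<dots> = 16/9 * (integral S (\<lambda>t. integral Q (A t)) + 1 / (6 * s * l\<^sup>2) * integral S (\<lambda>t. \<rho> t * T t ^ 6))"
  proof -
    have "(\<lambda>t. integral Q (A t)) integrable_on S" "(\<lambda>t. \<rho> t * T t ^ 6) integrable_on S"
      unfolding S_def by (intro integrable_continuous_real continuous_intros inner'[OF cA, unfolded S_def] c\<rho>[unfolded S_def] cT[unfolded S_def])+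
    then show ?thesis
      by (simp only: integral_mult_right Henstock_Kurzweil_Integration.integral_add integrable_on_mult_right)
  qed
  finally show ?thesis unfolding T6 w_def A_def .
qed

section \<open>The Knothe map on a cube\<close>

lemma continuous_slice:
  fixes h :: "real \<Rightarrow> real \<Rightarrow> real \<Rightarrow> real"
  assumes h: "continuous_on UNIV (\<lambda>(x, y, z). h x y z)"
    and "continuous_on A a" "continuous_on A b" "continuous_on A c"
  shows "continuous_on A (\<lambda>q. h (a q) (b q) (c q))"
proof -
  have "continuous_on A (\<lambda>q. (\<lambda>(x, y, z). h x y z) (a q, b q, c q))"
    by (rule continuous_on_compose2[OF h]) (auto intro!: continuous_intros assms)
  then show ?thesis by simp
qed

lemma continuous_integral_slice:
  fixes h :: "real \<Rightarrow> real \<Rightarrow> real \<Rightarrow> real"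
  assumes h: "continuous_on UNIV (\<lambda>(x, y, z). h x y z)"
  shows "continuous_on UNIV (\<lambda>(x, y). integral {l..u} (h x y))"
proof -
  have "continuous_on (UNIV \<times> cbox l u) (\<lambda>(p, t). h (fst p) (snd p) t)"
    unfolding split_beta' by (intro continuous_slice[OF h] continuous_intros)
  from integral_continuous_on_param[OF this] show ?thesis by (simp add: split_beta')
qed

lemma continuous_integral_slice2:
  fixes h :: "real \<Rightarrow> real \<Rightarrow> real"
  assumes h: "continuous_on UNIV (\<lambda>(x, y). h x y)"
  shows "continuous_on UNIV (\<lambda>x. integral {l..u} (h x))"
  using integral_continuous_on_param[OF continuous_on_subset[OF h], of UNIV l u] by simp

lemma continuous_slice2:
  fixes h :: "real \<Rightarrow> real \<Rightarrow> real"
  assumes h: "continuous_on UNIV (\<lambda>(x, y). h x y)"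
    and "continuous_on A a" "continuous_on A b"
  shows "continuous_on A (\<lambda>q. h (a q) (b q))"
proof -
  have "continuous_on A (\<lambda>q. (\<lambda>(x, y). h x y) (a q, b q))"
    by (rule continuous_on_compose2[OF h]) (auto intro!: continuous_intros assms)
  then show ?thesis by simp
qed

definition cube_integral :: "real \<Rightarrow> (real \<Rightarrow> real \<Rightarrow> real \<Rightarrow> real) \<Rightarrow> real" where
  "cube_integral R h = integral {-R..R} (\<lambda>x. integral {-R..R} (\<lambda>y. integral {-R..R} (\<lambda>z. h x y z)))"

lemma cube_integral_integrable:
  fixes h :: "real \<Rightarrow> real \<Rightarrow> real \<Rightarrow> real"
  assumes "continuous_on UNIV (\<lambda>(x, y, z). h x y z)"
  shows "h x y integrable_on {-R..R}"
    and "(\<lambda>y. integral {-R..R} (h x y)) integrable_on {-R..R}"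
    and "(\<lambda>x. integral {-R..R} (\<lambda>y. integral {-R..R} (h x y))) integrable_on {-R..R}"
proof -
  note c2 = continuous_integral_slice[OF assms, of "-R" R]
  show "h x y integrable_on {-R..R}"
    by (intro integrable_continuous_real continuous_slice[OF assms] continuous_intros)
  show "(\<lambda>y. integral {-R..R} (h x y)) integrable_on {-R..R}"
    by (intro integrable_continuous_real continuous_slice2[OF c2] continuous_intros)
  show "(\<lambda>x. integral {-R..R} (\<lambda>y. integral {-R..R} (h x y))) integrable_on {-R..R}"
    by (intro integrable_continuous_real continuous_on_subset[OF continuous_integral_slice2[OF c2]]) auto
qed

lemma cube_integral_add:
  assumes "continuous_on UNIV (\<lambda>(x, y, z). h x y z)" "continuous_on UNIV (\<lambda>(x, y, z). k x y z)"
  shows "cube_integral R (\<lambda>x y z. h x y z + k x y z) = cube_integral R h + cube_integral R k"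
  unfolding cube_integral_def
  by (simp add: Henstock_Kurzweil_Integration.integral_add cube_integral_integrable[OF assms(1)] cube_integral_integrable[OF assms(2)])

lemma continuous3_add:
  fixes h k :: "real \<Rightarrow> real \<Rightarrow> real \<Rightarrow> real"
  assumes "continuous_on UNIV (\<lambda>(x, y, z). h x y z)" "continuous_on UNIV (\<lambda>(x, y, z). k x y z)"
  shows "continuous_on UNIV (\<lambda>(x, y, z). h x y z + k x y z)"
  using continuous_on_add[OF assms] by (simp add: split_beta')

lemma cube_integral_cmult: "cube_integral R (\<lambda>x y z. c * h x y z) = c * cube_integral R h"
  unfolding cube_integral_def by simp

lemma cube_integral_mono:
  assumes "continuous_on UNIV (\<lambda>(x, y, z). h x y z)" "continuous_on UNIV (\<lambda>(x, y, z). k x y z)"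
    and "\<And>x y z. h x y z \<le> k x y z"
  shows "cube_integral R h \<le> cube_integral R k"
  unfolding cube_integral_def
  by (intro integral_le cube_integral_integrable[OF assms(1)] cube_integral_integrable[OF assms(2)] assms(3))

lemma cube_integral_const: "0 < R \<Longrightarrow> cube_integral R (\<lambda>x y z. c) = c * (2 * R) ^ 3"
  unfolding cube_integral_def by (simp add: power3_eq_cube)

text \<open>
  The Knothe map \<open>(T\<^sub>1(x), T\<^sub>2(x,y), T\<^sub>3(x,y,z))\<close> pushes \<open>f\<close>, normalised, to the uniform density on
  \<open>[-1,1]\<^sup>3\<close>; its coordinates are the monotone transports of the successive conditional densities.
  Only the diagonal derivatives \<open>\<tau>\<^sub>i\<close> matter. Their product is \<open>8 f/I\<close>, so the inequality of arithmetic
  and geometric means bounds their sum from below by \<open>6 (f/I)\<^sup>1\<^sup>/\<^sup>3\<close>. Multiplying by \<open>v\<^sup>1\<^sup>6\<^sup>/\<^sup>9\<close> and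
  applying \<open>transport_axis\<close> in each variable bounds \<open>\<integral> v\<^sup>8\<^sup>/\<^sup>3\<close> by the derivatives of \<open>v\<close>.
  Adding \<open>\<delta>\<close> to the density keeps all marginals positive and continuous on the cube.
\<close>

lemma knothe_cube_positive:
  fixes v v1 v2 v3 :: "real \<Rightarrow> real \<Rightarrow> real \<Rightarrow> real"
  assumes R: "0 < R"
    and c: "continuous_on UNIV (\<lambda>(x, y, z). v x y z)" "continuous_on UNIV (\<lambda>(x, y, z). v1 x y z)"
       "continuous_on UNIV (\<lambda>(x, y, z). v2 x y z)" "continuous_on UNIV (\<lambda>(x, y, z). v3 x y z)"
    and v0: "\<And>x y z. 0 \<le> v x y z"
    and bd: "\<And>x y z. R \<le> \<bar>x\<bar> \<or> R \<le> \<bar>y\<bar> \<or> R \<le> \<bar>z\<bar> \<Longrightarrow> v x y z = 0"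
    and d1: "\<And>x y z. ((\<lambda>x. v x y z) has_real_derivative v1 x y z) (at x)"
    and d2: "\<And>x y z. ((\<lambda>y. v x y z) has_real_derivative v2 x y z) (at y)"
    and d3: "\<And>x y z. ((\<lambda>z. v x y z) has_real_derivative v3 x y z) (at z)"
    and s: "0 < s" and l: "0 < l" and \<delta>: "0 < \<delta>"
  defines "f \<equiv> \<lambda>x y z. v x y z powr (8/3) + \<delta>"
  shows "27/8 * cube_integral R (\<lambda>x y z. v x y z powr (8/3)) * cube_integral R f powr (-1/3) \<le>
     s / 2 * cube_integral R (\<lambda>x y z. (v1 x y z)\<^sup>2 + (v2 x y z)\<^sup>2 + (v3 x y z)\<^sup>2)
      + 1 / s * (l * cube_integral R v + cube_integral R f / (14 * l\<^sup>2))"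
proof -
  let ?S = "{-R..R}"
  define F2 where "F2 x y = integral ?S (f x y)" for x y
  define F1 where "F1 x = integral ?S (F2 x)" for x
  define I where "I = integral ?S F1"
  have I: "I = cube_integral R f" by (simp add: I_def F1_def[abs_def] F2_def[abs_def] cube_integral_def)
  have cp: "continuous_on UNIV (\<lambda>(x, y, z). v x y z powr a)" if "0 < a" for a
    unfolding split_beta' by (intro continuous_on_powr' continuous_intros c(1)[unfolded split_beta']) (use v0 that in auto)
  have cf: "continuous_on UNIV (\<lambda>(x, y, z). f x y z)"
    unfolding f_def split_beta' by (intro continuous_intros cp[unfolded split_beta']) auto
  have cF2: "continuous_on UNIV (\<lambda>(x, y). F2 x y)"
    unfolding F2_def by (rule continuous_integral_slice[OF cf])
  have cF1: "continuous_on UNIV F1"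
    unfolding F1_def[abs_def] by (rule continuous_integral_slice2[OF cF2])
  have f_pos: "\<delta> \<le> f x y z" for x y z by (simp add: f_def)
  have F2_ge: "\<delta> * (2 * R) \<le> F2 x y" for x y
  proof -
    have "integral ?S (\<lambda>z. \<delta>) \<le> F2 x y"
      unfolding F2_def by (intro integral_le cube_integral_integrable[OF cf] f_pos) auto
    then show ?thesis using R by (simp add: mult_ac)
  qed
  have F1_ge: "\<delta> * (2 * R) * (2 * R) \<le> F1 x" for x
  proof -
    have "F2 x integrable_on ?S"
      unfolding F2_def[abs_def] by (rule cube_integral_integrable[OF cf])
    then have "integral ?S (\<lambda>y. \<delta> * (2 * R)) \<le> F1 x"
      unfolding F1_def by (intro integral_le F2_ge) auto
    then show ?thesis using R by (simp add: mult_ac)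
  qed
  have I_ge: "\<delta> * (2 * R) * (2 * R) * (2 * R) \<le> I"
  proof -
    have "integral ?S (\<lambda>x. \<delta> * (2 * R) * (2 * R)) \<le> I"
      unfolding I_def by (intro integral_le F1_ge integrable_continuous_real continuous_on_subset[OF cF1]) auto
    then show ?thesis using R by (simp add: mult_ac)
  qed
  have F2_pos: "0 < F2 x y" for x y using R \<delta> by (intro less_le_trans[OF _ F2_ge]) simp
  have F1_pos: "0 < F1 x" for x using R \<delta> by (intro less_le_trans[OF _ F1_ge]) simp
  have I_pos: "0 < I" using R \<delta> by (intro less_le_trans[OF _ I_ge]) simp
  have fv: "v x y z powr (8/3) \<le> f x y z" for x y z using \<delta> by (simp add: f_def)
  define w where "w x y z = v x y z powr (16/9)" for x y z
  define \<tau>1 where "\<tau>1 x y z = 2 * F1 x / I" for x y z :: real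
  define \<tau>2 where "\<tau>2 x y z = 2 * F2 x y / F1 x" for x y z :: real
  define \<tau>3 where "\<tau>3 x y z = 2 * f x y z / F2 x y" for x y z :: real
  define A1 where "A1 x y z = s / 2 * (v1 x y z)\<^sup>2 + l / (3 * s) * v x y z" for x y z
  define A2 where "A2 x y z = s / 2 * (v2 x y z)\<^sup>2 + l / (3 * s) * v x y z" for x y z
  define A3 where "A3 x y z = s / 2 * (v3 x y z)\<^sup>2 + l / (3 * s) * v x y z" for x y z
  define K where "K = 1 / (6 * s * l\<^sup>2)"
  have cw: "continuous_on UNIV (\<lambda>(x, y, z). w x y z)" unfolding w_def by (rule cp) simp
  have cA1: "continuous_on UNIV (\<lambda>(x, y, z). A1 x y z)"
    and cA2: "continuous_on UNIV (\<lambda>(x, y, z). A2 x y z)"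
    and cA3: "continuous_on UNIV (\<lambda>(x, y, z). A3 x y z)"
    unfolding A1_def A2_def A3_def split_beta' by (intro continuous_intros c[unfolded split_beta'])+
  have cw1: "continuous_on UNIV (\<lambda>(x, y, z). w x y z * \<tau>1 x y z)"
    unfolding \<tau>1_def split_beta' using I_pos
    by (intro continuous_intros cw[unfolded split_beta'] continuous_on_compose2[OF cF1]) auto
  have cw2: "continuous_on UNIV (\<lambda>(x, y, z). w x y z * \<tau>2 x y z)"
    unfolding \<tau>2_def split_beta' using F1_pos
    by (intro continuous_intros cw[unfolded split_beta'] continuous_on_compose2[OF cF1] continuous_slice2[OF cF2])
       (auto simp: less_imp_neq[symmetric])
  have cw3: "continuous_on UNIV (\<lambda>(x, y, z). w x y z * \<tau>3 x y z)"
    unfolding \<tau>3_def split_beta' using F2_pos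
    by (intro continuous_intros cw[unfolded split_beta'] cf[unfolded split_beta'] continuous_slice2[OF cF2])
       (auto simp: less_imp_neq[symmetric])

  have axis1: "cube_integral R (\<lambda>x y z. w x y z * \<tau>1 x y z) \<le> 16/9 * (cube_integral R A1 + K * (I / 7))"
  proof -
    let ?Q = "cbox (-R, -R) (R, R)"
    have fub: "integral ?Q (\<lambda>q. h (fst q) (snd q)) = integral ?S (\<lambda>y. integral ?S (h y))"
      if "continuous_on UNIV (\<lambda>(y, z). h y z)" for h :: "real \<Rightarrow> real \<Rightarrow> real"
      using integral_prod_continuous[OF continuous_on_subset[OF that], of "-R" "-R" R R]
      by (simp add: split_beta')
    have sl: "continuous_on UNIV (\<lambda>(y, z). h x y z)" if "continuous_on UNIV (\<lambda>(x, y, z). h x y z)"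
      for h :: "real \<Rightarrow> real \<Rightarrow> real \<Rightarrow> real" and x
      unfolding split_beta' by (intro continuous_slice[OF that] continuous_intros)
    have "integral ?S (\<lambda>t. integral ?Q (\<lambda>q. v t (fst q) (snd q) powr (16/9) * (2 * F1 t / I))) \<le>
       16/9 * (integral ?S (\<lambda>t. integral ?Q (\<lambda>q. s / 2 * (v1 t (fst q) (snd q))\<^sup>2 + l / (3 * s) * v t (fst q) (snd q)))
         + 1 / (6 * s * l\<^sup>2) * (I / 7))"
    proof (rule transport_axis[OF R, where f = "\<lambda>t q. f t (fst q) (snd q)"])
      show "F1 t = integral ?Q (\<lambda>q. f t (fst q) (snd q))" for t
        unfolding F1_def F2_def by (rule fub[OF sl[OF cf], symmetric])
      show "((\<lambda>t. v t (fst q) (snd q)) has_real_derivative v1 t (fst q) (snd q)) (at t within ?S)" for t q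
        using d1 by (rule has_field_derivative_at_within)
      show "continuous_on (?S \<times> ?Q) (\<lambda>(t, q). v t (fst q) (snd q))"
        "continuous_on (?S \<times> ?Q) (\<lambda>(t, q). v1 t (fst q) (snd q))"
        "continuous_on (?S \<times> ?Q) (\<lambda>(t, q). f t (fst q) (snd q))"
        unfolding split_beta'
        by (intro continuous_slice[OF c(1)] continuous_slice[OF c(2)] continuous_slice[OF cf] continuous_intros)+
    qed (use v0 bd R fv I_pos s l in \<open>auto simp: I_def\<close>)
    moreover have "integral ?Q (\<lambda>q. v t (fst q) (snd q) powr (16/9) * (2 * F1 t / I)) =
        integral ?S (\<lambda>y. integral ?S (\<lambda>z. w t y z * \<tau>1 t y z))" for t
      using fub[OF sl[OF cw1, of t]] by (simp only: w_def \<tau>1_def)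
    moreover have "integral ?Q (\<lambda>q. s / 2 * (v1 t (fst q) (snd q))\<^sup>2 + l / (3 * s) * v t (fst q) (snd q)) =
        integral ?S (\<lambda>y. integral ?S (\<lambda>z. A1 t y z))" for t
      using fub[OF sl[OF cA1, of t]] by (simp only: A1_def)
    ultimately show ?thesis
      by (simp only: cube_integral_def K_def)
  qed
  have axis2: "cube_integral R (\<lambda>x y z. w x y z * \<tau>2 x y z) \<le> 16/9 * (cube_integral R A2 + K * (I / 7))"
  proof -
    have x: "integral ?S (\<lambda>y. integral ?S (\<lambda>z. w x y z * \<tau>2 x y z)) \<le>
        16/9 * (integral ?S (\<lambda>y. integral ?S (\<lambda>z. A2 x y z)) + K * (F1 x / 7))" for x
    proof -
      have "integral ?S (\<lambda>y. integral (cbox (-R) R) (\<lambda>z. v x y z powr (16/9) * (2 * F2 x y / F1 x))) \<le>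
         16/9 * (integral ?S (\<lambda>y. integral (cbox (-R) R) (\<lambda>z. s / 2 * (v2 x y z)\<^sup>2 + l / (3 * s) * v x y z))
           + 1 / (6 * s * l\<^sup>2) * (F1 x / 7))"
      proof (rule transport_axis[OF R, where f = "\<lambda>y z. f x y z"])
        show "((\<lambda>y. v x y z) has_real_derivative v2 x y z) (at y within ?S)" for y z
          using d2 by (rule has_field_derivative_at_within)
        show "continuous_on (?S \<times> cbox (-R) R) (\<lambda>(y, z). v x y z)"
          "continuous_on (?S \<times> cbox (-R) R) (\<lambda>(y, z). v2 x y z)"
          "continuous_on (?S \<times> cbox (-R) R) (\<lambda>(y, z). f x y z)"
          unfolding split_beta'
          by (intro continuous_slice[OF c(1)] continuous_slice[OF c(3)] continuous_slice[OF cf] continuous_intros)+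
      qed (use v0 bd R fv F1_pos[of x] s l in \<open>auto simp: F1_def F2_def[abs_def]\<close>)
      then show ?thesis by (simp only: K_def w_def \<tau>2_def A2_def box_real)
    qed
    have iF1: "F1 integrable_on ?S"
      by (intro integrable_continuous_real continuous_on_subset[OF cF1]) auto
    have "cube_integral R (\<lambda>x y z. w x y z * \<tau>2 x y z) \<le> integral ?S (\<lambda>x. 16/9 * (integral ?S (\<lambda>y. integral ?S (\<lambda>z. A2 x y z)) + K / 7 * F1 x))"
      unfolding cube_integral_def
      by (intro integral_le cube_integral_integrable[OF cw2] integrable_on_mult_right integrable_add cube_integral_integrable[OF cA2] iF1)
         (use x in simp)
    also have "\<dots> = 16/9 * (cube_integral R A2 + K / 7 * I)"
      unfolding cube_integral_def I_def
      by (simp only: integral_mult_right Henstock_Kurzweil_Integration.integral_add[OF cube_integral_integrable(3)[OF cA2] integrable_on_mult_right[OF iF1]])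
    finally show ?thesis by simp
  qed
  have axis3: "cube_integral R (\<lambda>x y z. w x y z * \<tau>3 x y z) \<le> 16/9 * (cube_integral R A3 + K * (I / 7))"
  proof -
    have x: "integral ?S (\<lambda>z. w x y z * \<tau>3 x y z) \<le>
        16/9 * (integral ?S (\<lambda>z. A3 x y z) + K * (F2 x y / 7))" for x y
    proof -
      \<comment> \<open>nothing has been integrated out on this axis; the unit interval is a dummy range for \<open>q\<close>\<close>
      have "integral ?S (\<lambda>z. integral (cbox 0 (1::real)) (\<lambda>q. v x y z powr (16/9) * (2 * f x y z / F2 x y))) \<le>
         16/9 * (integral ?S (\<lambda>z. integral (cbox 0 (1::real)) (\<lambda>q. s / 2 * (v3 x y z)\<^sup>2 + l / (3 * s) * v x y z))
           + 1 / (6 * s * l\<^sup>2) * (F2 x y / 7))"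
      proof (rule transport_axis[OF R, where f = "\<lambda>z q. f x y z"])
        show "((\<lambda>z. v x y z) has_real_derivative v3 x y z) (at z within ?S)" for z
          using d3 by (rule has_field_derivative_at_within)
        show "continuous_on (?S \<times> cbox 0 (1::real)) (\<lambda>(z, q). v x y z)"
          "continuous_on (?S \<times> cbox 0 (1::real)) (\<lambda>(z, q). v3 x y z)"
          "continuous_on (?S \<times> cbox 0 (1::real)) (\<lambda>(z, q). f x y z)"
          unfolding split_beta'
          by (intro continuous_slice[OF c(1)] continuous_slice[OF c(4)] continuous_slice[OF cf] continuous_intros)+
      qed (use v0 bd R fv F2_pos[of x y] s l in \<open>auto simp: F2_def\<close>)
      moreover have "integral (cbox 0 (1::real)) (\<lambda>q. k) = k" for k :: real by simp
      ultimately show ?thesis by (simp only: K_def w_def \<tau>3_def A3_def)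
    qed
    have iF2: "F2 x integrable_on ?S" for x
      unfolding F2_def[abs_def] by (rule cube_integral_integrable[OF cf])
    have iF1: "F1 integrable_on ?S"
      by (intro integrable_continuous_real continuous_on_subset[OF cF1]) auto
    have y: "integral ?S (\<lambda>y. integral ?S (\<lambda>z. w x y z * \<tau>3 x y z)) \<le>
        16/9 * (integral ?S (\<lambda>y. integral ?S (\<lambda>z. A3 x y z)) + K / 7 * F1 x)" for x
    proof -
      have "integral ?S (\<lambda>y. integral ?S (\<lambda>z. w x y z * \<tau>3 x y z)) \<le>
         integral ?S (\<lambda>y. 16/9 * (integral ?S (\<lambda>z. A3 x y z) + K / 7 * F2 x y))"
        by (intro integral_le cube_integral_integrable[OF cw3] integrable_on_mult_right integrable_add cube_integral_integrable[OF cA3] iF2)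
           (use x in simp)
      also have "\<dots> = 16/9 * (integral ?S (\<lambda>y. integral ?S (\<lambda>z. A3 x y z)) + K / 7 * F1 x)"
        unfolding F1_def
        by (simp only: integral_mult_right Henstock_Kurzweil_Integration.integral_add[OF cube_integral_integrable(2)[OF cA3] integrable_on_mult_right[OF iF2]])
      finally show ?thesis .
    qed
    have "cube_integral R (\<lambda>x y z. w x y z * \<tau>3 x y z) \<le> integral ?S (\<lambda>x. 16/9 * (integral ?S (\<lambda>y. integral ?S (\<lambda>z. A3 x y z)) + K / 7 * F1 x))"
      unfolding cube_integral_def
      by (intro integral_le cube_integral_integrable[OF cw3] integrable_on_mult_right integrable_add cube_integral_integrable[OF cA3] iF1)
         (use y in simp)
    also have "\<dots> = 16/9 * (cube_integral R A3 + K / 7 * I)"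
      unfolding cube_integral_def I_def
      by (simp only: integral_mult_right Henstock_Kurzweil_Integration.integral_add[OF cube_integral_integrable(3)[OF cA3] integrable_on_mult_right[OF iF1]])
    finally show ?thesis by simp
  qed
  have point: "6 * I powr (-1/3) * v x y z powr (8/3) \<le> w x y z * \<tau>1 x y z + w x y z * \<tau>2 x y z + w x y z * \<tau>3 x y z" for x y z
  proof -
    have prod: "\<tau>1 x y z * \<tau>2 x y z * \<tau>3 x y z = 8 * f x y z / I"
      unfolding \<tau>1_def \<tau>2_def \<tau>3_def using F1_pos[of x] F2_pos[of x y] I_pos by (simp add: field_simps)
    have "3 * (2 * (v x y z powr (8/9) * I powr (-1/3))) \<le> \<tau>1 x y z + \<tau>2 x y z + \<tau>3 x y z"
    proof (rule amgm3)
      show "0 \<le> \<tau>1 x y z" "0 \<le> \<tau>2 x y z" "0 \<le> \<tau>3 x y z"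
        using F1_pos[of x] F2_pos[of x y] I_pos f_pos[of x y z] \<delta>
        by (auto simp: \<tau>1_def \<tau>2_def \<tau>3_def intro!: divide_nonneg_pos)
      have "(2 * (v x y z powr (8/9) * I powr (-1/3))) ^ 3 = 8 * (v x y z powr (8/3) / I)"
      proof -
        have "(v x y z powr (8/9)) ^ 3 = v x y z powr (8/3)"
          using v0[of x y z] by (simp add: powr_nth_power)
        moreover have "(I powr (-1/3)) ^ 3 = I powr (-1)"
          using I_pos by (subst powr_nth_power) auto
        then have "(I powr (-1/3)) ^ 3 = 1 / I"
          using I_pos by (simp only: powr_minus_divide powr_one less_imp_le)
        ultimately show ?thesis by (simp only: power_mult_distrib) simp
      qed
      also have "\<dots> \<le> 8 * (f x y z / I)"
        using fv[of x y z] I_pos by (intro mult_left_mono divide_right_mono) auto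
      finally show "(2 * (v x y z powr (8/9) * I powr (-1/3))) ^ 3 \<le> \<tau>1 x y z * \<tau>2 x y z * \<tau>3 x y z"
        by (simp add: prod)
    qed simp
    then have "w x y z * (3 * (2 * (v x y z powr (8/9) * I powr (-1/3)))) \<le> w x y z * (\<tau>1 x y z + \<tau>2 x y z + \<tau>3 x y z)"
      by (rule mult_left_mono) (simp add: w_def)
    moreover have "w x y z * v x y z powr (8/9) = v x y z powr (8/3)"
      by (simp add: w_def powr_add[symmetric])
    moreover have "w x y z * (3 * (2 * (v x y z powr (8/9) * I powr (-1/3)))) =
        6 * I powr (-1/3) * (w x y z * v x y z powr (8/9))"
      by (simp only: mult_ac)
    ultimately show ?thesis by (simp only: distrib_left)
  qed
  have "6 * I powr (-1/3) * cube_integral R (\<lambda>x y z. v x y z powr (8/3)) = cube_integral R (\<lambda>x y z. 6 * I powr (-1/3) * v x y z powr (8/3))"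
    by (rule cube_integral_cmult[symmetric])
  also have "\<dots> \<le> cube_integral R (\<lambda>x y z. w x y z * \<tau>1 x y z + w x y z * \<tau>2 x y z + w x y z * \<tau>3 x y z)"
    by (rule cube_integral_mono[OF _ _ point])
       (unfold split_beta', (intro continuous_intros cp[unfolded split_beta'] cw1[unfolded split_beta']
         cw2[unfolded split_beta'] cw3[unfolded split_beta']; simp)+)
  also have "\<dots> = cube_integral R (\<lambda>x y z. w x y z * \<tau>1 x y z) + cube_integral R (\<lambda>x y z. w x y z * \<tau>2 x y z) + cube_integral R (\<lambda>x y z. w x y z * \<tau>3 x y z)"
    by (simp only: cube_integral_add[OF continuous3_add[OF cw1 cw2] cw3] cube_integral_add[OF cw1 cw2])
  also have "\<dots> \<le> 16/9 * (cube_integral R A1 + cube_integral R A2 + cube_integral R A3 + 3 * (K * (I / 7)))"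
  proof -
    have "x + y + z \<le> 16/9 * (a + b + c + 3 * k)"
      if "x \<le> 16/9 * (a + k)" "y \<le> 16/9 * (b + k)" "z \<le> 16/9 * (c + k)" for x y z a b c k :: real
      using add_mono[OF add_mono[OF that(1,2)] that(3)] by (simp add: field_simps)
    from this[OF axis1 axis2 axis3] show ?thesis .
  qed
  also have "cube_integral R A1 + cube_integral R A2 + cube_integral R A3 = s / 2 * cube_integral R (\<lambda>x y z. (v1 x y z)\<^sup>2 + (v2 x y z)\<^sup>2 + (v3 x y z)\<^sup>2) + l / s * cube_integral R v"
  proof -
    have "cube_integral R A1 + cube_integral R A2 + cube_integral R A3 = cube_integral R (\<lambda>x y z. A1 x y z + A2 x y z + A3 x y z)"
      by (simp only: cube_integral_add[OF continuous3_add[OF cA1 cA2] cA3] cube_integral_add[OF cA1 cA2])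
    also have "\<dots> = cube_integral R (\<lambda>x y z. s / 2 * ((v1 x y z)\<^sup>2 + (v2 x y z)\<^sup>2 + (v3 x y z)\<^sup>2) + l / s * v x y z)"
    proof -
      have "A1 x y z + A2 x y z + A3 x y z = s / 2 * ((v1 x y z)\<^sup>2 + (v2 x y z)\<^sup>2 + (v3 x y z)\<^sup>2) + l / s * v x y z" for x y z
        using s by (simp add: A1_def A2_def A3_def field_simps)
      then show ?thesis by (simp only:)
    qed
    also have "\<dots> = cube_integral R (\<lambda>x y z. s / 2 * ((v1 x y z)\<^sup>2 + (v2 x y z)\<^sup>2 + (v3 x y z)\<^sup>2)) + cube_integral R (\<lambda>x y z. l / s * v x y z)"
      by (rule cube_integral_add) (unfold split_beta', (intro continuous_intros c[unfolded split_beta'])+)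
    finally show ?thesis by (simp only: cube_integral_cmult)
  qed
  finally have "6 * I powr (-1/3) * cube_integral R (\<lambda>x y z. v x y z powr (8/3)) \<le> 16/9 * (s / 2 * cube_integral R (\<lambda>x y z. (v1 x y z)\<^sup>2 + (v2 x y z)\<^sup>2 + (v3 x y z)\<^sup>2)
     + l / s * cube_integral R v + 3 * (K * (I / 7)))" .
  moreover have "3 * (K * (I / 7)) = 1 / s * (I / (14 * l\<^sup>2))"
    using s l by (simp add: K_def field_simps)
  moreover have "27/8 * X * p \<le> a + 1 / s * (l * M + J)"
    if "6 * p * X \<le> 16/9 * (a + l / s * M + k)" "k = 1 / s * J" for X p a M k J :: real
  proof -
    have "9/16 * (6 * p * X) \<le> 9/16 * (16/9 * (a + l / s * M + k))"
      using that(1) by (rule mult_left_mono) simp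
    moreover have "9/16 * (6 * p * X) = 27/8 * X * p" by simp
    moreover have "9/16 * (16/9 * (a + l / s * M + k)) = a + 1 / s * (l * M + J)"
      unfolding that(2) by (simp add: distrib_left add_divide_distrib)
    ultimately show ?thesis by (simp only:)
  qed
  ultimately show ?thesis unfolding I by blast
qed

section \<open>A Gagliardo-Nirenberg inequality for functions with compact support\<close>

lemma knothe_cube:
  fixes v v1 v2 v3 :: "real \<Rightarrow> real \<Rightarrow> real \<Rightarrow> real"
  assumes R: "0 < R"
    and c: "continuous_on UNIV (\<lambda>(x, y, z). v x y z)" "continuous_on UNIV (\<lambda>(x, y, z). v1 x y z)"
       "continuous_on UNIV (\<lambda>(x, y, z). v2 x y z)" "continuous_on UNIV (\<lambda>(x, y, z). v3 x y z)"
    and v0: "\<And>x y z. 0 \<le> v x y z"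
    and bd: "\<And>x y z. R \<le> \<bar>x\<bar> \<or> R \<le> \<bar>y\<bar> \<or> R \<le> \<bar>z\<bar> \<Longrightarrow> v x y z = 0"
    and d1: "\<And>x y z. ((\<lambda>x. v x y z) has_real_derivative v1 x y z) (at x)"
    and d2: "\<And>x y z. ((\<lambda>y. v x y z) has_real_derivative v2 x y z) (at y)"
    and d3: "\<And>x y z. ((\<lambda>z. v x y z) has_real_derivative v3 x y z) (at z)"
    and s: "0 < s" and l: "0 < l"
  defines "I \<equiv> cube_integral R (\<lambda>x y z. v x y z powr (8/3))"
  shows "27/8 * I powr (2/3) \<le>
     s / 2 * cube_integral R (\<lambda>x y z. (v1 x y z)\<^sup>2 + (v2 x y z)\<^sup>2 + (v3 x y z)\<^sup>2)
      + 1 / s * (l * cube_integral R v + I / (14 * l\<^sup>2))"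
proof -
  define D where "D = cube_integral R (\<lambda>x y z. (v1 x y z)\<^sup>2 + (v2 x y z)\<^sup>2 + (v3 x y z)\<^sup>2)"
  define M where "M = cube_integral R v"
  have cp: "continuous_on UNIV (\<lambda>(x, y, z). v x y z powr (8/3))"
    unfolding split_beta' by (intro continuous_on_powr' continuous_intros c(1)[unfolded split_beta']) (use v0 in auto)
  have zero: "cube_integral R (\<lambda>x y z. 0) = 0" unfolding cube_integral_def by simp
  have I0: "0 \<le> I"
    using cube_integral_mono[OF _ cp, of "\<lambda>_ _ _. 0" R] by (simp add: zero I_def)
  have pos: "27/8 * I * (I + \<delta> * (2 * R) ^ 3) powr (-1/3) \<le> s / 2 * D + 1 / s * (l * M + (I + \<delta> * (2 * R) ^ 3) / (14 * l\<^sup>2))"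
    if "0 < \<delta>" for \<delta>
  proof -
    have "cube_integral R (\<lambda>x y z. v x y z powr (8/3) + \<delta>) = I + \<delta> * (2 * R) ^ 3"
      using cube_integral_add[OF cp, of "\<lambda>_ _ _. \<delta>" R] cube_integral_const[OF R, of \<delta>] unfolding I_def by simp
    with knothe_cube_positive[OF R c v0 bd d1 d2 d3 s l that] show ?thesis
      by (simp only: I_def D_def M_def)
  qed
  have lim: "((\<lambda>\<delta>. I + \<delta> * (2 * R) ^ 3) \<longlongrightarrow> I) (at_right 0)"
  proof -
    have "((\<lambda>\<delta>. I + \<delta> * (2 * R) ^ 3) \<longlongrightarrow> I + 0 * (2 * R) ^ 3) (at_right 0)"
      by (intro tendsto_intros)
    then show ?thesis by simp
  qed
  have "27/8 * I * I powr (-1/3) \<le> s / 2 * D + 1 / s * (l * M + I / (14 * l\<^sup>2))"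
  proof (cases "I = 0")
    case True
    have "continuous_on UNIV (\<lambda>(x, y, z). (v1 x y z)\<^sup>2 + (v2 x y z)\<^sup>2 + (v3 x y z)\<^sup>2)"
      unfolding split_beta' by (intro continuous_intros c[unfolded split_beta'])
    then have "0 \<le> D"
      using cube_integral_mono[of "\<lambda>_ _ _. 0" "\<lambda>x y z. (v1 x y z)\<^sup>2 + (v2 x y z)\<^sup>2 + (v3 x y z)\<^sup>2" R]
      by (simp add: zero D_def)
    moreover have "0 \<le> M"
      using cube_integral_mono[OF _ c(1), of "\<lambda>_ _ _. 0" R] by (simp add: zero M_def v0)
    ultimately show ?thesis using True s l by simp
  next
    case False
    show ?thesis
    proof (rule tendsto_le)
      show "((\<lambda>\<delta>. s / 2 * D + 1 / s * (l * M + (I + \<delta> * (2 * R) ^ 3) / (14 * l\<^sup>2))) \<longlongrightarrow>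
         s / 2 * D + 1 / s * (l * M + I / (14 * l\<^sup>2))) (at_right 0)"
        by (intro tendsto_intros lim) (use l in auto)
      show "((\<lambda>\<delta>. 27/8 * I * (I + \<delta> * (2 * R) ^ 3) powr (-1/3)) \<longlongrightarrow> 27/8 * I * I powr (-1/3)) (at_right 0)"
        by (intro tendsto_intros lim) (use False in auto)
      show "\<forall>\<^sub>F \<delta> in at_right 0. 27/8 * I * (I + \<delta> * (2 * R) ^ 3) powr (-1/3)
          \<le> s / 2 * D + 1 / s * (l * M + (I + \<delta> * (2 * R) ^ 3) / (14 * l\<^sup>2))"
        using pos by (auto simp: eventually_at_filter)
    qed simp
  qed
  moreover have "I * I powr (-1/3) = I powr (2/3)"
  proof (cases "I = 0")
    case False
    then have "I * I powr (-1/3) = I powr (1 + -1/3)" using I0 by (subst powr_add) simp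
    then show ?thesis by simp
  qed simp
  ultimately show ?thesis by (simp add: D_def M_def mult.assoc)
qed

text \<open>
  The choice \<open>l\<^sup>3 = I/(7M)\<close> minimises the sum in parentheses, and \<open>s\<close> is then chosen to
  minimise the whole expression. This gives the constant \<open>192/(729 7\<^sup>1\<^sup>/\<^sup>3)\<close>, about \<open>0.138\<close>.
\<close>

lemma optimise_scales:
  fixes I M D :: real
  assumes nn: "0 \<le> I" "0 \<le> M" "0 \<le> D"
    and ineq: "\<And>s l. 0 < s \<Longrightarrow> 0 < l \<Longrightarrow> 27/8 * I powr (2/3) \<le> s / 2 * D + 1 / s * (l * M + I / (14 * l\<^sup>2))"
  shows "I \<le> 7/50 * M powr (2/3) * D"
proof (cases "I = 0")
  case True
  then show ?thesis using nn by simp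
next
  case False
  \<comment> \<open>enlarging \<open>M\<close> and \<open>D\<close> by \<open>e\<close> keeps the optimal scales defined when \<open>M\<close> or \<open>D\<close> vanishes\<close>
  have eps: "I \<le> 7/50 * (M + e) powr (2/3) * (D + e)" if e: "0 < e" for e
  proof -
    define P where "P = (M + e) powr (1/3)"
    define J where "J = I powr (1/3)"
    define k where "k = (7::real) powr (1/3)"
    define E where "E = D + e"
    have pos: "0 < P" "0 < J" "0 < k" "0 < E" using nn e False by (auto simp: P_def J_def k_def E_def)
    have P3: "M + e = P ^ 3" and J3: "I = J ^ 3" and k3: "k ^ 3 = 7"
      using nn e by (simp_all add: P_def J_def k_def powr_nth_power)
    have k: "19/10 \<le> k"
    proof (rule ccontr)
      assume "\<not> 19/10 \<le> k"
      then have "k ^ 3 < (19/10) ^ 3" using pos by (intro power_strict_mono) auto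
      then show False unfolding k3 by (simp add: power3_eq_cube)
    qed
    define l where "l = J / (k * P)"
    have l: "0 < l" unfolding l_def using pos by simp
    have l3: "I / (14 * l\<^sup>2) = P ^ 3 * l / 2"
      unfolding l_def J3 using pos k3 by (simp add: field_simps power2_eq_square power3_eq_cube)
    define q where "q = 3 * P ^ 3 * l"
    have q: "0 < q" unfolding q_def using pos l by simp
    define s where "s = sqrt (q / E)"
    have s: "0 < s" unfolding s_def using q pos by simp
    have "27/8 * I powr (2/3) \<le> s / 2 * D + 1 / s * (l * M + I / (14 * l\<^sup>2))"
      by (rule ineq[OF s l])
    also have "\<dots> \<le> s / 2 * E + 1 / s * (l * P ^ 3 + I / (14 * l\<^sup>2))"
      unfolding E_def P3[symmetric] using s l e by (intro add_mono mult_left_mono) auto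
    also have "\<dots> = s / 2 * E + 1 / s * (q / 2)"
      unfolding l3 q_def by simp
    also have "\<dots> = sqrt (q * E)"
    proof -
      have "s * E = sqrt (q * E)"
        unfolding s_def using pos q by (simp add: real_sqrt_divide real_sqrt_mult field_simps)
      moreover have "q / s = sqrt (q * E)"
        unfolding s_def using pos q by (simp add: real_sqrt_divide real_sqrt_mult field_simps)
      ultimately show ?thesis by simp
    qed
    finally have "27/8 * J ^ 2 \<le> sqrt (q * E)"
      using nn by (simp add: J_def powr_nth_power)
    then have "(27/8 * J ^ 2)\<^sup>2 \<le> (sqrt (q * E))\<^sup>2"
      by (rule power_mono) simp
    also have "\<dots> = q * E" using q pos by simp
    finally have "(27/8 * J ^ 2)\<^sup>2 \<le> q * E" .
    moreover have "(27/8 * J ^ 2)\<^sup>2 = 729/64 * J ^ 4"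
      by (simp add: power_mult_distrib power_divide flip: power_mult)
    ultimately have "729/64 * J ^ 4 \<le> 3 * P ^ 3 * (J / (k * P)) * E"
      by (simp only: q_def l_def)
    also have "\<dots> = J * (3 * P ^ 2 * E / k)"
      using pos by (simp add: field_simps power2_eq_square power3_eq_cube)
    finally have "J * (729/64 * J ^ 3) \<le> J * (3 * P ^ 2 * E / k)"
      by (simp add: numeral_eq_Suc)
    then have "729/64 * J ^ 3 \<le> 3 * P ^ 2 * E / k"
      using pos mult_le_cancel_left_pos by blast
    also have "\<dots> \<le> 3 * P ^ 2 * E / (19/10)"
      using k pos by (intro divide_left_mono) auto
    finally have "I \<le> 64 * 30 / (729 * 19) * (P ^ 2 * E)" unfolding J3 by (simp add: mult_ac)
    also have "\<dots> \<le> 7/50 * (P ^ 2 * E)" using pos by (intro mult_right_mono) auto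
    also have "P ^ 2 = (M + e) powr (2/3)" unfolding P_def using nn e by (simp add: powr_nth_power)
    finally show ?thesis by (simp add: E_def)
  qed
  have "((\<lambda>e. 7/50 * (M + e) powr (2/3) * (D + e)) \<longlongrightarrow> 7/50 * (M + 0) powr (2/3) * (D + 0)) (at_right 0)"
    by (intro tendsto_intros tendsto_powr') (use nn in \<open>auto simp: eventually_at_filter\<close>)
  then have "I \<le> 7/50 * (M + 0) powr (2/3) * (D + 0)"
    by (rule tendsto_lowerbound) (use eps in \<open>auto simp: eventually_at_filter\<close>)
  then show ?thesis by simp
qed

definition vec3 :: "real \<times> real \<times> real \<Rightarrow> real ^ 3" where
  "vec3 p = vector [fst p, fst (snd p), snd (snd p)]"

lemma vec3_nth [simp]: "vec3 p $ 1 = fst p" "vec3 p $ 2 = fst (snd p)" "vec3 p $ 3 = snd (snd p)"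
  by (simp_all add: vec3_def)

lemma Basis_vec3: "(Basis :: (real ^ 3) set) = {axis 1 1, axis 2 1, axis 3 1}"
  by (simp add: Basis_vec_def UNIV_3 insert_commute)

lemma axis_distinct: "axis 1 (1::real) \<noteq> (axis 2 1 :: real ^ 3)" "axis 1 (1::real) \<noteq> (axis 3 1 :: real ^ 3)"
  "axis 2 (1::real) \<noteq> (axis 3 1 :: real ^ 3)"
  by (simp_all add: axis_eq_axis)

lemma vec3_linear: "vec3 p = fst p *\<^sub>R axis 1 1 + fst (snd p) *\<^sub>R axis 2 1 + snd (snd p) *\<^sub>R axis 3 1"
  by (simp add: vec_eq_iff forall_3 axis_def)

lemma continuous_vec3: "continuous_on A vec3"
  unfolding vec3_linear[abs_def] by (intro continuous_intros)

lemma borel_measurable_vec3 [measurable]: "vec3 \<in> borel_measurable borel"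
  by (rule borel_measurable_continuous_onI[OF continuous_vec3])

lemma emeasure_lborel_Times:
  fixes A :: "'a::euclidean_space set" and B :: "'b::euclidean_space set"
  assumes "A \<in> sets borel" "B \<in> sets borel"
  shows "emeasure lborel (A \<times> B) = emeasure lborel A * emeasure lborel B"
  unfolding lborel_prod[symmetric] by (rule lborel.emeasure_pair_measure_Times) (use assms in auto)

text \<open>
  The isometry between \<open>\<real> \<times> \<real> \<times> \<real>\<close> and \<open>\<real>\<^sup>3\<close> transfers iterated integrals to the space on which the
  problem is posed.
\<close>

lemma lborel_vec3: "(lborel :: (real ^ 3) measure) = distr lborel borel vec3"
proof (rule lborel_eqI)
  fix l u :: "real ^ 3" assume lu: "\<And>b. b \<in> Basis \<Longrightarrow> l \<bullet> b \<le> u \<bullet> b"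
  have le: "l $ 1 \<le> u $ 1" "l $ 2 \<le> u $ 2" "l $ 3 \<le> u $ 3"
    using lu[of "axis 1 1"] lu[of "axis 2 1"] lu[of "axis 3 1"] by (auto simp: Basis_vec3 inner_axis)
  have "vec3 -` box l u = {l$1<..<u$1} \<times> {l$2<..<u$2} \<times> {l$3<..<u$3}"
    by (auto simp: mem_box_cart forall_3)
  then have "emeasure (distr lborel borel vec3) (box l u) =
     emeasure lborel ({l$1<..<u$1} \<times> {l$2<..<u$2} \<times> {l$3<..<u$3})"
    by (subst emeasure_distr) auto
  also have "\<dots> = emeasure lborel {l$1<..<u$1} * (emeasure lborel {l$2<..<u$2} * emeasure lborel {l$3<..<u$3})"
    by (simp add: emeasure_lborel_Times borel_Times)
  also have "\<dots> = ennreal (\<Prod>b\<in>Basis. (u - l) \<bullet> b)"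
    using le by (simp add: Basis_vec3 axis_distinct inner_axis ennreal_mult flip: mult.assoc)
  finally show "emeasure (distr lborel borel vec3) (box l u) = ennreal (\<Prod>b\<in>Basis. (u - l) \<bullet> b)" .
qed simp

lemma norm_vec3_ge:
  "\<bar>x\<bar> \<le> norm (vec3 (x, y, z)) \<and> \<bar>y\<bar> \<le> norm (vec3 (x, y, z)) \<and> \<bar>z\<bar> \<le> norm (vec3 (x, y, z))"
  using component_le_norm_cart[of "vec3 (x, y, z)" 1] component_le_norm_cart[of "vec3 (x, y, z)" 2]
    component_le_norm_cart[of "vec3 (x, y, z)" 3] by simp

lemma integral_cube_integral:
  fixes h :: "real ^ 3 \<Rightarrow> real"
  assumes h: "continuous_on UNIV h" and supp: "\<And>x. R \<le> norm x \<Longrightarrow> h x = 0"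
  shows "(LINT x|lborel. h x) = cube_integral R (\<lambda>x y z. h (vec3 (x, y, z)))"
proof -
  have [measurable]: "h \<in> borel_measurable borel" by (rule borel_measurable_continuous_onI[OF h])
  let ?Q = "cbox (-R, -R, -R) (R, R, R) :: (real \<times> real \<times> real) set"
  have ch: "continuous_on A (\<lambda>p. h (vec3 p))" for A
    by (rule continuous_on_compose2[OF h continuous_vec3]) auto
  have z: "h (vec3 p) = 0" if "p \<notin> ?Q" for p
  proof -
    obtain x y z where p: "p = (x, y, z)" by (cases p) auto
    have "R < \<bar>x\<bar> \<or> R < \<bar>y\<bar> \<or> R < \<bar>z\<bar>" using that by (auto simp: p)
    then have "R \<le> norm (vec3 p)" unfolding p using norm_vec3_ge[of x y z] by linarith
    then show ?thesis by (rule supp)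
  qed
  have "integrable lborel (\<lambda>p. indicator ?Q p *\<^sub>R h (vec3 p))"
    by (rule borel_integrable_compact[OF _ ch]) auto
  moreover have "indicator ?Q p *\<^sub>R h (vec3 p) = h (vec3 p)" for p
    using z[of p] by (cases "p \<in> ?Q") simp_all
  ultimately have i: "integrable lborel (\<lambda>p. h (vec3 p))" by (simp only:)
  have "(LINT x|lborel. h x) = (LINT p|lborel. h (vec3 p))"
    by (subst lborel_vec3) (rule integral_distr; simp)
  also have "\<dots> = integral UNIV (\<lambda>p. h (vec3 p))"
    by (rule integral_lborel[OF i, symmetric])
  also have "\<dots> = integral UNIV (\<lambda>p. if p \<in> ?Q then h (vec3 p) else 0)"
    using z by (intro integral_cong) (simp split: if_split)
  also have "\<dots> = integral ?Q (\<lambda>p. h (vec3 p))"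
    by (rule integral_restrict_UNIV)
  also have "\<dots> = integral (cbox (-R) R) (\<lambda>x. integral (cbox (-R, -R) (R, R)) (\<lambda>q. h (vec3 (x, q))))"
    by (rule integral_prod_continuous[OF ch, of "-R" "(-R, -R)" R "(R, R)"])
  also have "\<dots> = integral (cbox (-R) R) (\<lambda>x. integral (cbox (-R) R) (\<lambda>y. integral (cbox (-R) R) (\<lambda>z. h (vec3 (x, y, z)))))"
  proof -
    have "integral (cbox (-R, -R) (R, R)) (\<lambda>q. h (vec3 (x, q))) =
        integral (cbox (-R) R) (\<lambda>y. integral (cbox (-R) R) (\<lambda>z. h (vec3 (x, y, z))))" for x
    proof (rule integral_prod_continuous)
      have "continuous_on (cbox (-R, -R) (R, R)) (\<lambda>q. (\<lambda>p. h (vec3 p)) (x, q))"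
        by (rule continuous_on_compose2[OF ch[of UNIV]]) (auto intro!: continuous_intros)
      then show "continuous_on (cbox (-R, -R) (R, R)) (\<lambda>q. h (vec3 (x, q)))" by simp
    qed
    then show ?thesis by simp
  qed
  finally show ?thesis by (simp add: cube_integral_def)
qed

text \<open>
  \<open>G b\<close> is the partial derivative of \<open>V\<close> in the coordinate direction \<open>b\<close>.
\<close>

theorem gagliardo_nirenberg_compact:
  fixes V :: "real ^ 3 \<Rightarrow> real" and G :: "real ^ 3 \<Rightarrow> real ^ 3 \<Rightarrow> real"
  assumes R: "0 < R" and V: "continuous_on UNIV V" and G: "\<And>b. b \<in> Basis \<Longrightarrow> continuous_on UNIV (G b)"
    and V0: "\<And>x. 0 \<le> V x"
    and supp: "\<And>x. R \<le> norm x \<Longrightarrow> V x = 0" "\<And>b x. b \<in> Basis \<Longrightarrow> R \<le> norm x \<Longrightarrow> G b x = 0"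
    and der: "\<And>b x t. b \<in> Basis \<Longrightarrow> ((\<lambda>t. V (x + t *\<^sub>R b)) has_real_derivative G b (x + t *\<^sub>R b)) (at t)"
  shows "(LINT x|lborel. V x powr (8/3)) \<le>
     7/50 * (LINT x|lborel. V x) powr (2/3) * (LINT x|lborel. (\<Sum>b\<in>Basis. (G b x)\<^sup>2))"
proof -
  have B: "axis 1 1 \<in> (Basis :: (real ^ 3) set)" "axis 2 1 \<in> (Basis :: (real ^ 3) set)" "axis 3 1 \<in> (Basis :: (real ^ 3) set)"
    by (auto simp: Basis_vec3)
  define v where "v x y z = V (vec3 (x, y, z))" for x y z
  define v1 where "v1 x y z = G (axis 1 1) (vec3 (x, y, z))" for x y z
  define v2 where "v2 x y z = G (axis 2 1) (vec3 (x, y, z))" for x y z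
  define v3 where "v3 x y z = G (axis 3 1) (vec3 (x, y, z))" for x y z
  have c: "continuous_on UNIV (\<lambda>(x, y, z). h (vec3 (x, y, z)))" if "continuous_on UNIV h" for h :: "real ^ 3 \<Rightarrow> real"
    using continuous_on_compose2[OF that continuous_vec3[of UNIV]] by (simp add: split_beta')
  have d1: "((\<lambda>x. v x y z) has_real_derivative v1 x y z) (at x)" for x y z
  proof -
    have "vec3 (0, y, z) + t *\<^sub>R axis 1 1 = vec3 (t, y, z)" for t by (simp add: vec3_linear)
    with der[OF B(1), of "vec3 (0, y, z)" x] show ?thesis by (simp add: v_def v1_def)
  qed
  have d2: "((\<lambda>y. v x y z) has_real_derivative v2 x y z) (at y)" for x y z
  proof -
    have "vec3 (x, 0, z) + t *\<^sub>R axis 2 1 = vec3 (x, t, z)" for t by (simp add: vec3_linear)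
    with der[OF B(2), of "vec3 (x, 0, z)" y] show ?thesis by (simp add: v_def v2_def)
  qed
  have d3: "((\<lambda>z. v x y z) has_real_derivative v3 x y z) (at z)" for x y z
  proof -
    have "vec3 (x, y, 0) + t *\<^sub>R axis 3 1 = vec3 (x, y, t)" for t by (simp add: vec3_linear)
    with der[OF B(3), of "vec3 (x, y, 0)" z] show ?thesis by (simp add: v_def v3_def)
  qed
  have bd: "v x y z = 0" if "R \<le> \<bar>x\<bar> \<or> R \<le> \<bar>y\<bar> \<or> R \<le> \<bar>z\<bar>" for x y z
    unfolding v_def using that norm_vec3_ge[of x y z] by (intro supp) linarith
  have cV8: "continuous_on UNIV (\<lambda>x. V x powr (8/3))"
    by (intro continuous_on_powr' V continuous_intros) (use V0 in auto)
  have cG: "continuous_on UNIV (\<lambda>x. \<Sum>b\<in>Basis. (G b x)\<^sup>2)"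
    by (intro continuous_intros G)
  have I: "(LINT x|lborel. V x powr (8/3)) = cube_integral R (\<lambda>x y z. v x y z powr (8/3))"
    unfolding v_def by (rule integral_cube_integral[OF cV8]) (simp add: supp)
  have M: "(LINT x|lborel. V x) = cube_integral R v"
    unfolding v_def by (rule integral_cube_integral[OF V]) (simp add: supp)
  have D: "(LINT x|lborel. (\<Sum>b\<in>Basis. (G b x)\<^sup>2)) = cube_integral R (\<lambda>x y z. (v1 x y z)\<^sup>2 + (v2 x y z)\<^sup>2 + (v3 x y z)\<^sup>2)"
    by (subst integral_cube_integral[OF cG, of R])
       (auto simp: supp v1_def v2_def v3_def Basis_vec3 axis_distinct add.assoc)
  show ?thesis
  proof (rule optimise_scales)
    fix s l :: real assume s: "0 < s" and l: "0 < l"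
    have v0: "\<And>x y z. 0 \<le> v x y z" by (simp add: v_def V0)
    show "27/8 * (LINT x|lborel. V x powr (8/3)) powr (2/3) \<le> s / 2 * (LINT x|lborel. (\<Sum>b\<in>Basis. (G b x)\<^sup>2))
       + 1 / s * (l * (LINT x|lborel. V x) + (LINT x|lborel. V x powr (8/3)) / (14 * l\<^sup>2))"
      unfolding I M D
      by (rule knothe_cube[OF R _ _ _ _ v0 bd d1 d2 d3 s l]) (unfold v_def v1_def v2_def v3_def, (rule c V G B)+)
  qed (auto intro!: integral_nonneg_AE sum_nonneg simp: V0)
qed

section \<open>The inequality for weakly differentiable functions\<close>

lemma fatou_bound:
  fixes F :: "nat \<Rightarrow> 'a \<Rightarrow> ennreal"
  assumes [measurable]: "\<And>n. F n \<in> borel_measurable M"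
    and lim: "AE x in M. (\<lambda>n. F n x) \<longlonglongrightarrow> f x"
    and bound: "\<And>n. (\<integral>\<^sup>+ x. F n x \<partial>M) \<le> C n" and C: "C \<longlonglongrightarrow> c"
  shows "(\<integral>\<^sup>+ x. f x \<partial>M) \<le> c"
proof -
  have "(\<integral>\<^sup>+ x. f x \<partial>M) = (\<integral>\<^sup>+ x. liminf (\<lambda>n. F n x) \<partial>M)"
    by (rule nn_integral_cong_AE) (use lim in \<open>auto elim!: eventually_mono dest!: lim_imp_Liminf[rotated]\<close>)
  also have "\<dots> \<le> liminf (\<lambda>n. \<integral>\<^sup>+ x. F n x \<partial>M)"
    by (rule nn_integral_liminf) measurable
  also have "\<dots> \<le> liminf C"
    by (rule Liminf_mono) (use bound in auto)
  also have "\<dots> = c"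
    by (rule lim_imp_Liminf[OF _ C]) simp
  finally show ?thesis .
qed

text \<open>
  A cutoff function that is only once continuously differentiable is enough here, because it is
  applied after mollification; its gradient is of order \<open>1/k\<close>.
\<close>

definition cutoff :: "real \<Rightarrow> 'a::euclidean_space \<Rightarrow> real" where
  "cutoff k x = (max 0 (1 - x \<bullet> x / k\<^sup>2))\<^sup>2"

definition dcutoff :: "real \<Rightarrow> 'a::euclidean_space \<Rightarrow> 'a \<Rightarrow> real" where
  "dcutoff k b x = - (4 * max 0 (1 - x \<bullet> x / k\<^sup>2) * (x \<bullet> b) / k\<^sup>2)"

lemma positive_part_square_derivative:
  "((\<lambda>t. (max 0 t)\<^sup>2) has_real_derivative 2 * max 0 t) (at (t::real))"
proof -
  consider "0 < t" | "t < 0" | "t = 0" by linarith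
  then show ?thesis
  proof cases
    case 1
    have "((\<lambda>t. t\<^sup>2) has_real_derivative 2 * max 0 t) (at t)"
      using 1 by (auto intro!: derivative_eq_intros)
    then show ?thesis
      by (rule has_field_derivative_transform_within_open[of _ _ _ "{0<..}"]) (use 1 in auto)
  next
    case 2
    have "((\<lambda>t. 0) has_real_derivative 2 * max 0 t) (at t)"
      using 2 by auto
    then show ?thesis
      by (rule has_field_derivative_transform_within_open[of _ _ _ "{..<0}"]) (use 2 in auto)
  next
    case 3
    have "((\<lambda>h::real. max 0 h) \<longlongrightarrow> max 0 0) (at 0)" by (intro tendsto_intros)
    then have "((\<lambda>h::real. max 0 h) \<longlongrightarrow> 0) (at 0)" by simp
    then have "((\<lambda>h. ((max 0 (0 + h))\<^sup>2 - (max 0 0)\<^sup>2) / h) \<longlongrightarrow> (0::real)) (at 0)"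
      by (rule Lim_transform_eventually)
         (auto simp: eventually_at_filter max_def power2_eq_square)
    then show ?thesis using 3 by (simp add: DERIV_def)
  qed
qed

lemma cutoff_line_derivative:
  "((\<lambda>t. cutoff k (x + t *\<^sub>R b)) has_real_derivative dcutoff k b (x + t *\<^sub>R b)) (at t)"
proof -
  have "((\<lambda>t. 1 - (x + t *\<^sub>R b) \<bullet> (x + t *\<^sub>R b) / k\<^sup>2) has_real_derivative
      - (2 * ((x + t *\<^sub>R b) \<bullet> b) / k\<^sup>2)) (at t)"
  proof -
    have "(x + t *\<^sub>R b) \<bullet> (x + t *\<^sub>R b) = x \<bullet> x + 2 * t * (x \<bullet> b) + t\<^sup>2 * (b \<bullet> b)" for t
      by (simp add: inner_add_left inner_add_right inner_commute power2_eq_square algebra_simps)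
    moreover have "((\<lambda>t. x \<bullet> x + 2 * t * (x \<bullet> b) + t\<^sup>2 * (b \<bullet> b)) has_real_derivative
        2 * ((x + t *\<^sub>R b) \<bullet> b)) (at t)"
      by (auto intro!: derivative_eq_intros simp: inner_add_left algebra_simps)
    ultimately have "((\<lambda>t. (x + t *\<^sub>R b) \<bullet> (x + t *\<^sub>R b)) has_real_derivative
        2 * ((x + t *\<^sub>R b) \<bullet> b)) (at t)" by (simp only:)
    from DERIV_diff[OF DERIV_const[of 1] DERIV_cdivide[OF this, of "k\<^sup>2"]] show ?thesis by simp
  qed
  from DERIV_chain2[OF positive_part_square_derivative this]
  show ?thesis unfolding cutoff_def dcutoff_def by (simp add: algebra_simps)
qed

lemma continuous_cutoff: "continuous_on UNIV (cutoff k)"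
  unfolding cutoff_def[abs_def] divide_inverse by (intro continuous_intros)

lemma continuous_dcutoff: "continuous_on UNIV (dcutoff k b)"
  unfolding dcutoff_def[abs_def] divide_inverse by (intro continuous_intros)

lemma cutoff_outside:
  assumes "0 < k" "k \<le> norm x"
  shows "cutoff k x = 0" "dcutoff k b x = 0"
proof -
  have "k\<^sup>2 \<le> (norm x)\<^sup>2" using assms by (intro power_mono) auto
  then have "1 - x \<bullet> x / k\<^sup>2 \<le> 0" using assms by (simp add: dot_square_norm le_divide_eq)
  then show "cutoff k x = 0" "dcutoff k b x = 0" by (simp_all add: cutoff_def dcutoff_def)
qed

lemma cutoff_bounds: "0 \<le> cutoff k x" "cutoff k x \<le> 1"
proof -
  show "0 \<le> cutoff k x" by (simp add: cutoff_def)
  have "(max 0 (1 - x \<bullet> x / k\<^sup>2))\<^sup>2 \<le> 1\<^sup>2" by (intro power_mono) auto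
  then show "cutoff k x \<le> 1" by (simp add: cutoff_def)
qed

lemma dcutoff_bound:
  assumes k: "0 < k" and b: "b \<in> Basis"
  shows "\<bar>dcutoff k b x\<bar> \<le> 4 / k"
proof (cases "k \<le> norm x")
  case True
  then show ?thesis using cutoff_outside[OF k True] k by simp
next
  case False
  define m where "m = max 0 (1 - x \<bullet> x / k\<^sup>2)"
  have m: "0 \<le> m" "m \<le> 1" by (auto simp: m_def)
  have "\<bar>x \<bullet> b\<bar> \<le> k" using Basis_le_norm[OF b, of x] False by simp
  then have "m * \<bar>x \<bullet> b\<bar> \<le> 1 * k" using m by (intro mult_mono) auto
  then have "4 * m * \<bar>x \<bullet> b\<bar> / k\<^sup>2 \<le> 4 * k / k\<^sup>2" using k by (intro divide_right_mono) auto
  moreover have "\<bar>dcutoff k b x\<bar> = 4 * m * \<bar>x \<bullet> b\<bar> / k\<^sup>2"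
    by (simp add: dcutoff_def m_def abs_mult)
  ultimately show ?thesis using k by (simp add: power2_eq_square)
qed

lemma cutoff_tendsto_1: "(\<lambda>n. cutoff (real (Suc n)) x) \<longlonglongrightarrow> 1"
proof -
  have "(\<lambda>n. inverse (real (Suc n))) \<longlonglongrightarrow> 0" by (rule LIMSEQ_inverse_real_of_nat)
  then have "(\<lambda>n. (max 0 (1 - (x \<bullet> x) * (inverse (real (Suc n)))\<^sup>2))\<^sup>2) \<longlonglongrightarrow> (max 0 (1 - (x \<bullet> x) * 0\<^sup>2))\<^sup>2"
    by (intro tendsto_intros)
  then show ?thesis by (simp add: cutoff_def divide_inverse power_inverse)
qed

lemma moll_conv_nonneg: "(\<And>x. 0 \<le> f x) \<Longrightarrow> 0 \<le> moll_conv n f x"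
  unfolding moll_conv_def by (intro integral_nonneg_AE) (auto simp: moll_nonneg)

lemma moll_conv_nn_integral:
  fixes f :: "'a::euclidean_space \<Rightarrow> real"
  assumes f: "integrable lborel f" and f0: "\<And>x. 0 \<le> f x"
  shows "(\<integral>\<^sup>+ x. ennreal (moll_conv n f x) \<partial>lborel) = (\<integral>\<^sup>+ x. ennreal (f x) \<partial>lborel)"
proof -
  have [measurable]: "f \<in> borel_measurable borel" using borel_measurable_integrable[OF f] by simp
  have "ennreal (moll_conv n f x) = (\<integral>\<^sup>+ y. ennreal (moll n (x - y)) * ennreal (f y) \<partial>lborel)" for x
    unfolding moll_conv_def
    by (subst nn_integral_eq_integral[OF integrable_moll_mult[OF f], symmetric])
       (auto simp: moll_nonneg f0 ennreal_mult)
  then show ?thesis by (simp add: nn_integral_moll_right)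
qed

text \<open>
  The mollification \<open>W\<close> of \<open>v\<close> is continuously differentiable, bounded and integrable. Truncating it
  at radius \<open>k\<close> changes the gradient by a term of order \<open>W/k\<close>, which is small in \<open>L\<^sup>2\<close>. The price of
  the truncation is the step from the constant \<open>7/50\<close> to \<open>9/50\<close>. Fatou's lemma then removes first
  the truncation and then the mollification.
\<close>

theorem gagliardo_nirenberg_weak:
  fixes v :: "real ^ 3 \<Rightarrow> real" and G :: "real ^ 3 \<Rightarrow> real ^ 3 \<Rightarrow> real"
  assumes v: "integrable lborel v" and v0: "\<And>x. 0 \<le> v x"
    and G: "\<And>b. b \<in> Basis \<Longrightarrow> integrable lborel (G b)"
    and G2: "\<And>b. b \<in> Basis \<Longrightarrow> integrable lborel (\<lambda>x. (G b x)\<^sup>2)"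
    and parts: "\<And>b n z. b \<in> Basis \<Longrightarrow>
       (LINT x|lborel. v x * dmoll n b (x - z)) = - (LINT x|lborel. G b x * moll n (x - z))"
  defines "B \<equiv> 9/50 * (LINT x|lborel. v x) powr (2/3) * (LINT x|lborel. (\<Sum>b\<in>Basis. (G b x)\<^sup>2))"
  shows "integrable lborel (\<lambda>x. v x powr (8/3))" and "(LINT x|lborel. v x powr (8/3)) \<le> B"
proof -
  define M where "M = (LINT x|lborel. v x)"
  define D where "D = (LINT x|lborel. (\<Sum>b\<in>Basis. (G b x)\<^sup>2))"
  have [measurable]: "v \<in> borel_measurable borel" using borel_measurable_integrable[OF v] by simp
  have M0: "0 \<le> M" unfolding M_def by (intro integral_nonneg_AE) (simp add: v0)
  have D0: "0 \<le> D" unfolding D_def by (intro integral_nonneg_AE) (simp add: sum_nonneg)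
  have M_eq: "(\<integral>\<^sup>+ x. ennreal (v x) \<partial>lborel) = ennreal M"
    unfolding M_def by (rule nn_integral_eq_integral[OF v]) (simp add: v0)
  have smooth: "(\<integral>\<^sup>+ x. ennreal (moll_conv n v x powr (8/3)) \<partial>lborel) \<le> ennreal B" for n
  proof -
    define W where "W = moll_conv n v"
    define dW where "dW b = moll_conv n (G b)" for b
    have cW: "continuous_on UNIV W" unfolding W_def by (rule continuous_moll_conv[OF v])
    have cdW: "continuous_on UNIV (dW b)" if "b \<in> Basis" for b
      unfolding dW_def by (rule continuous_moll_conv[OF G[OF that]])
    have W0: "0 \<le> W x" for x unfolding W_def by (rule moll_conv_nonneg[OF v0])
    have [measurable]: "W \<in> borel_measurable borel" by (rule borel_measurable_continuous_onI[OF cW])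
    have W_nn: "(\<integral>\<^sup>+ x. ennreal (W x) \<partial>lborel) = ennreal M"
      unfolding W_def moll_conv_nn_integral[OF v v0] by (rule M_eq)
    have Wi: "integrable lborel W"
      by (rule integrableI_nonneg) (auto simp: W0 W_nn)
    have WM: "(LINT x|lborel. W x) = M"
      using W_nn W0 M0 by (subst integral_eq_nn_integral) auto
    obtain C where C: "0 \<le> C" "\<And>z::real^3. \<bar>moll n z\<bar> \<le> C" using moll_abs_bounded by blast
    have W_le: "W x \<le> C * M" for x
    proof -
      have "W x \<le> (LINT y|lborel. C * v y)"
        unfolding W_def moll_conv_def
        by (rule integral_mono[OF integrable_moll_mult[OF v]])
           (use v v0 C(2) abs_le_D1 in \<open>auto intro!: mult_right_mono\<close>)
      then show ?thesis by (simp add: M_def)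
    qed
    have W2: "integrable lborel (\<lambda>x. (W x)\<^sup>2)"
    proof (rule Bochner_Integration.integrable_bound)
      show "integrable lborel (\<lambda>x. C * M * W x)" using Wi by simp
      show "AE x in lborel. norm ((W x)\<^sup>2) \<le> norm (C * M * W x)"
        using W_le W0 C(1) M0 by (auto simp: power2_eq_square abs_mult intro!: mult_right_mono)
    qed measurable
    define E where "E = (LINT x|lborel. (W x)\<^sup>2)"
    have dW2: "integrable lborel (\<lambda>x. (dW b x)\<^sup>2) \<and> (LINT x|lborel. (dW b x)\<^sup>2) \<le> (LINT x|lborel. (G b x)\<^sup>2)"
      if b: "b \<in> Basis" for b
    proof -
      have [measurable]: "dW b \<in> borel_measurable borel" by (rule borel_measurable_continuous_onI[OF cdW[OF b]])
      have "(\<integral>\<^sup>+ x. ennreal ((dW b x)\<^sup>2) \<partial>lborel) \<le> (\<integral>\<^sup>+ x. ennreal ((G b x)\<^sup>2) \<partial>lborel)"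
        unfolding dW_def by (rule moll_conv_square_le[OF G[OF b] G2[OF b]])
      also have "\<dots> = ennreal (LINT x|lborel. (G b x)\<^sup>2)"
        by (rule nn_integral_eq_integral[OF G2[OF b]]) simp
      finally have le: "(\<integral>\<^sup>+ x. ennreal ((dW b x)\<^sup>2) \<partial>lborel) \<le> ennreal (LINT x|lborel. (G b x)\<^sup>2)" .
      then have i: "integrable lborel (\<lambda>x. (dW b x)\<^sup>2)"
        by (intro integrableI_nonneg) (auto intro: le_less_trans)
      then have "ennreal (LINT x|lborel. (dW b x)\<^sup>2) \<le> ennreal (LINT x|lborel. (G b x)\<^sup>2)"
        using le by (subst nn_integral_eq_integral[symmetric]) auto
      then show ?thesis using i by (simp add: ennreal_le_iff integral_nonneg_AE)
    qed
    have sum_dW: "(LINT x|lborel. (\<Sum>b\<in>Basis. (dW b x)\<^sup>2)) \<le> D"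
      unfolding D_def using dW2 G2
      by (subst (1 2) Bochner_Integration.integral_sum) (auto intro: sum_mono)
    have cut: "(\<integral>\<^sup>+ x. ennreal ((cutoff k x * W x) powr (8/3)) \<partial>lborel)
        \<le> ennreal (7/50 * M powr (2/3) * (9/7 * D + 216 / k\<^sup>2 * E))" if k: "0 < k" for k
    proof -
      define V where "V x = cutoff k x * W x" for x
      define GV where "GV b x = cutoff k x * dW b x + dcutoff k b x * W x" for b x
      have cV: "continuous_on UNIV V"
        unfolding V_def[abs_def] by (intro continuous_intros continuous_cutoff cW)
      have cGV: "continuous_on UNIV (GV b)" if "b \<in> Basis" for b
        unfolding GV_def[abs_def] by (intro continuous_intros continuous_cutoff continuous_dcutoff cW cdW that)
      have V0: "0 \<le> V x" for x unfolding V_def by (intro mult_nonneg_nonneg cutoff_bounds W0)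
      have VW: "V x \<le> W x" for x
        unfolding V_def using mult_right_mono[OF cutoff_bounds(2) W0, of k x x] by simp
      have suppV: "V x = 0" "GV b x = 0" if "k \<le> norm x" for x b
        using cutoff_outside[OF k that] by (simp_all add: V_def GV_def)
      have der: "((\<lambda>t. V (x + t *\<^sub>R b)) has_real_derivative GV b (x + t *\<^sub>R b)) (at t)"
        if b: "b \<in> Basis" for b x t
      proof -
        have "((\<lambda>t. W (x + t *\<^sub>R b)) has_real_derivative dW b (x + t *\<^sub>R b)) (at t)"
          unfolding W_def dW_def by (rule moll_conv_derivative[OF v parts[OF b]])
        from DERIV_mult[OF cutoff_line_derivative[of k x b t] this]
        show ?thesis by (simp add: V_def GV_def algebra_simps)
      qed
      have Vi: "integrable lborel V"
        by (rule integrable_compact_support[OF cV]) (use suppV in \<open>auto intro: less_imp_le\<close>)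
      have "(\<integral>\<^sup>+ x. ennreal (V x powr (8/3)) \<partial>lborel) = ennreal (LINT x|lborel. V x powr (8/3))"
      proof (rule nn_integral_eq_integral)
        show "integrable lborel (\<lambda>x. V x powr (8/3))"
        proof (rule integrable_compact_support[where r = k])
          show "continuous_on UNIV (\<lambda>x. V x powr (8/3))"
            by (intro continuous_on_powr' cV continuous_intros) (use V0 in auto)
        qed (simp add: suppV)
      qed simp
      also have "\<dots> \<le> ennreal (7/50 * (LINT x|lborel. V x) powr (2/3) * (LINT x|lborel. (\<Sum>b\<in>Basis. (GV b x)\<^sup>2)))"
        by (intro ennreal_leI gagliardo_nirenberg_compact[OF k cV cGV V0 suppV der])
      also have "\<dots> \<le> ennreal (7/50 * M powr (2/3) * (9/7 * D + 216 / k\<^sup>2 * E))"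
      proof (intro ennreal_leI mult_mono powr_mono2)
        show "(LINT x|lborel. V x) \<le> M"
          unfolding WM[symmetric] by (rule integral_mono[OF Vi Wi VW])
        have point: "(\<Sum>b\<in>Basis. (GV b x)\<^sup>2) \<le> 9/7 * (\<Sum>b\<in>Basis. (dW b x)\<^sup>2) + 216 / k\<^sup>2 * (W x)\<^sup>2" for x
        proof -
          have "(GV b x)\<^sup>2 \<le> 9/7 * (dW b x)\<^sup>2 + 72 / k\<^sup>2 * (W x)\<^sup>2" if b: "b \<in> Basis" for b
          proof -
            \<comment> \<open>the difference of the two sides is \<open>(2p - 7q)\<^sup>2/14\<close>\<close>
            have peter_paul: "(p + q)\<^sup>2 \<le> 9/7 * p\<^sup>2 + 9/2 * q\<^sup>2" for p q :: real
              using zero_le_power2[of "2 * p - 7 * q"] by (simp add: power2_eq_square algebra_simps)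
            have "(cutoff k x * dW b x)\<^sup>2 \<le> 1 * (dW b x)\<^sup>2"
              unfolding power_mult_distrib using cutoff_bounds[of k x] by (intro mult_right_mono) (auto simp: power_le_one)
            moreover have "(dcutoff k b x * W x)\<^sup>2 \<le> 16 / k\<^sup>2 * (W x)\<^sup>2"
            proof -
              have "(dcutoff k b x)\<^sup>2 \<le> (4 / k)\<^sup>2"
                using power_mono[OF dcutoff_bound[OF k b, of x], of 2] by simp
              then show ?thesis
                unfolding power_mult_distrib by (intro mult_right_mono) (auto simp: power_divide)
            qed
            moreover have "9/2 * (16 / k\<^sup>2 * (W x)\<^sup>2) = 72 / k\<^sup>2 * (W x)\<^sup>2" by simp
            ultimately show ?thesis
              using peter_paul[of "cutoff k x * dW b x" "dcutoff k b x * W x"]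
              unfolding GV_def by linarith
          qed
          then have "(\<Sum>b\<in>Basis. (GV b x)\<^sup>2) \<le> (\<Sum>b\<in>(Basis :: (real^3) set). 9/7 * (dW b x)\<^sup>2 + 72 / k\<^sup>2 * (W x)\<^sup>2)"
            by (rule sum_mono)
          also have "\<dots> = 9/7 * (\<Sum>b\<in>Basis. (dW b x)\<^sup>2) + 216 / k\<^sup>2 * (W x)\<^sup>2"
            by (simp add: sum.distrib sum_distrib_left)
          finally show ?thesis .
        qed
        have "(LINT x|lborel. (\<Sum>b\<in>Basis. (GV b x)\<^sup>2)) \<le>
           (LINT x|lborel. 9/7 * (\<Sum>b\<in>Basis. (dW b x)\<^sup>2) + 216 / k\<^sup>2 * (W x)\<^sup>2)"
        proof (rule integral_mono)
          show "integrable lborel (\<lambda>x. \<Sum>b\<in>Basis. (GV b x)\<^sup>2)"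
            by (rule integrable_compact_support[where r = k])
               (auto intro!: continuous_intros cGV simp: suppV)
        qed (use dW2 W2 point in auto)
        also have "\<dots> = 9/7 * (LINT x|lborel. (\<Sum>b\<in>Basis. (dW b x)\<^sup>2)) + 216 / k\<^sup>2 * E"
          using dW2 W2 by (simp add: E_def)
        also have "\<dots> \<le> 9/7 * D + 216 / k\<^sup>2 * E" using sum_dW by simp
        finally show "(LINT x|lborel. (\<Sum>b\<in>Basis. (GV b x)\<^sup>2)) \<le> 9/7 * D + 216 / k\<^sup>2 * E" .
      qed (auto intro!: integral_nonneg_AE sum_nonneg simp: V0 M0)
      finally show ?thesis unfolding V_def .
    qed
    have "(\<integral>\<^sup>+ x. ennreal (W x powr (8/3)) \<partial>lborel) \<le> ennreal (7/50 * M powr (2/3) * (9/7 * D + 216 * 0\<^sup>2 * E))"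
    proof (rule fatou_bound[where F = "\<lambda>j x. ennreal ((cutoff (real (Suc j)) x * W x) powr (8/3))"
          and C = "\<lambda>j. ennreal (7/50 * M powr (2/3) * (9/7 * D + 216 * (inverse (real (Suc j)))\<^sup>2 * E))"])
      show "(\<lambda>x. ennreal ((cutoff (real (Suc j)) x * W x) powr (8/3))) \<in> borel_measurable lborel" for j
        using borel_measurable_continuous_onI[OF continuous_cutoff, of "real (Suc j)"] by measurable
      show "AE x in lborel. (\<lambda>j. ennreal ((cutoff (real (Suc j)) x * W x) powr (8/3))) \<longlonglongrightarrow> ennreal (W x powr (8/3))"
      proof (rule AE_I2)
        fix x
        have "(\<lambda>j. (cutoff (real (Suc j)) x * W x) powr (8/3)) \<longlonglongrightarrow> (1 * W x) powr (8/3)"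
          by (intro tendsto_powr' tendsto_intros cutoff_tendsto_1) (auto simp: W0 cutoff_bounds)
        then show "(\<lambda>j. ennreal ((cutoff (real (Suc j)) x * W x) powr (8/3))) \<longlonglongrightarrow> ennreal (W x powr (8/3))"
          by (intro tendsto_ennrealI) simp
      qed
      show "(\<integral>\<^sup>+ x. ennreal ((cutoff (real (Suc j)) x * W x) powr (8/3)) \<partial>lborel)
          \<le> ennreal (7/50 * M powr (2/3) * (9/7 * D + 216 * (inverse (real (Suc j)))\<^sup>2 * E))" for j
      proof -
        have "216 / c\<^sup>2 = 216 * (inverse c)\<^sup>2" for c :: real
          by (simp only: divide_inverse power_inverse)
        moreover have "0 < real (Suc j)" by simp
        note cut[OF this]
        ultimately show ?thesis by (simp only:)
      qed
      show "(\<lambda>j. ennreal (7/50 * M powr (2/3) * (9/7 * D + 216 * (inverse (real (Suc j)))\<^sup>2 * E)))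
          \<longlonglongrightarrow> ennreal (7/50 * M powr (2/3) * (9/7 * D + 216 * 0\<^sup>2 * E))"
        by (intro tendsto_ennrealI tendsto_intros LIMSEQ_inverse_real_of_nat)
    qed
    also have "7/50 * M powr (2/3) * (9/7 * D + 216 * 0\<^sup>2 * E) = B"
      by (simp add: B_def M_def D_def)
    finally show ?thesis unfolding W_def .
  qed
  have mi: "integrable lborel (\<lambda>x. moll_conv n v x - v x)" for n
  proof -
    have "(\<integral>\<^sup>+ x. ennreal (moll_conv n v x) \<partial>lborel) = ennreal M"
      unfolding moll_conv_nn_integral[OF v v0] by (rule M_eq)
    then have "integrable lborel (moll_conv n v)"
      by (intro integrableI_nonneg) (auto simp: moll_conv_nonneg v0)
    then show ?thesis using v by simp
  qed
  have "(\<lambda>n. LINT x|lborel. norm (moll_conv n v x - v x)) \<longlonglongrightarrow> 0"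
  proof (rule tendsto_ennrealD)
    show "(\<lambda>n. ennreal (LINT x|lborel. norm (moll_conv n v x - v x))) \<longlonglongrightarrow> ennreal 0"
      unfolding ennreal_0
    proof (rule tendsto_sandwich[OF _ _ tendsto_const moll_osc_tendsto_0[OF v]])
      show "\<forall>\<^sub>F n in sequentially. ennreal (LINT x|lborel. norm (moll_conv n v x - v x)) \<le> moll_osc n v"
        using moll_conv_L1[OF v] mi by (auto simp: nn_integral_eq_integral[symmetric])
    qed auto
  qed auto
  then obtain r :: "nat \<Rightarrow> nat" where r: "strict_mono r" "AE x in lborel. (\<lambda>n. moll_conv (r n) v x - v x) \<longlonglongrightarrow> 0"
    using tendsto_L1_AE_subseq[of lborel "\<lambda>n x. moll_conv n v x - v x", OF mi] by auto
  have fin: "(\<integral>\<^sup>+ x. ennreal (v x powr (8/3)) \<partial>lborel) \<le> ennreal B"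
  proof (rule fatou_bound[where F = "\<lambda>n x. ennreal (moll_conv (r n) v x powr (8/3))", OF _ _ smooth tendsto_const])
    show "AE x in lborel. (\<lambda>n. ennreal (moll_conv (r n) v x powr (8/3))) \<longlonglongrightarrow> ennreal (v x powr (8/3))"
      using r(2)
    proof eventually_elim
      case (elim x)
      then have "(\<lambda>n. moll_conv (r n) v x) \<longlonglongrightarrow> v x" by (simp add: LIM_zero_iff)
      then show ?case
        by (intro tendsto_ennrealI tendsto_powr' tendsto_const) (auto simp: moll_conv_nonneg v0)
    qed
  qed measurable
  then show i: "integrable lborel (\<lambda>x. v x powr (8/3))"
    by (intro integrableI_nonneg) (auto intro: le_less_trans)
  have "0 \<le> B" unfolding B_def M_def[symmetric] D_def[symmetric] using D0 by simp
  with fin i show "(LINT x|lborel. v x powr (8/3)) \<le> B"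
    by (subst (asm) nn_integral_eq_integral) (auto simp: ennreal_le_iff)
qed

section \<open>Weak gradients and the space of finite energy\<close>

lemma integral_lebesgue_rep:
  fixes f f' :: "'a::euclidean_space \<Rightarrow> real"
  assumes f: "f \<in> borel_measurable lebesgue" and f': "f' \<in> borel_measurable borel"
    and ae: "AE x in lborel. f x = f' x"
  shows "integrable lebesgue f \<longleftrightarrow> integrable lborel f'"
    and "(LINT x|lebesgue. f x) = (LINT x|lborel. f' x)"
proof -
  have f'l: "f' \<in> borel_measurable lebesgue" using f' by (simp add: measurable_completion)
  have ae': "AE x in lebesgue. f x = f' x" using ae by (rule AE_completion)
  show "integrable lebesgue f \<longleftrightarrow> integrable lborel f'"
    using integrable_cong_AE[OF f f'l ae'] integrable_completion[of f' lborel] f' by simp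
  show "(LINT x|lebesgue. f x) = (LINT x|lborel. f' x)"
    using integral_cong_AE[OF f f'l ae'] integral_completion[of f' lborel] f' by simp
qed

lemma lebesgue_rep:
  fixes f :: "'a::euclidean_space \<Rightarrow> real"
  assumes "f \<in> borel_measurable lebesgue"
  obtains f' where "f' \<in> borel_measurable borel" "AE x in lborel. f x = f' x"
  using completion_ex_borel_measurable_real[OF assms] by (auto simp: measurable_lborel1)

lemma locally_integrable_component:
  fixes g :: "'a::euclidean_space \<Rightarrow> 'b::euclidean_space"
  assumes "locally_integrable g"
  shows "integrable lebesgue (\<lambda>x. indicator (cball 0 r) x * (g x \<bullet> b))"
proof -
  have "integrable lebesgue (\<lambda>x. (indicator (cball 0 r) x *\<^sub>R g x) \<bullet> b)"
    using assms unfolding locally_integrable_def set_integrable_def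
    by (intro integrable_inner_left) auto
  then show ?thesis by simp
qed

lemma locally_integrable_measurable:
  fixes g :: "'a::euclidean_space \<Rightarrow> 'b::euclidean_space"
  assumes "locally_integrable g"
  shows "(\<lambda>x. g x \<bullet> b) \<in> borel_measurable lebesgue"
proof (rule borel_measurable_LIMSEQ_real)
  show "(\<lambda>x. indicator (cball 0 (real n)) x * (g x \<bullet> b)) \<in> borel_measurable lebesgue" for n
    using locally_integrable_component[OF assms] by (rule borel_measurable_integrable)
  show "(\<lambda>n. indicator (cball 0 (real n)) x * (g x \<bullet> b)) \<longlonglongrightarrow> g x \<bullet> b" for x
  proof (rule tendsto_eventually)
    obtain N :: nat where "norm x \<le> real N" using real_arch_simple by blast
    then show "\<forall>\<^sub>F n in sequentially. indicator (cball 0 (real n)) x * (g x \<bullet> b) = g x \<bullet> b"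
      by (auto simp: eventually_sequentially indicator_def intro!: exI[of _ N])
  qed
qed

lemma locally_integrable_moll:
  fixes g :: "'a::euclidean_space \<Rightarrow> 'b::euclidean_space"
  assumes g: "locally_integrable g"
  shows "integrable lebesgue (\<lambda>x. (g x \<bullet> b) * moll n (x - a))"
proof -
  obtain C where C: "0 \<le> C" "\<And>z::'a. \<bar>moll n z\<bar> \<le> C" using moll_abs_bounded by blast
  let ?r = "norm a + 1"
  have z: "moll n (x - a) = 0" if "x \<notin> cball 0 ?r" for x
    using that norm_triangle_ineq2[of x a] moll_rad_le_1[of n] by (intro moll_eq_0) auto
  show ?thesis
  proof (rule Bochner_Integration.integrable_bound)
    show "integrable lebesgue (\<lambda>x. C * (indicator (cball 0 ?r) x * (g x \<bullet> b)))"
      using locally_integrable_component[OF g] by (rule integrable_mult_right)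
    show "(\<lambda>x. (g x \<bullet> b) * moll n (x - a)) \<in> borel_measurable lebesgue"
    proof (rule borel_measurable_times[OF locally_integrable_measurable[OF g]])
      show "(\<lambda>x. moll n (x - a)) \<in> borel_measurable lebesgue"
        by (intro measurable_completion) simp
    qed
    show "AE x in lebesgue. norm ((g x \<bullet> b) * moll n (x - a)) \<le> norm (C * (indicator (cball 0 ?r) x * (g x \<bullet> b)))"
    proof (rule AE_I2)
      fix x
      show "norm ((g x \<bullet> b) * moll n (x - a)) \<le> norm (C * (indicator (cball 0 ?r) x * (g x \<bullet> b)))"
      proof (cases "x \<in> cball 0 ?r")
        case True
        then show ?thesis using C(1) mult_left_mono[OF C(2)[of "x - a"], of "\<bar>g x \<bullet> b\<bar>"]
          by (simp add: abs_mult mult.commute)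
      next
        case False
        then show ?thesis using z by simp
      qed
    qed
  qed
qed

text \<open>
  The fundamental lemma is applied to a Borel representative of each component of \<open>g - h\<close>. In
  particular \<open>weak_grad\<close> may be computed from any weak gradient.
\<close>

theorem weak_gradient_unique:
  fixes u :: "'a::euclidean_space \<Rightarrow> real"
  assumes g: "is_weak_gradient u g" and h: "is_weak_gradient u h"
  shows "AE x in lborel. g x = h x"
proof -
  have lg: "locally_integrable g" and lh: "locally_integrable h"
    using g h by (auto simp: is_weak_gradient_def)
  have comp: "AE x in lborel. (g x - h x) \<bullet> b = 0" if b: "b \<in> Basis" for b
  proof -
    have m: "(\<lambda>x. (g x - h x) \<bullet> b) \<in> borel_measurable lebesgue"
      unfolding inner_diff_left
      by (intro borel_measurable_diff locally_integrable_measurable lg lh)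
    obtain d where d [measurable]: "d \<in> borel_measurable borel" and ae: "AE x in lborel. (g x - h x) \<bullet> b = d x"
      using lebesgue_rep[OF m] by metis
    have "AE x in lborel. d x = 0"
    proof (rule fundamental_lemma[OF d])
      fix r :: real
      have [measurable]: "cball (0::'a) r \<in> sets borel" by simp
      have m': "(\<lambda>x. indicator (cball 0 r) x * d x) \<in> borel_measurable borel" by measurable
      have ae': "AE x in lborel. indicator (cball 0 r) x * ((g x - h x) \<bullet> b) = indicator (cball 0 r) x * d x"
        using ae by eventually_elim simp
      have i: "integrable lebesgue (\<lambda>x. indicator (cball 0 r) x * ((g x - h x) \<bullet> b))"
        unfolding inner_diff_left right_diff_distrib
        by (intro Bochner_Integration.integrable_diff locally_integrable_component lg lh)
      then have "integrable lborel (\<lambda>x. indicator (cball 0 r) x * d x)"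
        using integral_lebesgue_rep(1)[OF borel_measurable_integrable[OF i] m' ae'] by blast
      then show "set_integrable lborel (cball 0 r) d" by (simp add: set_integrable_def)
    next
      fix n a
      have i: "integrable lebesgue (\<lambda>x. (g x \<bullet> b) * moll n (x - a))" "integrable lebesgue (\<lambda>x. (h x \<bullet> b) * moll n (x - a))"
        by (rule locally_integrable_moll lg lh)+
      have "(LINT x|lborel. d x * moll n (x - a)) = (LINT x|lebesgue. (g x \<bullet> b) * moll n (x - a) - (h x \<bullet> b) * moll n (x - a))"
        by (rule integral_lebesgue_rep(2)[symmetric])
           (use ae i in \<open>auto simp: inner_diff_left algebra_simps elim!: eventually_mono
              intro: borel_measurable_integrable borel_measurable_diff\<close>)
      also have "\<dots> = (LINT x|lebesgue. (g x \<bullet> b) * moll n (x - a)) - (LINT x|lebesgue. (h x \<bullet> b) * moll n (x - a))"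
        using i by simp
      also have "\<dots> = 0"
        using g[unfolded is_weak_gradient_def, THEN conjunct2, THEN conjunct2, rule_format, OF test_function_moll[of n a] b]
          h[unfolded is_weak_gradient_def, THEN conjunct2, THEN conjunct2, rule_format, OF test_function_moll[of n a] b]
        by simp
      finally show "(LINT x|lborel. d x * moll n (x - a)) = 0" .
    qed
    with ae show ?thesis by eventually_elim simp
  qed
  have "AE x in lborel. \<forall>b\<in>Basis. (g x - h x) \<bullet> b = 0"
    using comp by (subst AE_ball_countable) (auto intro: countable_finite)
  then show ?thesis
    by eventually_elim (simp add: euclidean_eq_iff[of "g _"] inner_diff_left)
qed

lemma weak_grad_is_weak_gradient: "u \<in> H1 \<Longrightarrow> is_weak_gradient u (weak_grad u)"
  unfolding H1_def weak_grad_def using someI[of "is_weak_gradient u"] by blast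

lemma weak_grad_AE:
  assumes "is_weak_gradient u g"
  shows "AE x in lborel. weak_grad u x = g x"
  using weak_gradient_unique[OF someI[of "is_weak_gradient u", OF assms] assms]
  by (simp only: weak_grad_def)

lemma weak_grad_component_measurable:
  assumes "u \<in> H1"
  shows "(\<lambda>x. weak_grad u x \<bullet> b) \<in> borel_measurable lebesgue"
  using weak_grad_is_weak_gradient[OF assms]
  by (intro locally_integrable_measurable) (simp add: is_weak_gradient_def)

lemma norm_square_components: "(norm (g x))\<^sup>2 = (\<Sum>b\<in>Basis. (g x \<bullet> b)\<^sup>2)"
  unfolding power2_norm_eq_inner
  by (subst euclidean_inner) (simp add: power2_eq_square)

lemma weak_grad_norm_square_measurable:
  assumes "u \<in> H1"
  shows "(\<lambda>x. (norm (weak_grad u x))\<^sup>2) \<in> borel_measurable lebesgue"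
  unfolding norm_square_components
  by (intro borel_measurable_sum borel_measurable_power weak_grad_component_measurable assms)

lemma weak_grad_square_integrable:
  assumes "u \<in> H1"
  shows "integrable lebesgue (\<lambda>x. (norm (weak_grad u x))\<^sup>2)"
proof -
  obtain g where g: "is_weak_gradient u g" "g \<in> L2" using assms by (auto simp: H1_def)
  have "AE x in lebesgue. (norm (weak_grad u x))\<^sup>2 = (norm (g x))\<^sup>2"
    using AE_completion[OF weak_grad_AE[OF g(1)]] by eventually_elim simp
  moreover have "integrable lebesgue (\<lambda>x. (norm (g x))\<^sup>2)" using g(2) by (simp add: L2_def)
  ultimately show ?thesis
    using integrable_cong_AE[OF weak_grad_norm_square_measurable[OF assms] borel_measurable_integrable]
    by blast
qed

text \<open>
  \<open>v = u\<^sup>2\<close> has the weak gradient \<open>2 u Du\<close>, hence \<open>\<integral> \<bar>Dv\<bar>\<^sup>2 = 4 \<integral> u\<^sup>2 \<bar>Du\<bar>\<^sup>2\<close>, and the general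
  inequality applies to Borel representatives of \<open>u\<close> and of the components of \<open>Du\<close>.
\<close>

theorem gagliardo_nirenberg_X:
  assumes u: "u \<in> X_space"
  defines "Y \<equiv> LINT x|lebesgue. (u x)\<^sup>2 * (norm (weak_grad u x))\<^sup>2"
  shows "integrable lebesgue (\<lambda>x. (u x)\<^sup>2)"
    and "integrable lebesgue (\<lambda>x. (u x)\<^sup>2 * (norm (weak_grad u x))\<^sup>2)"
    and "integrable lebesgue (\<lambda>x. (u x)\<^sup>2 powr (8/3))"
    and "(LINT x|lebesgue. (u x)\<^sup>2 powr (8/3)) \<le> 9/50 * (LINT x|lebesgue. (u x)\<^sup>2) powr (2/3) * (4 * Y)"
proof -
  have uH: "u \<in> H1" and uX: "(\<lambda>x. u x * norm (weak_grad u x)) \<in> L2"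
    using u by (auto simp: X_space_def)
  have um: "u \<in> borel_measurable lebesgue" and u2: "integrable lebesgue (\<lambda>x. (u x)\<^sup>2)"
    using uH by (auto simp: H1_def L2_def)
  show "integrable lebesgue (\<lambda>x. (u x)\<^sup>2)" by fact
  show uY: "integrable lebesgue (\<lambda>x. (u x)\<^sup>2 * (norm (weak_grad u x))\<^sup>2)"
    using uX by (simp add: L2_def power_mult_distrib)
  define g where "g = weak_grad u"
  have wg: "is_weak_gradient u g" unfolding g_def by (rule weak_grad_is_weak_gradient[OF uH])
  have gm: "(\<lambda>x. g x \<bullet> b) \<in> borel_measurable lebesgue" for b
    unfolding g_def by (rule weak_grad_component_measurable[OF uH])
  obtain w where w [measurable]: "w \<in> borel_measurable borel" and uw: "AE x in lborel. u x = w x"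
    using lebesgue_rep[OF um] by metis
  have "\<exists>h. h \<in> borel_measurable borel \<and> (AE x in lborel. g x \<bullet> b = h x)" for b
    using lebesgue_rep[OF gm[of b]] by metis
  then obtain h where h: "\<And>b. h b \<in> borel_measurable borel" "\<And>b. AE x in lborel. g x \<bullet> b = h b x"
    by metis
  note [measurable] = h(1)
  have w2: "integrable lborel (\<lambda>x. (w x)\<^sup>2)"
    using u2 by (subst (asm) integral_lebesgue_rep(1)[where f' = "\<lambda>x. (w x)\<^sup>2"])
       (use uw um in \<open>auto\<close>)
  have gb_le: "(g x \<bullet> b)\<^sup>2 \<le> (norm (g x))\<^sup>2" if "b \<in> Basis" for b x
    using Basis_le_norm[OF that, of "g x"] by (metis abs_ge_zero power2_abs power_mono)
  have h2: "integrable lborel (\<lambda>x. (h b x)\<^sup>2)" if b: "b \<in> Basis" for b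
  proof -
    have "integrable lebesgue (\<lambda>x. (g x \<bullet> b)\<^sup>2)"
    proof (rule Bochner_Integration.integrable_bound)
      show "integrable lebesgue (\<lambda>x. (norm (g x))\<^sup>2)"
        unfolding g_def by (rule weak_grad_square_integrable[OF uH])
    qed (use gm gb_le[OF b] in auto)
    then show ?thesis
      by (subst (asm) integral_lebesgue_rep(1)[where f' = "\<lambda>x. (h b x)\<^sup>2"])
         (use h(2)[of b] gm in \<open>auto\<close>)
  qed
  define v where "v x = (w x)\<^sup>2" for x
  define G where "G b x = 2 * w x * h b x" for b x
  have v: "integrable lborel v" unfolding v_def by (rule w2)
  have G: "integrable lborel (G b)" if b: "b \<in> Basis" for b
  proof -
    have "integrable lborel (\<lambda>x. 2 * (w x * h b x))"
      by (intro integrable_mult_right integrable_mult_L2 w2 h2 b) auto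
    then show ?thesis by (simp add: G_def[abs_def] mult.assoc)
  qed
  have G2l: "integrable lebesgue (\<lambda>x. 4 * (u x)\<^sup>2 * (g x \<bullet> b)\<^sup>2)" if b: "b \<in> Basis" for b
  proof (rule Bochner_Integration.integrable_bound)
    show "integrable lebesgue (\<lambda>x. 4 * ((u x)\<^sup>2 * (norm (g x))\<^sup>2))"
      using uY unfolding g_def by simp
    show "AE x in lebesgue. norm (4 * (u x)\<^sup>2 * (g x \<bullet> b)\<^sup>2) \<le> norm (4 * ((u x)\<^sup>2 * (norm (g x))\<^sup>2))"
      using gb_le[OF b] by (auto simp: mult_left_mono)
  qed (use um gm in simp)
  have G2_rep: "integrable lborel (\<lambda>x. (G b x)\<^sup>2)"
    "(LINT x|lborel. (G b x)\<^sup>2) = (LINT x|lebesgue. 4 * (u x)\<^sup>2 * (g x \<bullet> b)\<^sup>2)" if b: "b \<in> Basis" for b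
  proof -
    have ae: "AE x in lborel. 4 * (u x)\<^sup>2 * (g x \<bullet> b)\<^sup>2 = (G b x)\<^sup>2"
      using uw h(2)[of b] by eventually_elim (simp add: G_def power_mult_distrib)
    have m: "(\<lambda>x. (G b x)\<^sup>2) \<in> borel_measurable borel" unfolding G_def by measurable
    note rep = integral_lebesgue_rep[OF borel_measurable_integrable[OF G2l[OF b]] m ae]
    show "integrable lborel (\<lambda>x. (G b x)\<^sup>2)" using rep(1) G2l[OF b] by simp
    show "(LINT x|lborel. (G b x)\<^sup>2) = (LINT x|lebesgue. 4 * (u x)\<^sup>2 * (g x \<bullet> b)\<^sup>2)" using rep(2) by simp
  qed
  have parts: "(LINT x|lborel. v x * dmoll n b (x - z)) = - (LINT x|lborel. G b x * moll n (x - z))"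
    if b: "b \<in> Basis" for b n z
  proof -
    have "weak_partial b w (h b)"
      unfolding weak_partial_def
    proof (intro allI impI)
      fix \<phi> :: "real^3 \<Rightarrow> real" assume \<phi>: "test_function \<phi>"
      then have "C_times (Suc 0) \<phi>" unfolding test_function_def by blast
      then have diff: "\<phi> differentiable_on UNIV" and cont': "continuous_on UNIV (\<lambda>x. frechet_derivative \<phi> (at x) b)"
        using b by auto
      have \<phi>m [measurable]: "\<phi> \<in> borel_measurable borel" "(\<lambda>x. frechet_derivative \<phi> (at x) b) \<in> borel_measurable borel"
        using cont' differentiable_imp_continuous_on[OF diff] by (auto intro: borel_measurable_continuous_onI)
      have lm: "f \<in> borel_measurable lebesgue" if "f \<in> borel_measurable borel" for f :: "real^3 \<Rightarrow> real"
        using that by (simp add: measurable_completion)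
      have "(LINT x|lborel. w x * frechet_derivative \<phi> (at x) b) = (LINT x|lebesgue. u x * frechet_derivative \<phi> (at x) b)"
      proof (rule integral_lebesgue_rep(2)[symmetric])
        show "(\<lambda>x. u x * frechet_derivative \<phi> (at x) b) \<in> borel_measurable lebesgue"
          by (rule borel_measurable_times[OF um lm[OF \<phi>m(2)]])
        show "(\<lambda>x. w x * frechet_derivative \<phi> (at x) b) \<in> borel_measurable borel" by measurable
        show "AE x in lborel. u x * frechet_derivative \<phi> (at x) b = w x * frechet_derivative \<phi> (at x) b"
          using uw by eventually_elim simp
      qed
      also have "\<dots> = - (LINT x|lebesgue. (g x \<bullet> b) * \<phi> x)"
        using wg \<phi> b unfolding is_weak_gradient_def by blast
      also have "(LINT x|lebesgue. (g x \<bullet> b) * \<phi> x) = (LINT x|lborel. h b x * \<phi> x)"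
      proof (rule integral_lebesgue_rep(2))
        show "(\<lambda>x. (g x \<bullet> b) * \<phi> x) \<in> borel_measurable lebesgue"
          by (rule borel_measurable_times[OF gm lm[OF \<phi>m(1)]])
        show "(\<lambda>x. h b x * \<phi> x) \<in> borel_measurable borel" by measurable
        show "AE x in lborel. (g x \<bullet> b) * \<phi> x = h b x * \<phi> x"
          using h(2)[of b] by eventually_elim simp
      qed
      finally show "(LINT x|lborel. w x * frechet_derivative \<phi> (at x) b) = - (LINT x|lborel. h b x * \<phi> x)" .
    qed
    from weak_partial_square[OF w h(1) w2 h2[OF b] this] show ?thesis
      by (simp add: v_def G_def)
  qed
  have v0: "0 \<le> v x" for x by (simp add: v_def)
  note GN = gagliardo_nirenberg_weak[OF v v0 G G2_rep(1) parts]
  have ae8: "AE x in lborel. (u x)\<^sup>2 powr (8/3) = v x powr (8/3)"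
    using uw by eventually_elim (simp add: v_def)
  have m8: "(\<lambda>x. (u x)\<^sup>2 powr (8/3)) \<in> borel_measurable lebesgue" using um by simp
  have m8': "(\<lambda>x. v x powr (8/3)) \<in> borel_measurable borel" unfolding v_def by measurable
  note rep8 = integral_lebesgue_rep[OF m8 m8' ae8]
  show "integrable lebesgue (\<lambda>x. (u x)\<^sup>2 powr (8/3))" using rep8(1) GN(1) by simp
  have M: "(LINT x|lborel. v x) = (LINT x|lebesgue. (u x)\<^sup>2)"
    by (rule integral_lebesgue_rep(2)[OF borel_measurable_integrable[OF u2], symmetric])
       (use uw in \<open>auto simp: v_def[abs_def] elim!: eventually_mono\<close>)
  have D: "(LINT x|lborel. (\<Sum>b\<in>Basis. (G b x)\<^sup>2)) = 4 * Y"
  proof -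
    have "(LINT x|lborel. (\<Sum>b\<in>Basis. (G b x)\<^sup>2)) = (\<Sum>b\<in>Basis. (LINT x|lebesgue. 4 * (u x)\<^sup>2 * (g x \<bullet> b)\<^sup>2))"
      using G2_rep by (subst Bochner_Integration.integral_sum) auto
    also have "\<dots> = (LINT x|lebesgue. (\<Sum>b\<in>Basis. 4 * (u x)\<^sup>2 * (g x \<bullet> b)\<^sup>2))"
      using G2l by (subst Bochner_Integration.integral_sum) auto
    also have "\<dots> = (LINT x|lebesgue. 4 * ((u x)\<^sup>2 * (norm (g x))\<^sup>2))"
      by (simp add: norm_square_components sum_distrib_left mult.assoc)
    finally show ?thesis by (simp add: Y_def g_def)
  qed
  show "(LINT x|lebesgue. (u x)\<^sup>2 powr (8/3)) \<le> 9/50 * (LINT x|lebesgue. (u x)\<^sup>2) powr (2/3) * (4 * Y)"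
    using GN(2) unfolding rep8(2) M D by simp
qed

section \<open>Gaussians\<close>

lemma gaussian_line:
  fixes a :: real
  assumes a: "0 < a"
  shows "(\<integral>\<^sup>+ t. ennreal (exp (- (a * t\<^sup>2))) \<partial>lborel) = ennreal (sqrt (pi / a))"
    and "(\<integral>\<^sup>+ t. ennreal (t\<^sup>2 * exp (- (a * t\<^sup>2))) \<partial>lborel) = ennreal (sqrt (pi / a) / (2 * a))"
proof -
  \<comment> \<open>the standard deviation for which the normal density is proportional to \<open>exp (-a t\<^sup>2)\<close>\<close>
  define \<sigma> where "\<sigma> = sqrt (1 / (2 * a))"
  have \<sigma>: "0 < \<sigma>" "\<sigma>\<^sup>2 = 1 / (2 * a)" using a by (auto simp: \<sigma>_def)
  have nd: "normal_density 0 \<sigma> t = sqrt (a / pi) * exp (- (a * t\<^sup>2))" for t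
    using a by (simp add: normal_density_def \<sigma> real_sqrt_divide field_simps)
  have k: "sqrt (pi / a) * sqrt (a / pi) = 1"
    using a by (simp add: real_sqrt_mult[symmetric])
  have "has_bochner_integral lborel (\<lambda>t. sqrt (pi / a) * normal_density 0 \<sigma> t) (sqrt (pi / a) * 1)"
    using \<sigma> by (intro has_bochner_integral_mult_right) (simp add: has_bochner_integral_iff)
  moreover have "sqrt (pi / a) * normal_density 0 \<sigma> t = exp (- (a * t\<^sup>2))" for t
    unfolding nd mult.assoc[symmetric] k by simp
  ultimately have 1: "has_bochner_integral lborel (\<lambda>t. exp (- (a * t\<^sup>2))) (sqrt (pi / a))" by simp
  then show "(\<integral>\<^sup>+ t. ennreal (exp (- (a * t\<^sup>2))) \<partial>lborel) = ennreal (sqrt (pi / a))"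
    by (subst nn_integral_eq_integral) (auto simp: has_bochner_integral_iff)
  have "has_bochner_integral lborel (\<lambda>t. sqrt (pi / a) * (normal_density 0 \<sigma> t * (t - 0) ^ (2 * 1)))
     (sqrt (pi / a) * (fact (2 * 1) / ((2 / \<sigma>\<^sup>2) ^ 1 * fact 1)))"
    by (intro has_bochner_integral_mult_right normal_moment_even \<sigma>)
  moreover have "sqrt (pi / a) * (normal_density 0 \<sigma> t * (t - 0) ^ (2 * 1)) = t\<^sup>2 * exp (- (a * t\<^sup>2))" for t
    unfolding nd using k by (simp add: mult.assoc[symmetric])
  moreover have "fact (2 * 1) / ((2 / \<sigma>\<^sup>2) ^ 1 * fact 1) = 1 / (2 * a)"
    unfolding \<sigma> using a by (simp add: field_simps)
  ultimately have "has_bochner_integral lborel (\<lambda>t. t\<^sup>2 * exp (- (a * t\<^sup>2))) (sqrt (pi / a) * (1 / (2 * a)))"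
    by (simp only:)
  then have 2: "has_bochner_integral lborel (\<lambda>t. t\<^sup>2 * exp (- (a * t\<^sup>2))) (sqrt (pi / a) / (2 * a))" by simp
  then show "(\<integral>\<^sup>+ t. ennreal (t\<^sup>2 * exp (- (a * t\<^sup>2))) \<partial>lborel) = ennreal (sqrt (pi / a) / (2 * a))"
    by (subst nn_integral_eq_integral) (auto simp: has_bochner_integral_iff)
qed

lemma powr_three_halves: "0 < x \<Longrightarrow> x powr (3/2) = sqrt x ^ 3"
  by (simp add: powr_half_sqrt[symmetric] powr_powr flip: powr_numeral)

lemma gaussian_mass:
  fixes a :: real
  assumes a: "0 < a"
  shows "has_bochner_integral lborel (\<lambda>x::real^3. exp (- (a * (norm x)\<^sup>2))) ((pi / a) powr (3/2))"
proof -
  have e: "exp (- (a * (norm x)\<^sup>2)) = (\<Prod>b\<in>Basis. exp (- (a * (x \<bullet> b)\<^sup>2)))" for x :: "real ^ 3"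
    using norm_square_components[of "\<lambda>x. x" x]
    by (simp add: exp_sum[symmetric] sum_negf sum_distrib_left)
  have "(\<integral>\<^sup>+ x. ennreal (exp (- (a * (norm (x::real^3))\<^sup>2))) \<partial>lborel) =
      (\<integral>\<^sup>+ x. (\<Prod>b\<in>Basis. ennreal (exp (- (a * ((x::real^3) \<bullet> b)\<^sup>2)))) \<partial>lborel)"
    unfolding e by (simp add: prod_ennreal)
  also have "\<dots> = (\<Prod>b\<in>(Basis :: (real^3) set). \<integral>\<^sup>+ t. ennreal (exp (- (a * t\<^sup>2))) \<partial>lborel)"
    by (rule nn_integral_lborel_prod) auto
  also have "\<dots> = ennreal ((pi / a) powr (3/2))"
    using a by (simp add: gaussian_line powr_three_halves ennreal_power)
  finally have "(\<integral>\<^sup>+ x. ennreal (exp (- (a * (norm (x::real^3))\<^sup>2))) \<partial>lborel) = ennreal ((pi / a) powr (3/2))" .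
  then show ?thesis
    by (intro has_bochner_integral_nn_integral) auto
qed

text \<open>
  Each \<open>(x \<bullet> b)\<^sup>2\<close> contributes a product of one-dimensional integrals in which a single factor is a
  second moment.
\<close>

lemma gaussian_second_moment:
  fixes a :: real
  assumes a: "0 < a"
  shows "has_bochner_integral lborel (\<lambda>x::real^3. (norm x)\<^sup>2 * exp (- (a * (norm x)\<^sup>2)))
      (3 / (2 * a) * (pi / a) powr (3/2))"
proof -
  define f where "f b b' t = (if b' = b then t\<^sup>2 * exp (- (a * t\<^sup>2)) else exp (- (a * t\<^sup>2)))"
    for b b' :: "real ^ 3" and t :: real
  have e: "(x \<bullet> b)\<^sup>2 * exp (- (a * (norm x)\<^sup>2)) = (\<Prod>b'\<in>Basis. f b b' (x \<bullet> b'))" if b: "b \<in> Basis" for x b :: "real ^ 3"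
  proof -
    have "exp (- (a * (norm x)\<^sup>2)) = (\<Prod>b\<in>Basis. exp (- (a * (x \<bullet> b)\<^sup>2)))"
      using norm_square_components[of "\<lambda>x. x" x]
      by (simp add: exp_sum[symmetric] sum_negf sum_distrib_left)
    also have "\<dots> = exp (- (a * (x \<bullet> b)\<^sup>2)) * (\<Prod>b'\<in>Basis - {b}. exp (- (a * (x \<bullet> b')\<^sup>2)))"
      using b by (subst prod.remove[of _ b]) auto
    also have "(\<Prod>b'\<in>Basis - {b}. exp (- (a * (x \<bullet> b')\<^sup>2))) = (\<Prod>b'\<in>Basis - {b}. f b b' (x \<bullet> b'))"
      by (rule prod.cong) (auto simp: f_def)
    finally have "(x \<bullet> b)\<^sup>2 * exp (- (a * (norm x)\<^sup>2)) = f b b (x \<bullet> b) * (\<Prod>b'\<in>Basis - {b}. f b b' (x \<bullet> b'))"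
      by (simp add: f_def)
    also have "\<dots> = (\<Prod>b'\<in>Basis. f b b' (x \<bullet> b'))"
      by (rule prod.remove[symmetric]) (use b in auto)
    finally show ?thesis .
  qed
  have one: "(\<integral>\<^sup>+ x. ennreal ((x \<bullet> b)\<^sup>2 * exp (- (a * (norm x)\<^sup>2))) \<partial>lborel) = ennreal ((pi / a) powr (3/2) / (2 * a))"
    if b: "b \<in> Basis" for b :: "real ^ 3"
  proof -
    have "(\<integral>\<^sup>+ x. ennreal ((x \<bullet> b)\<^sup>2 * exp (- (a * (norm x)\<^sup>2))) \<partial>lborel) =
        (\<integral>\<^sup>+ x. (\<Prod>b'\<in>Basis. ennreal (f b b' (x \<bullet> b'))) \<partial>lborel)"
      unfolding e[OF b] by (subst prod_ennreal) (auto simp: f_def)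
    also have "\<dots> = (\<Prod>b'\<in>Basis. \<integral>\<^sup>+ t. ennreal (f b b' t) \<partial>lborel)"
      by (rule nn_integral_lborel_prod) (auto simp: f_def)
    also have "\<dots> = (\<integral>\<^sup>+ t. ennreal (f b b t) \<partial>lborel) * (\<Prod>b'\<in>Basis - {b}. \<integral>\<^sup>+ t. ennreal (f b b' t) \<partial>lborel)"
      using b by (subst prod.remove[of _ b]) auto
    also have "(\<Prod>b'\<in>Basis - {b}. \<integral>\<^sup>+ t. ennreal (f b b' t) \<partial>lborel) = (\<Prod>b'\<in>Basis - {b}. ennreal (sqrt (pi / a)))"
      by (rule prod.cong) (auto simp: f_def gaussian_line[OF a])
    also have "\<dots> = ennreal (sqrt (pi / a)) ^ 2"
      using b by (simp add: card_Diff_singleton)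
    also have "(\<integral>\<^sup>+ t. ennreal (f b b t) \<partial>lborel) = ennreal (sqrt (pi / a) / (2 * a))"
      by (simp add: f_def gaussian_line[OF a])
    also have "ennreal (sqrt (pi / a) / (2 * a)) * ennreal (sqrt (pi / a)) ^ 2 = ennreal (sqrt (pi / a) / (2 * a) * sqrt (pi / a) ^ 2)"
      using a by (subst ennreal_power, simp, subst ennreal_mult) auto
    also have "sqrt (pi / a) / (2 * a) * sqrt (pi / a) ^ 2 = (pi / a) powr (3/2) / (2 * a)"
      using a by (simp only: powr_three_halves divide_pos_pos pi_gt_zero power3_eq_cube power2_eq_square) (simp add: mult_ac)
    finally show ?thesis .
  qed
  have "(\<integral>\<^sup>+ x. ennreal ((norm (x::real^3))\<^sup>2 * exp (- (a * (norm x)\<^sup>2))) \<partial>lborel) =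
     (\<integral>\<^sup>+ x. (\<Sum>b\<in>Basis. ennreal (((x::real^3) \<bullet> b)\<^sup>2 * exp (- (a * (norm x)\<^sup>2)))) \<partial>lborel)"
  proof (rule nn_integral_cong)
    fix x :: "real ^ 3"
    have "(norm x)\<^sup>2 * exp (- (a * (norm x)\<^sup>2)) = (\<Sum>b\<in>Basis. (x \<bullet> b)\<^sup>2 * exp (- (a * (norm x)\<^sup>2)))"
      unfolding sum_distrib_right[symmetric] using norm_square_components[of "\<lambda>x. x" x] by simp
    then show "ennreal ((norm x)\<^sup>2 * exp (- (a * (norm x)\<^sup>2))) = (\<Sum>b\<in>Basis. ennreal ((x \<bullet> b)\<^sup>2 * exp (- (a * (norm x)\<^sup>2))))"
      by (simp add: sum_ennreal)
  qed
  also have "\<dots> = (\<Sum>b\<in>(Basis :: (real^3) set). ennreal ((pi / a) powr (3/2) / (2 * a)))"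
    by (subst nn_integral_sum) (auto simp: one)
  also have "\<dots> = of_nat 3 * ennreal ((pi / a) powr (3/2) / (2 * a))" by simp
  also have "\<dots> = ennreal (3 / (2 * a) * (pi / a) powr (3/2))"
    using a by (simp add: ennreal_mult[symmetric] flip: ennreal_numeral)
  finally show ?thesis
    by (intro has_bochner_integral_nn_integral) (use a in auto)
qed

lemma locally_integrable_continuous:
  fixes f :: "'a::euclidean_space \<Rightarrow> 'b::euclidean_space"
  assumes "continuous_on UNIV f"
  shows "locally_integrable f"
  unfolding locally_integrable_def set_integrable_def
proof (intro allI impI)
  fix K :: "'a set" assume K: "compact K"
  have i: "integrable lborel (\<lambda>x. indicator K x *\<^sub>R f x)"
    by (rule borel_integrable_compact[OF K continuous_on_subset[OF assms]]) simp
  then show "integrable lebesgue (\<lambda>x. indicator K x *\<^sub>R f x)"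
    using integrable_completion[of "\<lambda>x. indicator K x *\<^sub>R f x" lborel] borel_measurable_integrable[OF i] by blast
qed

definition gauss :: "real \<Rightarrow> real \<Rightarrow> real ^ 3 \<Rightarrow> real" where
  "gauss A s x = A * exp (- (s\<^sup>2 / 2 * (norm x)\<^sup>2))"

lemma continuous_gauss: "continuous_on UNIV (gauss A s)"
  unfolding gauss_def[abs_def] by (intro continuous_intros)

lemma gauss_power: "gauss A s x ^ n = A ^ n * exp (- (real n * s\<^sup>2 / 2 * (norm x)\<^sup>2))"
  by (simp add: gauss_def power_mult_distrib exp_of_nat_mult[symmetric] mult_ac)

lemma gauss_line_derivative:
  "((\<lambda>t. gauss A s (x + t *\<^sub>R b)) has_real_derivative
      (- (s\<^sup>2 * gauss A s (x + t *\<^sub>R b)) *\<^sub>R (x + t *\<^sub>R b)) \<bullet> b) (at t)"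
proof -
  have n: "(norm (x + t *\<^sub>R b))\<^sup>2 = x \<bullet> x + 2 * t * (x \<bullet> b) + t\<^sup>2 * (b \<bullet> b)" for t
    unfolding power2_norm_eq_inner
    by (simp add: inner_add_left inner_add_right inner_commute power2_eq_square algebra_simps)
  have "((\<lambda>t. A * exp (- (s\<^sup>2 / 2 * (x \<bullet> x + 2 * t * (x \<bullet> b) + t\<^sup>2 * (b \<bullet> b))))) has_real_derivative
     - (s\<^sup>2 * (A * exp (- (s\<^sup>2 / 2 * (x \<bullet> x + 2 * t * (x \<bullet> b) + t\<^sup>2 * (b \<bullet> b)))))) * (x \<bullet> b + t * (b \<bullet> b))) (at t)"
    by (auto intro!: derivative_eq_intros simp: algebra_simps)
  then show ?thesis
    unfolding gauss_def n by (simp add: inner_add_left)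
qed

lemma gauss_weak_gradient: "is_weak_gradient (gauss A s) (\<lambda>x. - (s\<^sup>2 * gauss A s x) *\<^sub>R x)"
proof -
  have cg: "continuous_on UNIV (\<lambda>x. - (s\<^sup>2 * gauss A s x) *\<^sub>R x)"
    by (intro continuous_intros continuous_gauss)
  have "(LINT x|lebesgue. gauss A s x * frechet_derivative \<phi> (at x) b) =
        - (LINT x|lebesgue. ((- (s\<^sup>2 * gauss A s x) *\<^sub>R x) \<bullet> b) * \<phi> x)"
    if \<phi>: "test_function \<phi>" and b: "b \<in> Basis" for \<phi> b
  proof -
    from \<phi> have "C_times (Suc 0) \<phi>" unfolding test_function_def by blast
    then have diff: "\<phi> differentiable_on UNIV" and cont': "continuous_on UNIV (\<lambda>x. frechet_derivative \<phi> (at x) b)"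
      using b by auto
    have m: "(\<lambda>x. gauss A s x * frechet_derivative \<phi> (at x) b) \<in> borel_measurable borel"
      "(\<lambda>x. ((- (s\<^sup>2 * gauss A s x) *\<^sub>R x) \<bullet> b) * \<phi> x) \<in> borel_measurable borel"
      by (intro borel_measurable_continuous_onI continuous_intros continuous_gauss cont' differentiable_imp_continuous_on[OF diff])+
    have "weak_partial b (gauss A s) (\<lambda>x. (- (s\<^sup>2 * gauss A s x) *\<^sub>R x) \<bullet> b)"
      by (rule weak_partial_classical[OF b continuous_gauss _ gauss_line_derivative])
         (intro continuous_intros continuous_gauss)
    then show ?thesis
      using \<phi> m unfolding weak_partial_def by (simp add: integral_completion)
  qed
  then show ?thesis
    unfolding is_weak_gradient_def
    using locally_integrable_continuous[OF continuous_gauss] locally_integrable_continuous[OF cg] by blast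
qed

text \<open>
  The amplitude is chosen so that the mass is \<open>c\<close>. The integral of the power of \<open>U\<close> is compared with
  the stated expression through logarithms, where all exponents become linear.
\<close>

theorem gaussian_energy:
  fixes c s p :: real
  assumes c: "0 < c" and s: "0 < s" and p: "0 < p"
  defines "U \<equiv> gauss (sqrt c * (s\<^sup>2 / pi) powr (3/4)) s"
  shows "U \<in> mass_sphere c"
    and "energy p U = s ^ 2 * (3 * c / 4) + s ^ 5 * (3 * c\<^sup>2 / (8 * sqrt 2 * pi powr (3/2)))
       - s powr (3 * (p - 1) / 2) *
           (2 * sqrt 2 * c powr ((p + 1) / 2) * pi powr (3/2 - 3 * (p + 1) / 4) / (p + 1) powr (5/2))"
proof -
  define A where "A = sqrt c * (s\<^sup>2 / pi) powr (3/4)"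
  have A: "0 < A" using c s by (simp add: A_def)
  have U: "U = gauss A s" by (simp add: U_def A_def)
  define q where "q = (s\<^sup>2 / pi) powr (3/2)"
  have q: "0 < q" using s by (simp add: q_def)
  have A2: "A\<^sup>2 = c * q"
    using c by (simp add: A_def q_def power_mult_distrib powr_nth_power)
  have qi: "(pi / s\<^sup>2) powr (3/2) = 1 / q"
    using s by (simp add: q_def powr_divide)
  define J where "J a = (pi / a) powr (3/2)" for a :: real
  have Js: "q * J (s\<^sup>2) = 1" using q by (simp add: J_def qi)
  have leb: "has_bochner_integral lebesgue f z" if "has_bochner_integral lborel f z" for f :: "real^3 \<Rightarrow> real" and z
    using that by (auto simp: has_bochner_integral_iff integrable_completion integral_completion dest: borel_measurable_integrable)
  have mass: "has_bochner_integral lebesgue (\<lambda>x. (U x)\<^sup>2) c"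
  proof -
    have "has_bochner_integral lborel (\<lambda>x::real^3. A\<^sup>2 * exp (- (s\<^sup>2 * (norm x)\<^sup>2))) (A\<^sup>2 * J (s\<^sup>2))"
      unfolding J_def using s by (intro has_bochner_integral_mult_right gaussian_mass) simp
    moreover have "A\<^sup>2 * J (s\<^sup>2) = c" using A2 Js by simp
    ultimately show ?thesis
      unfolding U gauss_power[of A s _ 2] by (intro leb) simp
  qed
  define g where "g x = - (s\<^sup>2 * U x) *\<^sub>R x" for x
  have wg: "is_weak_gradient U g" unfolding U g_def by (rule gauss_weak_gradient)
  have cU: "continuous_on UNIV U" unfolding U by (rule continuous_gauss)
  have cg: "continuous_on UNIV g" unfolding g_def[abs_def] by (intro continuous_intros cU)
  have lm: "f \<in> borel_measurable lebesgue" if "continuous_on UNIV f" for f :: "real^3 \<Rightarrow> 'z::euclidean_space"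
    using borel_measurable_continuous_onI[OF that] by (simp add: measurable_completion)
  have ng: "(norm (g x))\<^sup>2 = s ^ 4 * (U x)\<^sup>2 * (norm x)\<^sup>2" for x
    by (simp add: g_def power_mult_distrib)
  have grad: "has_bochner_integral lebesgue (\<lambda>x. (norm (g x))\<^sup>2) (3 / 2 * c * s\<^sup>2)"
  proof -
    have "has_bochner_integral lborel (\<lambda>x::real^3. s ^ 4 * A\<^sup>2 * ((norm x)\<^sup>2 * exp (- (s\<^sup>2 * (norm x)\<^sup>2))))
        (s ^ 4 * A\<^sup>2 * (3 / (2 * s\<^sup>2) * J (s\<^sup>2)))"
      unfolding J_def using s by (intro has_bochner_integral_mult_right gaussian_second_moment) simp
    moreover have "s ^ 4 * A\<^sup>2 * (3 / (2 * s\<^sup>2) * J (s\<^sup>2)) = 3 / 2 * c * s\<^sup>2"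
    proof -
      have "s ^ 4 * A\<^sup>2 * (3 / (2 * s\<^sup>2) * J (s\<^sup>2)) = s ^ 4 * c * (3 / (2 * s\<^sup>2)) * (q * J (s\<^sup>2))" by (simp add: A2)
      then show ?thesis unfolding Js using s by (simp add: field_simps power2_eq_square power4_eq_xxxx)
    qed
    moreover have "s ^ 4 * (U x)\<^sup>2 * (norm x)\<^sup>2 = s ^ 4 * A\<^sup>2 * ((norm x)\<^sup>2 * exp (- (s\<^sup>2 * (norm x)\<^sup>2)))" for x
      unfolding U gauss_power[of A s _ 2] by simp
    ultimately show ?thesis unfolding ng by (intro leb) (simp only:)
  qed
  have quasi: "has_bochner_integral lebesgue (\<lambda>x. (U x)\<^sup>2 * (norm (g x))\<^sup>2) (s ^ 5 * (3 * c\<^sup>2 / (8 * sqrt 2 * pi powr (3/2))))"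
  proof -
    have "has_bochner_integral lborel (\<lambda>x::real^3. s ^ 4 * A ^ 4 * ((norm x)\<^sup>2 * exp (- (2 * s\<^sup>2 * (norm x)\<^sup>2))))
        (s ^ 4 * A ^ 4 * (3 / (2 * (2 * s\<^sup>2)) * J (2 * s\<^sup>2)))"
      unfolding J_def using s by (intro has_bochner_integral_mult_right gaussian_second_moment) simp
    moreover have "s ^ 4 * A ^ 4 * (3 / (2 * (2 * s\<^sup>2)) * J (2 * s\<^sup>2)) = s ^ 5 * (3 * c\<^sup>2 / (8 * sqrt 2 * pi powr (3/2)))"
    proof -
      have "A ^ 4 = c\<^sup>2 * q * q" using A2 by (metis power2_eq_square mult.assoc mult.left_commute power_mult_distrib power_mult num_double numeral_times_numeral)
      moreover have "J (2 * s\<^sup>2) = J (s\<^sup>2) / (2 * sqrt 2)"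
      proof -
        have "J (2 * s\<^sup>2) = (pi / s\<^sup>2) powr (3/2) / 2 powr (3/2)"
          unfolding J_def using s by (simp add: powr_divide powr_mult)
        then show ?thesis by (simp add: J_def powr_three_halves power3_eq_cube)
      qed
      ultimately have "s ^ 4 * A ^ 4 * (3 / (2 * (2 * s\<^sup>2)) * J (2 * s\<^sup>2)) =
          s ^ 4 * c\<^sup>2 * (3 / (4 * s\<^sup>2)) * q * (q * J (s\<^sup>2)) / (2 * sqrt 2)" by simp
      also have "\<dots> = s ^ 4 * c\<^sup>2 * (3 / (4 * s\<^sup>2)) * q / (2 * sqrt 2)" unfolding Js by simp
      also have "q = s ^ 3 / pi powr (3/2)"
        unfolding q_def using s by (simp add: powr_divide powr_three_halves)
      finally show ?thesis
        using s by (simp add: field_simps power2_eq_square eval_nat_numeral)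
    qed
    moreover have "(U x)\<^sup>2 * (s ^ 4 * (U x)\<^sup>2 * (norm x)\<^sup>2) = s ^ 4 * A ^ 4 * ((norm x)\<^sup>2 * exp (- (2 * s\<^sup>2 * (norm x)\<^sup>2)))" for x
    proof -
      have "(U x)\<^sup>2 * (s ^ 4 * (U x)\<^sup>2 * (norm x)\<^sup>2) = s ^ 4 * U x ^ 4 * (norm x)\<^sup>2"
        by (simp add: power2_eq_square power4_eq_xxxx)
      then show ?thesis unfolding U gauss_power by simp
    qed
    ultimately show ?thesis unfolding ng by (intro leb) (simp only:)
  qed
  have UL2: "U \<in> L2" using mass lm[OF cU] by (auto simp: L2_def has_bochner_integral_iff)
  have gL2: "g \<in> L2" using grad lm[OF cg] by (auto simp: L2_def has_bochner_integral_iff)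
  have UH: "U \<in> H1" using UL2 gL2 wg by (auto simp: H1_def)
  have ae: "AE x in lebesgue. weak_grad U x = g x"
    by (rule AE_completion[OF weak_grad_AE[OF wg]])
  have wm: "(\<lambda>x. (norm (weak_grad U x))\<^sup>2) \<in> borel_measurable lebesgue"
    by (rule weak_grad_norm_square_measurable[OF UH])
  have wn: "(\<lambda>x. norm (weak_grad U x)) \<in> borel_measurable lebesgue"
    using measurable_compose[OF wm borel_measurable_sqrt] by simp
  have quasi': "has_bochner_integral lebesgue (\<lambda>x. (U x)\<^sup>2 * (norm (weak_grad U x))\<^sup>2) (s ^ 5 * (3 * c\<^sup>2 / (8 * sqrt 2 * pi powr (3/2))))"
  proof -
    have m: "(\<lambda>x. (U x)\<^sup>2 * (norm (weak_grad U x))\<^sup>2) \<in> borel_measurable lebesgue"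
      using mass by (intro borel_measurable_times wm) (simp add: has_bochner_integral_iff borel_measurable_integrable)
    have "AE x in lebesgue. (U x)\<^sup>2 * (norm (weak_grad U x))\<^sup>2 = (U x)\<^sup>2 * (norm (g x))\<^sup>2"
      using ae by eventually_elim simp
    from has_bochner_integral_cong_AE[OF m borel_measurable_integrable[OF integrable.intros[OF quasi]] this] quasi
    show ?thesis by blast
  qed
  have grad': "has_bochner_integral lebesgue (\<lambda>x. (norm (weak_grad U x))\<^sup>2) (3 / 2 * c * s\<^sup>2)"
  proof -
    have "AE x in lebesgue. (norm (weak_grad U x))\<^sup>2 = (norm (g x))\<^sup>2"
      using ae by eventually_elim simp
    from has_bochner_integral_cong_AE[OF wm borel_measurable_integrable[OF integrable.intros[OF grad]] this] grad
    show ?thesis by blast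
  qed
  have "(\<lambda>x. U x * norm (weak_grad U x)) \<in> L2"
    unfolding L2_def using quasi' borel_measurable_times[OF lm[OF cU] wn]
    by (simp add: has_bochner_integral_iff power_mult_distrib)
  with UH have UX: "U \<in> X_space" by (simp add: X_space_def)
  have "(L2_norm U)\<^sup>2 = c"
    unfolding L2_norm_def using mass c by (simp add: has_bochner_integral_iff)
  with UX show "U \<in> mass_sphere c" by (simp add: mass_sphere_def)
  have kin: "(LINT x|lebesgue. (1 + 2 * (U x)\<^sup>2) * (norm (weak_grad U x))\<^sup>2) =
      3 / 2 * c * s\<^sup>2 + 2 * (s ^ 5 * (3 * c\<^sup>2 / (8 * sqrt 2 * pi powr (3/2))))"
  proof -
    have "(LINT x|lebesgue. (1 + 2 * (U x)\<^sup>2) * (norm (weak_grad U x))\<^sup>2) =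
       (LINT x|lebesgue. (norm (weak_grad U x))\<^sup>2 + 2 * ((U x)\<^sup>2 * (norm (weak_grad U x))\<^sup>2))"
      by (simp add: algebra_simps)
    also have "\<dots> = (LINT x|lebesgue. (norm (weak_grad U x))\<^sup>2) + 2 * (LINT x|lebesgue. (U x)\<^sup>2 * (norm (weak_grad U x))\<^sup>2)"
      using grad' quasi' by (simp add: has_bochner_integral_iff)
    finally show ?thesis using grad' quasi' by (simp add: has_bochner_integral_iff)
  qed
  have pot: "(LINT x|lebesgue. \<bar>U x\<bar> powr (p + 1)) = (p + 1) * (s powr (3 * (p - 1) / 2) *
           (2 * sqrt 2 * c powr ((p + 1) / 2) * pi powr (3/2 - 3 * (p + 1) / 4) / (p + 1) powr (5/2)))"
  proof -
    have "\<bar>U x\<bar> powr (p + 1) = A powr (p + 1) * exp (- ((p + 1) * s\<^sup>2 / 2 * (norm x)\<^sup>2))" for x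
    proof -
      have "\<bar>U x\<bar> powr (p + 1) = A powr (p + 1) * exp (- (s\<^sup>2 / 2 * (norm x)\<^sup>2)) powr (p + 1)"
        unfolding U gauss_def using A by (simp add: abs_mult powr_mult)
      moreover have "exp y powr (p + 1) = exp ((p + 1) * y)" for y :: real
        by (simp add: powr_def)
      ultimately show ?thesis by simp
    qed
    moreover have "has_bochner_integral lborel (\<lambda>x::real^3. A powr (p + 1) * exp (- ((p + 1) * s\<^sup>2 / 2 * (norm x)\<^sup>2)))
        (A powr (p + 1) * J ((p + 1) * s\<^sup>2 / 2))"
      unfolding J_def using s p by (intro has_bochner_integral_mult_right gaussian_mass) simp
    ultimately have "has_bochner_integral lebesgue (\<lambda>x. \<bar>U x\<bar> powr (p + 1)) (A powr (p + 1) * J ((p + 1) * s\<^sup>2 / 2))"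
      by (intro leb) (simp only:)
    then have "(LINT x|lebesgue. \<bar>U x\<bar> powr (p + 1)) = A powr (p + 1) * J ((p + 1) * s\<^sup>2 / 2)"
      by (rule has_bochner_integral_integral_eq)
    also have "\<dots> = exp (ln (A powr (p + 1) * J ((p + 1) * s\<^sup>2 / 2)))"
      using A s p by (simp add: J_def)
    also have "ln (A powr (p + 1) * J ((p + 1) * s\<^sup>2 / 2)) = ln ((p + 1) * (s powr (3 * (p - 1) / 2) *
           (2 * sqrt 2 * c powr ((p + 1) / 2) * pi powr (3/2 - 3 * (p + 1) / 4) / (p + 1) powr (5/2))))"
    proof -
      have "ln A = ln c / 2 + 3/4 * (2 * ln s - ln pi)"
        unfolding A_def using c s by (simp add: ln_mult ln_powr ln_sqrt ln_div ln_realpow)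
      moreover have "ln (A powr q * J (q * s\<^sup>2 / 2)) = q * ln A + 3/2 * (ln pi - (ln q + 2 * ln s - ln 2))"
        if "0 < q" for q
        using A s that by (simp add: J_def ln_mult ln_powr ln_div ln_realpow)
      moreover have "ln (q * (s powr k * (2 * sqrt 2 * c powr a * pi powr b / q powr (5/2)))) =
          ln q + (k * ln s + (ln 2 + ln 2 / 2 + a * ln c + b * ln pi - 5/2 * ln q))" if "0 < q" for q k a b
        using c s that by (simp add: ln_mult ln_powr ln_div ln_sqrt)
      moreover have "0 < p + 1" using p by simp
      ultimately show ?thesis by (simp only:) (simp add: field_simps)
    qed
    also have "exp \<dots> = (p + 1) * (s powr (3 * (p - 1) / 2) *
           (2 * sqrt 2 * c powr ((p + 1) / 2) * pi powr (3/2 - 3 * (p + 1) / 4) / (p + 1) powr (5/2)))"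
      using c s p by simp
    finally show ?thesis .
  qed
  show "energy p U = s ^ 2 * (3 * c / 4) + s ^ 5 * (3 * c\<^sup>2 / (8 * sqrt 2 * pi powr (3/2)))
       - s powr (3 * (p - 1) / 2) *
           (2 * sqrt 2 * c powr ((p + 1) / 2) * pi powr (3/2 - 3 * (p + 1) / 4) / (p + 1) powr (5/2))"
  proof -
    have "1 / 2 * (3 / 2 * c * s\<^sup>2 + 2 * Y) - 1 / (p + 1) * ((p + 1) * Z) = s ^ 2 * (3 * c / 4) + Y - Z" for Y Z
      using p by (simp add: field_simps)
    then show ?thesis unfolding energy_def kin pot .
  qed
qed

section \<open>Numerical constants and lower bounds\<close>

lemma arctan_bounds:
  fixes x :: real
  assumes x: "0 \<le> x"
  shows "x - x^3/3 + x^5/5 - x^7/7 \<le> arctan x" "arctan x \<le> x - x^3/3 + x^5/5 - x^7/7 + x^9/9"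
    and "x - x^3/3 \<le> arctan x" "arctan x \<le> x"
proof -
  have mono: "f 0 \<le> f x" if "\<And>t. (f has_real_derivative f' t) (at t)" "\<And>t. 0 \<le> f' t" for f f' :: "real \<Rightarrow> real"
    by (rule DERIV_nonneg_imp_nondecreasing[OF x]) (use that in blast)
  have pos: "0 < 1 + t\<^sup>2" for t :: real by (simp add: add_pos_nonneg)
  have geo3: "(1 - t^2) * (1 + t\<^sup>2) = 1 - t^4" for t :: real
    by (simp add: algebra_simps flip: power_add)
  have geo7: "(1 - t^2 + t^4 - t^6) * (1 + t\<^sup>2) = 1 - t^8" for t :: real
    by (simp add: algebra_simps flip: power_add)
  have geo9: "(1 - t^2 + t^4 - t^6 + t^8) * (1 + t\<^sup>2) = 1 + t^10" for t :: real
    by (simp add: algebra_simps flip: power_add)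
  define P7 where "P7 x = x - x^3/3 + x^5/5 - x^7/7" for x :: real
  have d7: "(P7 has_real_derivative (1 - t^2 + t^4 - t^6)) (at t)" for t
    unfolding P7_def by (auto intro!: derivative_eq_intros)
  have d9: "((\<lambda>x. P7 x + x^9/9) has_real_derivative (1 - t^2 + t^4 - t^6 + t^8)) (at t)" for t
    by (auto intro!: derivative_eq_intros d7)
  have d3: "((\<lambda>x. x - x^3/3) has_real_derivative (1 - t^2)) (at t)" for t :: real
    by (auto intro!: derivative_eq_intros)
  have "(\<lambda>x. arctan x - P7 x) 0 \<le> (\<lambda>x. arctan x - P7 x) x"
  proof (rule mono)
    show "((\<lambda>x. arctan x - P7 x) has_real_derivative inverse (1 + t\<^sup>2) - (1 - t^2 + t^4 - t^6)) (at t)" for t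
      by (rule DERIV_diff[OF DERIV_arctan d7])
    show "0 \<le> inverse (1 + t\<^sup>2) - (1 - t^2 + t^4 - t^6)" for t :: real
      using pos[of t] geo7[of t] by (simp add: inverse_eq_divide pos_le_divide_eq)
  qed
  then show "x - x^3/3 + x^5/5 - x^7/7 \<le> arctan x" by (simp add: P7_def)
  have "(\<lambda>x. (P7 x + x^9/9) - arctan x) 0 \<le> (\<lambda>x. (P7 x + x^9/9) - arctan x) x"
  proof (rule mono)
    show "((\<lambda>x. (P7 x + x^9/9) - arctan x) has_real_derivative
        (1 - t^2 + t^4 - t^6 + t^8) - inverse (1 + t\<^sup>2)) (at t)" for t
      by (rule DERIV_diff[OF d9 DERIV_arctan])
    show "0 \<le> (1 - t^2 + t^4 - t^6 + t^8) - inverse (1 + t\<^sup>2)" for t :: real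
      using pos[of t] geo9[of t] by (simp add: inverse_eq_divide pos_divide_le_eq)
  qed
  then show "arctan x \<le> x - x^3/3 + x^5/5 - x^7/7 + x^9/9" by (simp add: P7_def)
  have "(\<lambda>x. arctan x - (x - x^3/3)) 0 \<le> (\<lambda>x. arctan x - (x - x^3/3)) x"
  proof (rule mono)
    show "((\<lambda>x. arctan x - (x - x^3/3)) has_real_derivative inverse (1 + t\<^sup>2) - (1 - t^2)) (at t)" for t
      by (rule DERIV_diff[OF DERIV_arctan d3])
    show "0 \<le> inverse (1 + t\<^sup>2) - (1 - t^2)" for t :: real
      using pos[of t] geo3[of t] by (simp add: inverse_eq_divide pos_le_divide_eq)
  qed
  then show "x - x^3/3 \<le> arctan x" by simp
  show "arctan x \<le> x" using x by (rule arctan_le_self)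
qed

text \<open>
  Machin's formula, with the alternating bounds for the arctangent. The approximations of the two
  threshold masses leave little room: the smaller one is \<open>2\<pi>\<^sup>2\<close>, which is \<open>19.739\<close>, so \<open>\<pi>\<close> is needed
  to four digits.
\<close>

lemma pi_bounds: "3.1415 < pi" "pi < 3.1416"
proof -
  define a where "a = arctan (1/5 :: real)"
  define b where "b = arctan (1/239 :: real)"
  have m: "pi = 16 * a - 4 * b" using machin unfolding a_def b_def by linarith
  have "197395/1000000 < a" "a < 1973956/10000000"
    using arctan_bounds(1,2)[of "1/5"] unfolding a_def power_divide power_one by simp_all
  moreover have "4184/1000000 < b" "b < 41842/10000000"
    using arctan_bounds(3,4)[of "1/239"] unfolding b_def power_divide power_one by simp_all
  ultimately show "3.1415 < pi" "pi < 3.1416" unfolding m by simp_all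
qed

text \<open>
  Since \<open>\<Gamma>(3/2) = \<surd>\<pi> / 2\<close>, the sixth power of the Sobolev constant is a rational multiple of a power
  of \<open>\<pi>\<close>.
\<close>

lemma S_sob_power: "0 < S_sob" "S_sob ^ 6 = 16 / (27 * pi ^ 4)"
proof -
  have G: "Gamma (3/2 :: real) = sqrt pi / 2"
  proof -
    have "(1/2 :: real) \<notin> \<int>\<^sub>\<le>\<^sub>0" by (auto dest: nonpos_Ints_nonpos)
    then show ?thesis using Gamma_plus1[of "1/2 :: real"] by (simp add: Gamma_one_half_real)
  qed
  have 1: "(2 powr (1/3)) ^ 6 = (4::real)" by (simp add: powr_nth_power)
  have 2: "sqrt (3 * pi) ^ 6 = 27 * pi ^ 3"
  proof -
    have "sqrt (3 * pi) ^ 6 = ((sqrt (3 * pi))\<^sup>2) ^ 3" by (subst power_mult[symmetric]) simp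
    then show ?thesis by (simp add: power_mult_distrib)
  qed
  have 3: "(Gamma (3/2 :: real) powr (1/3)) ^ 6 = pi / 4"
    unfolding G by (subst powr_nth_power) (simp_all add: power_divide)
  show "0 < S_sob" by (simp add: S_sob_def G)
  have "S_sob ^ 6 = 4 / (27 * pi ^ 3) * (1 / (pi / 4))"
    unfolding S_sob_def power_mult_distrib power_divide 1 2 3 by simp
  then show "S_sob ^ 6 = 16 / (27 * pi ^ 4)" by (simp add: eval_nat_numeral)
qed

lemma K_crit_pos: "0 < K_crit"
  using S_sob_power(1) by (simp add: K_crit_def)

lemma K_crit_cube: "K_crit ^ 3 = 1024 / (27 * pi ^ 4)"
  using S_sob_power(2) by (simp add: K_crit_def power_mult_distrib flip: power_mult)

text \<open>
  The constant \<open>4 \<cdot> 9/50 = 18/25\<close> that \<open>gagliardo_nirenberg_X\<close> provides lies strictly below the one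
  obtained from the best Sobolev constant, which is about \<open>0.730\<close>.
\<close>

lemma K_crit_gt: "18/25 < K_crit"
proof -
  have "pi ^ 4 < (3.15::real) ^ 4" using pi_bounds by (intro power_strict_mono) auto
  then have "pi ^ 4 * 27 * (18/25) ^ 3 < (1024::real)" by (simp add: power_divide)
  then have "(18/25) ^ 3 < K_crit ^ 3"
    unfolding K_crit_cube by (simp add: field_simps)
  then show ?thesis by (rule power_less_imp_less_base) (use K_crit_pos in simp)
qed

text \<open>
  The exponent is the interpolation parameter: \<open>K_const p\<close> arises from \<open>K_crit\<close> by interpolating the
  power \<open>p + 1\<close> of \<open>u\<close> between the mass and the critical power \<open>16/3\<close>.
\<close>

lemma K_const_eq: "K_const p = K_crit powr (3 * (p - 1) / 10)"
proof -
  have "K_crit powr (3 * (p - 1) / 10) = 4 powr (3 * (p - 1) / 10) * (S_sob\<^sup>2) powr (3 * (p - 1) / 10)"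
    by (simp add: K_crit_def powr_mult)
  also have "(S_sob\<^sup>2) powr (3 * (p - 1) / 10) = S_sob powr (3 * (p - 1) / 5)"
  proof -
    have "(S_sob\<^sup>2) powr a = S_sob powr (2 * a)" for a
      using S_sob_power(1) by (simp add: powr_powr flip: powr_numeral)
    moreover have "2 * (3 * (p - 1) / 10) = 3 * (p - 1) / 5" by simp
    ultimately show ?thesis by (simp only:)
  qed
  finally show ?thesis by (simp add: K_const_def algebra_simps)
qed

lemma c_flat_lower_eq: "c_flat_lower = 2 * pi\<^sup>2"
proof -
  have half: "(x\<^sup>2) powr (1/2) = x" if "0 \<le> x" for x :: real
    using that by (simp add: powr_half_sqrt)
  have "c_flat_lower = ((16 / (3 * K_crit)) ^ 3) powr (1/2)"
    using K_crit_pos by (simp add: c_flat_lower_def powr_powr flip: powr_numeral)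
  also have "(16 / (3 * K_crit)) ^ 3 = 4 * pi ^ 4"
    unfolding power_divide power_mult_distrib K_crit_cube by simp
  also have "\<dots> = (2 * pi\<^sup>2)\<^sup>2"
    unfolding power_mult_distrib power_mult[symmetric] by simp
  also have "\<dots> powr (1/2) = 2 * pi\<^sup>2" by (rule half) simp
  finally show ?thesis .
qed

lemma c_flat_lower_approx: "\<bar>c_flat_lower - 1973/100\<bar> < 1/100"
proof -
  have "3.1415\<^sup>2 < pi\<^sup>2" "pi\<^sup>2 < 3.1416\<^sup>2"
    using pi_bounds by (auto intro!: power_strict_mono)
  then show ?thesis unfolding c_flat_lower_eq abs_less_iff by (simp add: power2_eq_square)
qed

lemma c_flat_upper_power: "0 < c_flat_upper" "c_flat_upper ^ 4 = 2 ^ 30 * pi ^ 6 / 3 ^ 9"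
proof -
  show "0 < c_flat_upper" by (simp add: c_flat_upper_def)
  have "(3 powr (3/2)) ^ 4 = (3 ^ 6 :: real)" "((16/3) powr (15/4)) ^ 4 = ((16/3) ^ 15 :: real)"
    "(pi powr (3/2)) ^ 4 = pi ^ 6" "(32 powr (3/2)) ^ 4 = (32 ^ 6 :: real)"
    by (simp_all add: powr_nth_power)
  then have "c_flat_upper ^ 4 = 3 ^ 6 * (16/3) ^ 15 * pi ^ 6 / 32 ^ 6"
    by (simp only: c_flat_upper_def power_mult_distrib power_divide)
  then show "c_flat_upper ^ 4 = 2 ^ 30 * pi ^ 6 / 3 ^ 9" by (simp add: power_divide)
qed

lemma c_flat_upper_approx: "\<bar>c_flat_upper - 8509/100\<bar> < 1/100"
proof -
  have "3.1415 ^ 6 < pi ^ 6" "pi ^ 6 < 3.1416 ^ 6"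
    using pi_bounds by (auto intro!: power_strict_mono)
  then have "(8508/100) ^ 4 < c_flat_upper ^ 4" "c_flat_upper ^ 4 < (851/10) ^ 4"
    unfolding c_flat_upper_power(2) by (simp_all add: power_divide)
  then have "8508/100 < c_flat_upper" "c_flat_upper < 851/10"
    using c_flat_upper_power(1) power_less_imp_less_base[of "8508/100" 4 c_flat_upper]
      power_less_imp_less_base[of c_flat_upper 4 "851/10"] by simp_all
  then show ?thesis unfolding abs_less_iff by linarith
qed

text \<open>
  Hoelder's inequality between the exponents \<open>1\<close> and \<open>8/3\<close>, obtained by integrating the weighted
  inequality of means for the normalised functions.
\<close>

lemma interpolation:
  fixes v :: "'a \<Rightarrow> real"
  assumes v: "integrable M v" and v0: "\<And>x. 0 \<le> v x" and v8: "integrable M (\<lambda>x. v x powr (8/3))"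
    and A: "0 < (LINT x|M. v x)" and t: "0 < t" "t < 1"
  shows "(LINT x|M. v x powr (1 + 5/3 * t)) \<le> (LINT x|M. v x) powr (1 - t) * (LINT x|M. v x powr (8/3)) powr t"
proof -
  define a where "a = (LINT x|M. v x)"
  define b where "b = (LINT x|M. v x powr (8/3))"
  have a: "0 < a" using A by (simp add: a_def)
  have b: "0 < b"
  proof -
    have "b \<noteq> 0"
    proof
      assume "b = 0"
      then have "(LINT x|M. v x powr (8/3)) = 0" by (simp only: b_def)
      then have "AE x in M. v x powr (8/3) = 0"
        by (subst (asm) integral_nonneg_eq_0_iff_AE[OF v8]) simp_all
      then have "AE x in M. v x = 0" by eventually_elim simp
      then have "(LINT x|M. v x) = 0"
        by (subst integral_nonneg_eq_0_iff_AE[OF v]) (simp_all add: v0)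
      then show False using A by simp
    qed
    moreover have "0 \<le> b" unfolding b_def by (intro integral_nonneg_AE) simp
    ultimately show ?thesis by linarith
  qed
  have point: "v x powr (1 + 5/3 * t) \<le> a powr (1 - t) * b powr t * ((1 - t) * (v x / a) + t * (v x powr (8/3) / b))" for x
  proof (cases "v x = 0")
    case False
    then have vx: "0 < v x" using v0[of x] by simp
    have "(v x / a) powr (1 - t) * (v x powr (8/3) / b) powr t \<le> (1 - t) * (v x / a) + t * (v x powr (8/3) / b)"
      by (rule Youngs_inequality_0) (use t vx a b in auto)
    then have "a powr (1 - t) * b powr t * ((v x / a) powr (1 - t) * (v x powr (8/3) / b) powr t)
       \<le> a powr (1 - t) * b powr t * ((1 - t) * (v x / a) + t * (v x powr (8/3) / b))"
      by (rule mult_left_mono) simp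
    moreover have "a powr (1 - t) * b powr t * ((v x / a) powr (1 - t) * (v x powr (8/3) / b) powr t) = v x powr (1 - t) * v x powr (8/3 * t)"
      using vx a b by (simp add: powr_divide powr_powr)
    moreover have "v x powr (1 - t) * v x powr (8/3 * t) = v x powr (1 + 5/3 * t)"
    proof -
      have "1 - t + 8/3 * t = 1 + 5/3 * t" by simp
      then show ?thesis by (simp only: powr_add[symmetric])
    qed
    ultimately show ?thesis by (simp only:)
  qed (use t a b in simp)
  have "(LINT x|M. v x powr (1 + 5/3 * t)) \<le> (LINT x|M. a powr (1 - t) * b powr t * ((1 - t) * (v x / a) + t * (v x powr (8/3) / b)))"
    by (rule integral_mono') (use v v8 point v0 a b t in auto)
  also have "\<dots> = a powr (1 - t) * b powr t * ((1 - t) * (a / a) + t * (b / b))"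
    using v v8 by (simp add: a_def b_def)
  also have "\<dots> = a powr (1 - t) * b powr t" using a b by simp
  finally show ?thesis by (simp add: a_def b_def)
qed

text \<open>
  The left-hand side is the minimum over \<open>y\<close>, attained at \<open>z = (t b)\<^sup>1\<^sup>/\<^sup>(\<^sup>1\<^sup>-\<^sup>t\<^sup>)\<close>; Young's inequality
  with weights \<open>t\<close> and \<open>1 - t\<close> compares a general \<open>y\<close> with that point.
\<close>

lemma power_gap:
  fixes y b t :: real
  assumes y: "0 \<le> y" and b: "0 < b" and t: "0 < t" "t < 1"
  shows "- ((1 - t) / t) * (t * b) powr (1 / (1 - t)) \<le> y - b * y powr t"
proof (cases "y = 0")
  case True
  then show ?thesis using t by simp
next
  case False
  define z where "z = (t * b) powr (1 / (1 - t))"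
  have z: "0 < z" unfolding z_def using t b by simp
  have zt: "z powr (1 - t) = t * b" unfolding z_def using t b by (simp add: powr_powr)
  have "y powr t * z powr (1 - t) \<le> t * y + (1 - t) * z"
    by (rule Youngs_inequality_0) (use t y z False in auto)
  then have "t * (b * y powr t) \<le> t * (y + (1 - t) / t * z)"
  proof -
    assume "y powr t * z powr (1 - t) \<le> t * y + (1 - t) * z"
    moreover have "t * (y + (1 - t) / t * z) = t * y + (1 - t) * z" using t by (simp add: distrib_left)
    ultimately show ?thesis unfolding zt by (simp add: mult_ac)
  qed
  then have "b * y powr t \<le> y + (1 - t) / t * z"
    using t mult_le_cancel_left_pos by blast
  then show ?thesis by (simp add: z_def)
qed

lemma abs_powr_square: "\<bar>u\<bar> powr r = (u\<^sup>2) powr (r / 2)" for u r :: real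
proof (cases "u = 0")
  case False
  then have "(\<bar>u\<bar>\<^sup>2) powr (r / 2) = \<bar>u\<bar> powr r" by (simp add: powr_powr flip: powr_numeral del: power2_abs)
  then show ?thesis by simp
qed simp

lemma energy_split:
  assumes u: "u \<in> mass_sphere c"
  defines "Y \<equiv> LINT x|lebesgue. (u x)\<^sup>2 * (norm (weak_grad u x))\<^sup>2"
  shows "0 \<le> Y" and "(LINT x|lebesgue. (u x)\<^sup>2) = c"
    and "Y - 1 / (p + 1) * (LINT x|lebesgue. (u x)\<^sup>2 powr ((p + 1) / 2)) \<le> energy p u"
proof -
  have uX: "u \<in> X_space" and uc: "(L2_norm u)\<^sup>2 = c" using u by (auto simp: mass_sphere_def)
  have uH: "u \<in> H1" using uX by (simp add: X_space_def)
  show "0 \<le> Y" unfolding Y_def by (intro integral_nonneg_AE) simp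
  have "0 \<le> (LINT x|lebesgue. (u x)\<^sup>2)" by (intro integral_nonneg_AE) simp
  then show "(LINT x|lebesgue. (u x)\<^sup>2) = c" using uc by (simp add: L2_norm_def)
  note i = weak_grad_square_integrable[OF uH] gagliardo_nirenberg_X(2)[OF uX]
  have "(LINT x|lebesgue. (1 + 2 * (u x)\<^sup>2) * (norm (weak_grad u x))\<^sup>2) =
     (LINT x|lebesgue. (norm (weak_grad u x))\<^sup>2 + 2 * ((u x)\<^sup>2 * (norm (weak_grad u x))\<^sup>2))"
    by (simp add: algebra_simps)
  also have "\<dots> = (LINT x|lebesgue. (norm (weak_grad u x))\<^sup>2) + 2 * Y"
    unfolding Y_def using i by simp
  moreover have "0 \<le> (LINT x|lebesgue. (norm (weak_grad u x))\<^sup>2)" by (intro integral_nonneg_AE) simp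
  ultimately show "Y - 1 / (p + 1) * (LINT x|lebesgue. (u x)\<^sup>2 powr ((p + 1) / 2)) \<le> energy p u"
    unfolding energy_def abs_powr_square by simp
qed

text \<open>
  With \<open>Y = \<integral> u\<^sup>2 \<bar>Du\<bar>\<^sup>2\<close> the energy is at least \<open>Y - b Y\<^sup>t\<close>, where \<open>t = 3(p-1)/10 < 1\<close> and \<open>b\<close> depends
  only on \<open>c\<close> and \<open>p\<close>; \<open>power_gap\<close> minimises this over \<open>Y\<close>.
\<close>

theorem energy_lower_bound:
  assumes p: "1 < p" "p < 13/3" and c: "0 < c" and u: "u \<in> mass_sphere c"
  shows "- ((13 - 3 * p) / (3 * (p - 1))) * (10 * (p + 1) / (3 * (p - 1) * K_const p)) powr (10 / (3 * p - 13))
       * c powr ((11 - p) / (13 - 3 * p)) \<le> energy p u"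
proof -
  define t where "t = 3 * (p - 1) / 10"
  define Y where "Y = (LINT x|lebesgue. (u x)\<^sup>2 * (norm (weak_grad u x))\<^sup>2)"
  define I where "I = (LINT x|lebesgue. (u x)\<^sup>2 powr (8/3))"
  have t: "0 < t" "t < 1" using p by (auto simp: t_def)
  have uX: "u \<in> X_space" using u by (simp add: mass_sphere_def)
  note es = energy_split[OF u, folded Y_def]
  have I: "0 \<le> I" unfolding I_def by (intro integral_nonneg_AE) simp
  have "I \<le> 9/50 * c powr (2/3) * (4 * Y)"
    using gagliardo_nirenberg_X(4)[OF uX] unfolding es(2) I_def[symmetric] Y_def[symmetric] .
  also have "\<dots> = 18/25 * (c powr (2/3) * Y)" by simp
  also have "\<dots> \<le> K_crit * (c powr (2/3) * Y)"
    using K_crit_gt es(1) by (intro mult_right_mono) auto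
  finally have IK: "I \<le> K_crit * c powr (2/3) * Y" by (simp add: mult.assoc)
  have "(LINT x|lebesgue. (u x)\<^sup>2 powr ((p + 1) / 2)) = (LINT x|lebesgue. (u x)\<^sup>2 powr (1 + 5/3 * t))"
  proof -
    have "(p + 1) / 2 = 1 + 5/3 * t" by (simp add: t_def field_simps)
    then show ?thesis by (simp only:)
  qed
  also have "\<dots> \<le> c powr (1 - t) * I powr t"
    using interpolation[OF gagliardo_nirenberg_X(1)[OF uX] _ gagliardo_nirenberg_X(3)[OF uX] _ t] c
    unfolding es(2) I_def by simp
  also have "\<dots> \<le> c powr (1 - t) * (K_crit * c powr (2/3) * Y) powr t"
    using I IK t by (intro mult_left_mono powr_mono2) auto
  also have "\<dots> = K_const p * c powr ((11 - p) / 10) * Y powr t"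
  proof -
    have "c powr (1 - t) * (c powr (2/3)) powr t = c powr ((11 - p) / 10)"
    proof -
      have "1 - t + 2/3 * t = (11 - p) / 10" by (simp add: t_def field_simps)
      then show ?thesis by (simp only: powr_powr powr_add[symmetric])
    qed
    moreover have "(K_crit * c powr (2/3) * Y) powr t = K_crit powr t * (c powr (2/3)) powr t * Y powr t"
      using K_crit_pos es(1) by (simp add: powr_mult)
    moreover have "K_const p = K_crit powr t" by (simp only: K_const_eq t_def)
    moreover have "a * (k * d * y) = k * (a * d) * y" for a k d y :: real by simp
    ultimately show ?thesis by (simp only:)
  qed
  finally have pot: "(LINT x|lebesgue. (u x)\<^sup>2 powr ((p + 1) / 2)) \<le> K_const p * c powr ((11 - p) / 10) * Y powr t" .
  define b where "b = K_const p * c powr ((11 - p) / 10) / (p + 1)"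
  have K: "0 < K_const p" using K_crit_pos by (simp add: K_const_eq)
  have b: "0 < b" unfolding b_def using K c p by simp
  have "- ((1 - t) / t) * (t * b) powr (1 / (1 - t)) \<le> Y - b * Y powr t"
    by (rule power_gap[OF es(1) b t])
  also have "b * Y powr t = 1 / (p + 1) * (K_const p * c powr ((11 - p) / 10) * Y powr t)"
    by (simp add: b_def)
  also have "Y - \<dots> \<le> Y - 1 / (p + 1) * (LINT x|lebesgue. (u x)\<^sup>2 powr ((p + 1) / 2))"
    using pot p by (intro diff_left_mono mult_left_mono) auto
  also have "\<dots> \<le> energy p u" by (rule es(3))
  finally have low: "- ((1 - t) / t) * (t * b) powr (1 / (1 - t)) \<le> energy p u" .
  have ratio: "(1 - t) / t = (13 - 3 * p) / (3 * (p - 1))"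
    using p by (simp add: t_def field_simps)
  have gap: "(t * b) powr (1 / (1 - t)) =
      (10 * (p + 1) / (3 * (p - 1) * K_const p)) powr (10 / (3 * p - 13)) * c powr ((11 - p) / (13 - 3 * p))"
  proof -
    define Z where "Z = 10 * (p + 1) / (3 * (p - 1) * K_const p)"
    have Z: "0 < Z" unfolding Z_def using p K by simp
    have e: "1 / (1 - t) = 10 / (13 - 3 * p)" using p by (simp add: t_def field_simps)
    have "t * b = c powr ((11 - p) / 10) / Z"
      using p K by (simp add: t_def b_def Z_def field_simps)
    then have "(t * b) powr (1 / (1 - t)) = c powr ((11 - p) / 10 * (10 / (13 - 3 * p))) / Z powr (10 / (13 - 3 * p))"
      unfolding e using Z c by (simp add: powr_divide powr_powr)
    also have "(11 - p) / 10 * (10 / (13 - 3 * p)) = (11 - p) / (13 - 3 * p)"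
    proof -
      have "x / 10 * (10 / d) = x / d" for x d :: real by simp
      then show ?thesis .
    qed
    also have "Z powr (10 / (13 - 3 * p)) = 1 / Z powr (10 / (3 * p - 13))"
    proof -
      have "10 / (13 - 3 * p) = - (10 / (3 * p - 13))" using p by (simp add: field_simps)
      then show ?thesis by (simp only: powr_minus_divide)
    qed
    finally show ?thesis unfolding Z_def[symmetric] by simp
  qed
  show ?thesis using low unfolding ratio gap by (simp only: mult.assoc)
qed

text \<open>
  At the critical exponent the potential term is bounded linearly by \<open>Y = \<integral> u\<^sup>2 \<bar>Du\<bar>\<^sup>2\<close>, and for \<open>c \<le> c_flat_lower\<close>
  it is strictly smaller than \<open>Y\<close>. Strictness excludes minimisers,
  because \<open>Y\<close> cannot vanish when the mass is positive.
\<close>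

theorem critical_energy_pos:
  assumes c: "0 < c" "c \<le> c_flat_lower" and u: "u \<in> mass_sphere c"
  shows "0 < energy (13/3) u"
proof -
  define Y where "Y = (LINT x|lebesgue. (u x)\<^sup>2 * (norm (weak_grad u x))\<^sup>2)"
  define I where "I = (LINT x|lebesgue. (u x)\<^sup>2 powr (8/3))"
  have uX: "u \<in> X_space" using u by (simp add: mass_sphere_def)
  note es = energy_split[OF u, folded Y_def]
  have I: "I \<le> 18/25 * (c powr (2/3) * Y)"
    using gagliardo_nirenberg_X(4)[OF uX] unfolding es(2) I_def[symmetric] Y_def[symmetric] by linarith
  have "0 < I"
  proof -
    have "I \<noteq> 0"
    proof
      assume "I = 0"
      then have "(LINT x|lebesgue. (u x)\<^sup>2 powr (8/3)) = 0" by (simp only: I_def)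
      then have "AE x in lebesgue. (u x)\<^sup>2 powr (8/3) = 0"
        by (subst (asm) integral_nonneg_eq_0_iff_AE[OF gagliardo_nirenberg_X(3)[OF uX]]) simp_all
      then have "AE x in lebesgue. (u x)\<^sup>2 = 0" by eventually_elim simp
      then have "(LINT x|lebesgue. (u x)\<^sup>2) = 0"
        by (subst integral_nonneg_eq_0_iff_AE[OF gagliardo_nirenberg_X(1)[OF uX]]) simp_all
      then show False using es(2) c by simp
    qed
    moreover have "0 \<le> I" unfolding I_def by (intro integral_nonneg_AE) simp
    ultimately show ?thesis by linarith
  qed
  then have Y: "0 < Y" using I es(1) c by (cases "Y = 0") auto
  have "c powr (2/3) \<le> c_flat_lower powr (2/3)" using c by (intro powr_mono2) auto
  also have "\<dots> = 16 / (3 * K_crit)"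
    using K_crit_pos by (simp add: c_flat_lower_def powr_powr)
  finally have cK: "c powr (2/3) \<le> 16 / (3 * K_crit)" .
  have "3/16 * I \<le> 3/16 * (18/25 * (c powr (2/3) * Y))" by (rule mult_left_mono[OF I]) simp
  also have "\<dots> < 3/16 * (K_crit * (c powr (2/3) * Y))" using K_crit_gt Y c by simp
  also have "\<dots> \<le> 3/16 * (K_crit * (16 / (3 * K_crit) * Y))"
    using cK K_crit_pos Y by (intro mult_left_mono mult_right_mono) auto
  also have "\<dots> = Y" using K_crit_pos by simp
  finally have "0 < Y - 3/16 * I" by simp
  also have "\<dots> \<le> energy (13/3) u" using es(3)[of "13/3"] by (simp add: I_def)
  finally show ?thesis .
qed

section \<open>Upper bounds and the final statement\<close>

text \<open>
  The energy of the Gaussian of mass \<open>c\<close> and inverse width \<open>\<sigma>\<close>.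
\<close>

definition gauss_bound :: "real \<Rightarrow> real \<Rightarrow> real \<Rightarrow> real" where
  "gauss_bound p c \<sigma> = \<sigma>^2 * (3 * c / 4)
             + \<sigma>^5 * (3 * c^2 / (8 * sqrt 2 * pi powr (3/2)))
             - \<sigma> powr (3 * (p - 1) / 2) *
                 (2 * sqrt 2 * c powr ((p + 1) / 2) * pi powr (3/2 - 3 * (p + 1) / 4)
                   / (p + 1) powr (5/2))"

lemma min_energy_le_gauss:
  assumes "0 < p" "0 < c" "0 < \<sigma>"
  shows "min_energy p c \<le> ereal (gauss_bound p c \<sigma>)"
  unfolding min_energy_def gauss_bound_def gaussian_energy(2)[OF assms(2,3,1), symmetric]
  by (rule INF_lower) (rule gaussian_energy(1)[OF assms(2,3,1)])

text \<open>
  Spreading the Gaussian out, \<open>\<sigma> \<rightarrow> 0\<close>, makes its energy tend to zero.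
\<close>

lemma min_energy_nonpos:
  assumes p: "1 < p" and c: "0 < c"
  shows "min_energy p c \<le> 0"
proof -
  have "(gauss_bound p c \<longlongrightarrow> 0^2 * (3 * c / 4)
             + 0^5 * (3 * c^2 / (8 * sqrt 2 * pi powr (3/2)))
             - 0 powr (3 * (p - 1) / 2) *
                 (2 * sqrt 2 * c powr ((p + 1) / 2) * pi powr (3/2 - 3 * (p + 1) / 4)
                   / (p + 1) powr (5/2))) (at_right 0)"
    unfolding gauss_bound_def[abs_def]
    by (intro tendsto_diff tendsto_add tendsto_mult_right tendsto_power tendsto_ident_at
          tendsto_powr'[OF tendsto_ident_at tendsto_const])
       (use p in \<open>auto simp: eventually_at_filter\<close>)
  then have "((\<lambda>\<sigma>. ereal (gauss_bound p c \<sigma>)) \<longlongrightarrow> ereal 0) (at_right 0)"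
    by (intro tendsto_ereal) simp
  then have "min_energy p c \<le> ereal 0"
    by (rule tendsto_lowerbound)
       (use p c min_energy_le_gauss in \<open>auto simp: eventually_at_filter\<close>)
  then show ?thesis by (simp add: zero_ereal_def)
qed

text \<open>
  \<open>\<sigma>\<close> is the critical point of \<open>b \<sigma>\<^sup>5 - a \<sigma>\<^sup>2\<close> on the positive axis.
\<close>

lemma quadratic_quintic_minimum:
  fixes a b :: real
  assumes a: "0 < a" and b: "0 < b"
  defines "\<sigma> \<equiv> (2 * a / (5 * b)) powr (1/3)"
  shows "0 < \<sigma>" "b * \<sigma> ^ 5 - a * \<sigma>\<^sup>2 = - (((2/5) powr (2/3) - (2/5) powr (5/3)) * (a powr (5/3) / b powr (2/3)))"
proof -
  show "0 < \<sigma>" unfolding \<sigma>_def using a b by simp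
  have x: "2 * a / (5 * b) = 2/5 * (a / b)" by simp
  have pw: "\<sigma> ^ n = (2/5) powr r * (a powr r / b powr r)" if "0 < n" "r = 1/3 * real n" for n r
  proof -
    have "\<sigma> ^ n = (2/5 * (a / b)) powr r"
      unfolding \<sigma>_def x that(2) using a b that(1) by (intro powr_nth_power) auto
    then show ?thesis using a b by (simp add: powr_mult powr_divide)
  qed
  have s2: "\<sigma>\<^sup>2 = (2/5) powr (2/3) * (a powr (2/3) / b powr (2/3))"
    and s5: "\<sigma> ^ 5 = (2/5) powr (5/3) * (a powr (5/3) / b powr (5/3))"
    by (rule pw; simp)+
  have a5: "a powr (5/3) = a * a powr (2/3)" using a powr_add[of a 1 "2/3"] by simp
  have b5: "b powr (5/3) = b * b powr (2/3)" using b powr_add[of b 1 "2/3"] by simp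
  show "b * \<sigma> ^ 5 - a * \<sigma>\<^sup>2 = - (((2/5) powr (2/3) - (2/5) powr (5/3)) * (a powr (5/3) / b powr (2/3)))"
    unfolding s2 s5 a5 b5 using b by (simp add: field_simps)
qed

text \<open>
  At \<open>p = 7/3\<close> the potential energy scales like the kinetic term \<open>\<integral> \<bar>Du\<bar>\<^sup>2\<close>, quadratically in \<open>\<sigma>\<close>.
\<close>

lemma gauss_bound_7_3:
  assumes c: "0 < c" and \<sigma>: "0 < \<sigma>"
  shows "gauss_bound (7/3) c \<sigma> = 3 * c\<^sup>2 / (8 * sqrt 2 * pi powr (3/2)) * \<sigma> ^ 5 - (A_const * c powr (5/3) - 3 * c / 4) * \<sigma>\<^sup>2"
proof -
  have e: "(7/3 - 1 :: real) = 4/3" "(7/3 + 1 :: real) = 10/3" by simp_all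
  have "2 * sqrt 2 * c powr (10/3/2) * pi powr (3/2 - 3 * (10/3) / 4) / (10/3) powr (5/2) = A_const * c powr (5/3)"
    using c by (simp add: A_const_def powr_divide powr_minus_divide mult_ac)
  moreover have "\<sigma> powr (3 * (4/3) / 2) = \<sigma>\<^sup>2" using \<sigma> by simp
  ultimately show ?thesis
    unfolding gauss_bound_def e by (simp only:) (simp add: algebra_simps)
qed

lemma B_const_powr:
  assumes c: "0 < c"
  shows "(3 * c\<^sup>2 / (8 * sqrt 2 * pi powr (3/2))) powr (2/3) = B_const * c powr (4/3)"
proof -
  have "8 * sqrt 2 = (2::real) powr (7/2)"
    using powr_add[of "2::real" 3 "1/2"] by (simp add: powr_half_sqrt)
  then have "(3 * c\<^sup>2 / (8 * sqrt 2 * pi powr (3/2))) powr (2/3)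
      = 3 powr (2/3) * (c\<^sup>2) powr (2/3) / ((2 powr (7/2)) powr (2/3) * (pi powr (3/2)) powr (2/3))"
    using c by (simp add: powr_mult powr_divide)
  also have "(c\<^sup>2) powr (2/3) = c powr (4/3)"
    using c by (simp add: powr_powr flip: powr_numeral)
  finally show ?thesis by (simp add: B_const_def powr_powr)
qed

lemma A_const_pos: "0 < A_const" and B_const_pos: "0 < B_const"
  by (simp_all add: A_const_def B_const_def)

text \<open>
  \<open>c_sharp\<close> is the mass at which the coefficient of \<open>\<sigma>\<^sup>2\<close> changes sign; taking logarithms makes the
  comparison linear.
\<close>

lemma c_sharp_excess:
  assumes c: "0 < c" "c_sharp \<le> c"
  shows "0 \<le> A_const * c powr (5/3) - 3 * c / 4"
proof -
  have cs: "0 < c_sharp" by (simp add: c_sharp_def)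
  have "ln c_sharp \<le> ln c" using cs c by simp
  moreover have "ln c_sharp = 3/2 * (5/2 * ln 10 + ln pi - (7/2 * ln 2 + 3/2 * ln 3))"
    by (simp add: c_sharp_def ln_powr ln_div ln_mult)
  moreover have "ln A_const = ln 2 + ln 2 / 2 + 5/2 * ln 3 - (5/2 * ln 10 + ln pi)"
    by (simp add: A_const_def ln_powr ln_div ln_mult ln_sqrt)
  moreover have "ln (A_const * c powr (5/3)) = ln A_const + 5/3 * ln c"
    using A_const_pos c by (simp add: ln_mult ln_powr)
  moreover have "ln (3 * c / 4) = ln 3 + ln c - 2 * ln 2"
  proof -
    have "ln (4::real) = 2 * ln 2" using ln_realpow[of "2::real" 2] by simp
    then show ?thesis using c by (simp add: ln_mult ln_div)
  qed
  ultimately have "ln (3 * c / 4) \<le> ln (A_const * c powr (5/3))" by simp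
  then have "3 * c / 4 \<le> A_const * c powr (5/3)"
    using A_const_pos c by (subst (asm) ln_le_cancel_iff) auto
  then show ?thesis by simp
qed

lemma min_energy_7_3_le:
  assumes c: "0 < c" "c_sharp \<le> c"
  shows "min_energy (7/3) c \<le> ereal (- (((2/5) powr (2/3) - (2/5) powr (5/3))
           * ((A_const * c powr (5/3) - 3 * c / 4) powr (5/3) / (B_const * c powr (4/3)))))"
proof (cases "A_const * c powr (5/3) - 3 * c / 4 = 0")
  case True
  show ?thesis using min_energy_nonpos[of "7/3" c] c unfolding True by (simp add: zero_ereal_def)
next
  case False
  define a where "a = A_const * c powr (5/3) - 3 * c / 4"
  define b where "b = 3 * c\<^sup>2 / (8 * sqrt 2 * pi powr (3/2))"
  define \<sigma> where "\<sigma> = (2 * a / (5 * b)) powr (1/3)"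
  have a: "0 < a" using False c_sharp_excess[OF c] by (simp add: a_def)
  have b: "0 < b" using c by (simp add: b_def)
  note qq = quadratic_quintic_minimum[OF a b, folded \<sigma>_def]
  have "min_energy (7/3) c \<le> ereal (gauss_bound (7/3) c \<sigma>)"
    by (rule min_energy_le_gauss) (use c qq(1) in auto)
  also have "gauss_bound (7/3) c \<sigma> = - (((2/5) powr (2/3) - (2/5) powr (5/3)) * (a powr (5/3) / b powr (2/3)))"
    using gauss_bound_7_3[OF c(1) qq(1)] qq(2) by (simp only: a_def[symmetric] b_def[symmetric])
  also have "b powr (2/3) = B_const * c powr (4/3)"
    unfolding b_def by (rule B_const_powr[OF c(1)])
  finally show ?thesis by (simp only: a_def)
qed

lemma gauss_coefficient_pos: "0 < (2/5) powr (2/3) - (2/5 :: real) powr (5/3)"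
  using powr_less_mono'[of "2/5 :: real" "2/3" "5/3"] by simp

text \<open>
  Once \<open>A_const * c powr (2/3) \<ge> 3/2\<close>, at least half of the term \<open>A_const * c powr (5/3)\<close> survives the
  subtraction.
\<close>

lemma min_energy_7_3_large:
  "\<exists>M>0. \<forall>\<^sub>F c in at_top. min_energy (7/3) c \<le> ereal (- M * c powr (13/9))"
proof -
  define k where "k = (2/5) powr (2/3) - (2/5 :: real) powr (5/3)"
  define M where "M = k * ((A_const / 2) powr (5/3) / B_const)"
  define c1 where "c1 = max c_sharp ((3 / (2 * A_const)) powr (3/2))"
  have k: "0 < k" unfolding k_def by (rule gauss_coefficient_pos)
  have M: "0 < M" unfolding M_def using k A_const_pos B_const_pos by simp
  have "min_energy (7/3) c \<le> ereal (- M * c powr (13/9))" if c: "c1 < c" for c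
  proof -
    have cs: "0 < c_sharp" by (simp add: c_sharp_def)
    have c0: "0 < c" "c_sharp \<le> c" "(3 / (2 * A_const)) powr (3/2) \<le> c"
      using c cs by (auto simp: c1_def)
    have "((3 / (2 * A_const)) powr (3/2)) powr (2/3) \<le> c powr (2/3)"
      using c0 by (intro powr_mono2) auto
    then have "3 / (2 * A_const) \<le> c powr (2/3)"
      using A_const_pos by (simp add: powr_powr)
    then have "3 / 4 \<le> A_const / 2 * c powr (2/3)"
      using A_const_pos by (simp add: field_simps)
    then have "3 / 4 * c \<le> A_const / 2 * c powr (2/3) * c"
      using c0 by (intro mult_right_mono) auto
    moreover have "c powr (2/3) * c = c powr (5/3)"
      using c0 powr_add[of c "2/3" 1] by simp
    ultimately have "A_const / 2 * c powr (5/3) \<le> A_const * c powr (5/3) - 3 * c / 4"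
      by (simp add: mult.assoc)
    then have "(A_const / 2 * c powr (5/3)) powr (5/3) \<le> (A_const * c powr (5/3) - 3 * c / 4) powr (5/3)"
      using A_const_pos by (intro powr_mono2) auto
    moreover have "(A_const / 2 * c powr (5/3)) powr (5/3) = (A_const / 2) powr (5/3) * c powr (25/9)"
      using A_const_pos c0 powr_mult[of "A_const / 2" "c powr (5/3)" "5/3"] by (simp add: powr_powr)
    ultimately have "(A_const / 2) powr (5/3) * c powr (25/9) / (B_const * c powr (4/3))
        \<le> (A_const * c powr (5/3) - 3 * c / 4) powr (5/3) / (B_const * c powr (4/3))"
      using B_const_pos by (intro divide_right_mono) auto
    moreover have "(A_const / 2) powr (5/3) * c powr (25/9) / (B_const * c powr (4/3)) = (A_const / 2) powr (5/3) / B_const * c powr (13/9)"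
    proof -
      have "c powr (25/9) = c powr (13/9) * c powr (4/3)"
        by (simp add: powr_add[symmetric])
      then show ?thesis using c0 B_const_pos by simp
    qed
    ultimately have "M * c powr (13/9) \<le> k * ((A_const * c powr (5/3) - 3 * c / 4) powr (5/3) / (B_const * c powr (4/3)))"
      using k unfolding M_def by (simp only: mult.assoc) (rule mult_left_mono; simp)
    then have "ereal (- (k * ((A_const * c powr (5/3) - 3 * c / 4) powr (5/3) / (B_const * c powr (4/3))))) \<le> ereal (- M * c powr (13/9))"
      by simp
    then show ?thesis
      using min_energy_7_3_le[OF c0(1,2)] unfolding k_def by (rule order_trans[rotated])
  qed
  then show ?thesis
    using M by (intro exI[of _ M] conjI eventually_mono[OF eventually_gt_at_top[of c1]])
qed

text \<open>
  At \<open>p = 13/3\<close> the potential energy and \<open>\<integral> u\<^sup>2 \<bar>Du\<bar>\<^sup>2\<close> both scale like \<open>\<sigma>\<^sup>5\<close>. For \<open>c > c_flat_upper\<close> the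
  former has the larger coefficient, so concentrating the Gaussian drives the energy to \<open>-\<infinity>\<close>.
\<close>

lemma min_energy_critical_unbounded:
  assumes c: "c_flat_upper < c"
  shows "min_energy (13/3) c = - \<infinity>"
proof -
  define b where "b = 3 * c\<^sup>2 / (8 * sqrt 2 * pi powr (3/2))"
  define k where "k = 2 * sqrt 2 * c powr (8/3) * pi powr (-5/2) / (16/3) powr (5/2)"
  have c0: "0 < c" using c c_flat_upper_power(1) by simp
  have b: "0 < b" and k: "0 < k" using c0 by (simp_all add: b_def k_def)
  have "b < k"
  proof -
    have ln4: "ln (x * y * z / w) = ln x + ln y + ln z - ln w"
      if "0 < x" "0 < y" "0 < z" "0 < w" for x y z w :: real
      using that by (simp add: ln_mult ln_div)
    have "ln c_flat_upper < ln c" using c c_flat_upper_power(1) by simp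
    moreover have "ln c_flat_upper = 3/2 * ln 3 + 15/4 * ln (16/3) + 3/2 * ln pi - 3/2 * (5 * ln 2)"
    proof -
      have "ln (32::real) = 5 * ln 2" using ln_realpow[of "2::real" 5] by simp
      moreover have "ln c_flat_upper = 3/2 * ln 3 + 15/4 * ln (16/3) + 3/2 * ln pi - 3/2 * ln 32"
        unfolding c_flat_upper_def by (subst ln4) (simp_all add: ln_powr)
      ultimately show ?thesis by simp
    qed
    moreover have "ln k = ln 2 + ln 2 / 2 + 8/3 * ln c - 5/2 * ln pi - 5/2 * ln (16/3)"
      unfolding k_def using c0
      by (subst ln4) (simp_all add: ln_mult[of 2] ln_powr ln_sqrt)
    moreover have "ln b = ln 3 + 2 * ln c - (3 * ln 2 + ln 2 / 2 + 3/2 * ln pi)"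
    proof -
      have "ln (8::real) = 3 * ln 2" using ln_realpow[of "2::real" 3] by simp
      then show ?thesis
        unfolding b_def using c0 by (simp add: ln_mult ln_div ln_powr ln_sqrt ln_realpow)
    qed
    ultimately have "ln b < ln k" by simp
    then show ?thesis using b k by simp
  qed
  have at_critical: "gauss_bound (13/3) c \<sigma> = \<sigma>\<^sup>2 * (3 * c / 4) + \<sigma> ^ 5 * b - \<sigma> ^ 5 * k" if "0 < \<sigma>" for \<sigma>
  proof -
    have e: "(13/3 - 1 :: real) = 10/3" "(13/3 + 1 :: real) = 16/3" by simp_all
    have "\<sigma> powr (3 * (10/3) / 2) = \<sigma> ^ 5" using that by simp
    moreover have "3/2 - 3 * (16/3) / 4 = (-5/2 :: real)" "16/3/2 = (8/3 :: real)" by simp_all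
    ultimately show ?thesis unfolding gauss_bound_def e b_def k_def by (simp only:)
  qed
  have below: "min_energy (13/3) c \<le> ereal y" for y
  proof -
    define a where "a = 3 * c / 4"
    define d where "d = k - b"
    define \<sigma> where "\<sigma> = max 1 ((a + \<bar>y\<bar>) / d)"
    have d: "0 < d" using \<open>b < k\<close> by (simp add: d_def)
    have s1: "1 \<le> \<sigma>" and "(a + \<bar>y\<bar>) / d \<le> \<sigma>" by (simp_all add: \<sigma>_def)
    then have sd: "a + \<bar>y\<bar> \<le> \<sigma> * d" using d by (simp add: divide_le_eq)
    have "\<sigma>\<^sup>2 * a - \<sigma> ^ 5 * d \<le> - \<bar>y\<bar>"
    proof -
      have "\<sigma>\<^sup>2 * (a + \<bar>y\<bar>) \<le> \<sigma>\<^sup>2 * (\<sigma> * d)" using sd by (intro mult_left_mono) auto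
      also have "\<dots> = \<sigma> ^ 3 * d" by (simp add: power2_eq_square power3_eq_cube)
      also have "\<dots> \<le> \<sigma> ^ 5 * d" using s1 d by (intro mult_right_mono power_increasing) auto
      finally have "\<sigma>\<^sup>2 * a + \<sigma>\<^sup>2 * \<bar>y\<bar> \<le> \<sigma> ^ 5 * d" by (simp add: distrib_left)
      moreover have "1 * \<bar>y\<bar> \<le> \<sigma>\<^sup>2 * \<bar>y\<bar>" using s1 by (intro mult_right_mono) (auto simp: one_le_power)
      ultimately show ?thesis by linarith
    qed
    moreover have "gauss_bound (13/3) c \<sigma> = \<sigma>\<^sup>2 * a - \<sigma> ^ 5 * d"
      using at_critical[of \<sigma>] s1 by (simp add: a_def d_def algebra_simps)
    ultimately have "gauss_bound (13/3) c \<sigma> \<le> y" by linarith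
    then have "ereal (gauss_bound (13/3) c \<sigma>) \<le> ereal y" by simp
    moreover have "min_energy (13/3) c \<le> ereal (gauss_bound (13/3) c \<sigma>)"
      by (rule min_energy_le_gauss) (use c0 s1 in auto)
    ultimately show ?thesis by (rule order_trans[rotated])
  qed
  show ?thesis by (rule ereal_bot) (rule below)
qed

lemma min_energy_critical_zero:
  assumes c: "0 < c" "c \<le> c_flat_lower"
  shows "min_energy (13/3) c = 0" "\<not> min_energy_attained (13/3) c"
proof -
  have "0 \<le> min_energy (13/3) c"
    unfolding min_energy_def
    by (rule INF_greatest) (use critical_energy_pos[OF c] in \<open>auto simp: less_imp_le\<close>)
  moreover have "min_energy (13/3) c \<le> 0" by (rule min_energy_nonpos) (use c in auto)
  ultimately show *: "min_energy (13/3) c = 0" by simp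
  show "\<not> min_energy_attained (13/3) c"
    unfolding min_energy_attained_def * using critical_energy_pos[OF c] by fastforce
qed

theorem proposition2p1:
  shows
    "(\<forall>p c. 7/3 \<le> p \<and> p < 13/3 \<and> 0 < c \<longrightarrow>
        min_energy p c \<le>
          (INF \<sigma>\<in>{0<..}. ereal (
             \<sigma>^2 * (3 * c / 4)
             + \<sigma>^5 * (3 * c^2 / (8 * sqrt 2 * pi powr (3/2)))
             - \<sigma> powr (3 * (p - 1) / 2) *
                 (2 * sqrt 2 * c powr ((p + 1) / 2) * pi powr (3/2 - 3 * (p + 1) / 4)
                   / (p + 1) powr (5/2)))))
     \<and> (\<forall>p c. 7/3 \<le> p \<and> p < 13/3 \<and> 0 < c \<longrightarrow>
        min_energy p c \<ge>
          ereal (- ((13 - 3 * p) / (3 * (p - 1)))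
                 * (10 * (p + 1) / (3 * (p - 1) * K_const p)) powr (10 / (3 * p - 13))
                 * c powr ((11 - p) / (13 - 3 * p))))
     \<and> (\<forall>c>0.
          (c \<le> c_sharp \<longrightarrow> min_energy (7/3) c \<le> 0) \<and>
          (c \<ge> c_sharp \<longrightarrow> min_energy (7/3) c \<le>
             ereal (- (((2/5) powr (2/3) - (2/5) powr (5/3))
                       * ((A_const * c powr (5/3) - 3 * c / 4) powr (5/3)
                          / (B_const * c powr (4/3)))))))
     \<and> (\<exists>M>0. \<forall>\<^sub>F c in at_top. min_energy (7/3) c \<le> ereal (- M * c powr (13/9)))
     \<and> \<bar>c_flat_lower - 1973/100\<bar> < 1/100
     \<and> (\<forall>c. 0 < c \<and> c \<le> c_flat_lower \<longrightarrow>
          min_energy (13/3) c = 0 \<and> \<not> min_energy_attained (13/3) c)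
     \<and> \<bar>c_flat_upper - 8509/100\<bar> < 1/100
     \<and> (\<forall>c>c_flat_upper. min_energy (13/3) c = -\<infinity>)"
proof (intro conjI)
  show "\<forall>p c. 7/3 \<le> p \<and> p < 13/3 \<and> 0 < c \<longrightarrow>
        min_energy p c \<le>
          (INF \<sigma>\<in>{0<..}. ereal (
             \<sigma>^2 * (3 * c / 4)
             + \<sigma>^5 * (3 * c^2 / (8 * sqrt 2 * pi powr (3/2)))
             - \<sigma> powr (3 * (p - 1) / 2) *
                 (2 * sqrt 2 * c powr ((p + 1) / 2) * pi powr (3/2 - 3 * (p + 1) / 4)
                   / (p + 1) powr (5/2))))"
    by (intro allI impI, elim conjE, rule INF_greatest, rule min_energy_le_gauss[unfolded gauss_bound_def]) simp_all
  show "\<forall>p c. 7/3 \<le> p \<and> p < 13/3 \<and> 0 < c \<longrightarrow>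
        min_energy p c \<ge>
          ereal (- ((13 - 3 * p) / (3 * (p - 1)))
                 * (10 * (p + 1) / (3 * (p - 1) * K_const p)) powr (10 / (3 * p - 13))
                 * c powr ((11 - p) / (13 - 3 * p)))"
  proof (intro allI impI, elim conjE)
    fix p c :: real assume "7/3 \<le> p" "p < 13/3" "0 < c"
    then show "min_energy p c \<ge>
          ereal (- ((13 - 3 * p) / (3 * (p - 1)))
                 * (10 * (p + 1) / (3 * (p - 1) * K_const p)) powr (10 / (3 * p - 13))
                 * c powr ((11 - p) / (13 - 3 * p)))"
      unfolding min_energy_def
      by (intro INF_greatest, unfold ereal_less_eq) (rule energy_lower_bound; simp)
  qed
  show "\<forall>c>0. (c \<le> c_sharp \<longrightarrow> min_energy (7/3) c \<le> 0) \<and>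
          (c \<ge> c_sharp \<longrightarrow> min_energy (7/3) c \<le>
             ereal (- (((2/5) powr (2/3) - (2/5) powr (5/3))
                       * ((A_const * c powr (5/3) - 3 * c / 4) powr (5/3)
                          / (B_const * c powr (4/3))))))"
    by (intro allI impI conjI min_energy_nonpos min_energy_7_3_le) simp_all
  show "\<exists>M>0. \<forall>\<^sub>F c in at_top. min_energy (7/3) c \<le> ereal (- M * c powr (13/9))"
    by (rule min_energy_7_3_large)
  show "\<bar>c_flat_lower - 1973/100\<bar> < 1/100" by (rule c_flat_lower_approx)
  show "\<forall>c. 0 < c \<and> c \<le> c_flat_lower \<longrightarrow>
          min_energy (13/3) c = 0 \<and> \<not> min_energy_attained (13/3) c"
    using min_energy_critical_zero by blast
  show "\<bar>c_flat_upper - 8509/100\<bar> < 1/100" by (rule c_flat_upper_approx)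
  show "\<forall>c>c_flat_upper. min_energy (13/3) c = -\<infinity>"
    using min_energy_critical_unbounded by blast
qed

end
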